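(* If $\mathcal{Q}$ is a random-free class of graphs, then $|\mathcal{Q}_n|=2^{o(n^2)}$ as $n\to\infty$.
   Context: All graphs are finite and simple; $|G|$ is the number of vertices of $G$. $\mathcal{U}$ is the set of unlabelled graphs (isomorphism classes), and $\mathcal{U}_n$ is the set of those with exactly $n\ge 1$ vertices. A graph class is a subset $\mathcal{Q}\subseteq\mathcal{U}$; $\mathcal{Q}_n:=\mathcal{Q}\cap\mathcal{U}_n$. For graphs $H,G$ with $|H|\le|G|$, $p(H;G)$ is the probability that a uniformly random injective map $\phi:V(H)\to V(G)$ satisfies $uv\in E(H)\iff\phi(u)\phi(v)\in E(G)$ for all $u\ne v$. A graphon is a symmetric measurable function $W:[0,1]^2\to[0,1]$ (functions equal a.e. are identified). For a graphon $W$ and a graph $H$, $$p(H;W):=\mathbb{E}\Big[\prod_{uv\in E(H)}W(X_u,X_v)\prod_{uv\in E(H)^c}(1-W(X_u,X_v))\Big],$$ where $(X_u)_{u\in V(H)}$ are i.i.d. uniform on $[0,1]$ and $E(H)^c=\{uv:u\ne v,\ uv\notin E(H)\}$. Two graphons $W,W'$ are equivalent if $p(H;W)=p(H;W')$ for all graphs $H$; a graph limit $\Gamma$ is an equivalence class of graphons, and $p(H;\Gamma):=p(H;W)$ for any representing $W$. A sequence of graphs $G_i$ converges to $\Gamma$ if $|G_i|\to\infty$ and $p(H;G_i)\to p(H;\Gamma)$ for every graph $H$. $\widehat{\mathcal{Q}}$ is the set of graph limits that are limits of sequences of graphs in $\mathcal{Q}$. A graphon is random-free if it is $\{0,1\}$-valued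 almost everywhere; this is invariant under equivalence, so a graph limit is called random-free if some (equivalently, any) representing graphon is random-free. A class $\mathcal{Q}$ is random-free if every $\Gamma\in\widehat{\mathcal{Q}}$ is random-free. Here $|\mathcal{Q}_n|=2^{o(n^2)}$ is an upper bound on growth: for every $\varepsilon>0$, $|\mathcal{Q}_n|\le2^{\varepsilon n^2}$ for all sufficiently large $n$. *)

theory Defs
  imports "HOL-Probability.Probability"
begin

(* Every finite graph is isomorphic to one with vertices in nat, so fixing the vertex type
   loses no isomorphism class. *)
type_synonym graph = "nat set \<times> nat set set"

definition verts :: "graph \<Rightarrow> nat set" where
  "verts G = fst G"

definition edges :: "graph \<Rightarrow> nat set set" where
  "edges G = snd G"

definition simple_graph :: "graph \<Rightarrow> bool" where
  "simple_graph G \<longleftrightarrow> finite (verts G) \<and> verts G \<noteq> {} \<and>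
     edges G \<subseteq> {{u, v} | u v. u \<in> verts G \<and> v \<in> verts G \<and> u \<noteq> v}"

definition gsize :: "graph \<Rightarrow> nat" where
  "gsize G = card (verts G)"


definition graph_iso :: "(graph \<times> graph) set" where
  "graph_iso = {(G, H). simple_graph G \<and> simple_graph H \<and>
     (\<exists>f. bij_betw f (verts G) (verts H) \<and>
        (\<forall>u\<in>verts G. \<forall>v\<in>verts G. u \<noteq> v \<longrightarrow> ({u, v} \<in> edges G \<longleftrightarrow> {f u, f v} \<in> edges H)))}"

definition iso_class :: "graph \<Rightarrow> graph set" where
  "iso_class G = graph_iso `` {G}"

definition unlabelled_graphs :: "graph set set" where
  "unlabelled_graphs = {G. simple_graph G} // graph_iso"

definition class_level :: "graph set set \<Rightarrow> nat \<Rightarrow> graph set set" where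
  "class_level Q n = {C \<in> Q. \<exists>G\<in>C. gsize G = n}"


definition injections :: "graph \<Rightarrow> graph \<Rightarrow> (nat \<Rightarrow> nat) set" where
  "injections H G = {\<phi> \<in> verts H \<rightarrow>\<^sub>E verts G. inj_on \<phi> (verts H)}"

(* Meaningful only for gsize H \<le> gsize G; otherwise there are no injections and the value is
   unspecified. *)
definition density :: "graph \<Rightarrow> graph \<Rightarrow> real" where
  "density H G = measure_pmf.prob (pmf_of_set (injections H G))
     {\<phi>. \<forall>u\<in>verts H. \<forall>v\<in>verts H. u \<noteq> v \<longrightarrow> ({u, v} \<in> edges H \<longleftrightarrow> {\<phi> u, \<phi> v} \<in> edges G)}"


definition unit_space :: "real measure" where
  "unit_space = restrict_space lborel {0..1}"

(* Values outside the unit square are irrelevant.  Borel measurability is no restriction, as every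
   symmetric Lebesgue measurable kernel agrees almost everywhere with a symmetric Borel one. *)
definition graphon :: "(real \<Rightarrow> real \<Rightarrow> real) \<Rightarrow> bool" where
  "graphon W \<longleftrightarrow>
     (\<lambda>(x, y). W x y) \<in> borel_measurable (unit_space \<Otimes>\<^sub>M unit_space) \<and>
     (\<forall>x\<in>{0..1}. \<forall>y\<in>{0..1}. W x y \<in> {0..1} \<and> W x y = W y x)"

(* The pairs u < v enumerate each unordered pair of vertices once; the order is immaterial by
   symmetry of W. *)
definition graphon_density :: "graph \<Rightarrow> (real \<Rightarrow> real \<Rightarrow> real) \<Rightarrow> real" where
  "graphon_density H W =
     (\<integral>X. (\<Prod>(u, v) \<in> {(u, v). u \<in> verts H \<and> v \<in> verts H \<and> u < v \<and> {u, v} \<in> edges H}.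
              W (X u) (X v)) *
          (\<Prod>(u, v) \<in> {(u, v). u \<in> verts H \<and> v \<in> verts H \<and> u < v \<and> {u, v} \<notin> edges H}.
              1 - W (X u) (X v))
      \<partial>(\<Pi>\<^sub>M u \<in> verts H. unit_space))"

definition graphon_equiv :: "((real \<Rightarrow> real \<Rightarrow> real) \<times> (real \<Rightarrow> real \<Rightarrow> real)) set" where
  "graphon_equiv = {(W, W'). graphon W \<and> graphon W' \<and>
     (\<forall>H. simple_graph H \<longrightarrow> graphon_density H W = graphon_density H W')}"

definition graph_limits :: "(real \<Rightarrow> real \<Rightarrow> real) set set" where
  "graph_limits = {W. graphon W} // graphon_equiv"

definition limit_density :: "graph \<Rightarrow> (real \<Rightarrow> real \<Rightarrow> real) set \<Rightarrow> real" where
  "limit_density H \<Gamma> = graphon_density H (SOME W. W \<in> \<Gamma>)"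

definition converges_to :: "(nat \<Rightarrow> graph) \<Rightarrow> (real \<Rightarrow> real \<Rightarrow> real) set \<Rightarrow> bool" where
  "converges_to G \<Gamma> \<longleftrightarrow> filterlim (\<lambda>i. gsize (G i)) at_top sequentially \<and>
     (\<forall>H. simple_graph H \<longrightarrow> (\<lambda>i. density H (G i)) \<longlonglongrightarrow> limit_density H \<Gamma>)"

definition class_limits :: "graph set set \<Rightarrow> (real \<Rightarrow> real \<Rightarrow> real) set set" where
  "class_limits Q = {\<Gamma> \<in> graph_limits.
     \<exists>G. (\<forall>i. simple_graph (G i) \<and> iso_class (G i) \<in> Q) \<and> converges_to G \<Gamma>}"


definition random_free_graphon :: "(real \<Rightarrow> real \<Rightarrow> real) \<Rightarrow> bool" where
  "random_free_graphon W \<longleftrightarrow> (AE (x, y) in unit_space \<Otimes>\<^sub>M unit_space. W x y \<in> {0, 1})"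

definition random_free_limit :: "(real \<Rightarrow> real \<Rightarrow> real) set \<Rightarrow> bool" where
  "random_free_limit \<Gamma> \<longleftrightarrow> (\<exists>W\<in>\<Gamma>. random_free_graphon W)"

definition random_free_class :: "graph set set \<Rightarrow> bool" where
  "random_free_class Q \<longleftrightarrow> (\<forall>\<Gamma>\<in>class_limits Q. random_free_limit \<Gamma>)"


lemma equiv_graph_iso: "equiv {G. simple_graph G} graph_iso"
proof (rule equivI)
  show "graph_iso \<subseteq> {G. simple_graph G} \<times> {G. simple_graph G}"
    by (auto simp: graph_iso_def)
  show "refl_on {G. simple_graph G} graph_iso"
    by (auto simp: refl_on_def graph_iso_def intro!: exI[of _ id])
  show "sym graph_iso"
  proof (rule symI)
    fix G H assume "(G, H) \<in> graph_iso"
    then obtain f where G: "simple_graph G" "simple_graph H" and f: "bij_betw f (verts G) (verts H)"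
      and e: "\<And>u v. u \<in> verts G \<Longrightarrow> v \<in> verts G \<Longrightarrow> u \<noteq> v \<Longrightarrow>
                {u, v} \<in> edges G \<longleftrightarrow> {f u, f v} \<in> edges H"
      unfolding graph_iso_def by blast
    let ?g = "inv_into (verts G) f"
    have g: "bij_betw ?g (verts H) (verts G)" by (rule bij_betw_inv_into[OF f])
    have "{u, v} \<in> edges H \<longleftrightarrow> {?g u, ?g v} \<in> edges G"
      if "u \<in> verts H" "v \<in> verts H" "u \<noteq> v" for u v
    proof -
      have "?g u \<in> verts G" "?g v \<in> verts G" "f (?g u) = u" "f (?g v) = v"
        using that g f by (auto simp: bij_betw_inv_into_right intro: bij_betw_apply)
      moreover from this have "?g u \<noteq> ?g v" using that by metis
      ultimately show ?thesis using e[of "?g u" "?g v"] by simp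
    qed
    then show "(H, G) \<in> graph_iso" using G g unfolding graph_iso_def by blast
  qed
  show "trans graph_iso"
  proof (rule transI)
    fix G H K assume "(G, H) \<in> graph_iso" "(H, K) \<in> graph_iso"
    then obtain f g where s: "simple_graph G" "simple_graph K"
      and f: "bij_betw f (verts G) (verts H)" and g: "bij_betw g (verts H) (verts K)"
      and e: "\<And>u v. u \<in> verts G \<Longrightarrow> v \<in> verts G \<Longrightarrow> u \<noteq> v \<Longrightarrow>
                {u, v} \<in> edges G \<longleftrightarrow> {f u, f v} \<in> edges H"
      and e': "\<And>u v. u \<in> verts H \<Longrightarrow> v \<in> verts H \<Longrightarrow> u \<noteq> v \<Longrightarrow>
                {u, v} \<in> edges H \<longleftrightarrow> {g u, g v} \<in> edges K"
      unfolding graph_iso_def by blast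
    have "{u, v} \<in> edges G \<longleftrightarrow> {(g \<circ> f) u, (g \<circ> f) v} \<in> edges K"
      if "u \<in> verts G" "v \<in> verts G" "u \<noteq> v" for u v
    proof -
      have "f u \<in> verts H" "f v \<in> verts H" "f u \<noteq> f v"
        using that f by (auto simp: bij_betw_def inj_on_def)
      then show ?thesis using e[OF that] e'[of "f u" "f v"] by simp
    qed
    then show "(G, K) \<in> graph_iso"
      using s bij_betw_trans[OF f g] unfolding graph_iso_def by blast
  qed
qed

(* Hence the cardinality of class_level Q n is never the default value of card on infinite sets. *)
lemma finite_class_level:
  assumes "Q \<subseteq> unlabelled_graphs"
  shows "finite (class_level Q n)"
proof (rule finite_subset)
  show "class_level Q n \<subseteq> iso_class ` ({{..<n}} \<times> Pow (Pow {..<n}))"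
  proof
    fix C assume C: "C \<in> class_level Q n"
    then obtain G where G: "G \<in> C" "gsize G = n" by (auto simp: class_level_def)
    from C assms have Cq: "C \<in> {G. simple_graph G} // graph_iso"
      by (auto simp: class_level_def unlabelled_graphs_def)
    then have s: "simple_graph G"
      using G(1) in_quotient_imp_subset[OF equiv_graph_iso Cq] by blast
    then have "finite (verts G)" by (simp add: simple_graph_def)
    then obtain h where h: "bij_betw h (verts G) {..<n}"
      using G ex_bij_betw_finite_nat[of "verts G"] by (auto simp: gsize_def atLeast0LessThan)
    define K where "K = ({..<n}, (`) h ` edges G)"
    have E: "e \<subseteq> verts G" if "e \<in> edges G" for e using that s by (auto simp: simple_graph_def)
    have inj: "inj_on h (verts G)" and im: "h ` verts G = {..<n}" using h by (auto simp: bij_betw_def)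
    have sK: "simple_graph K"
    proof -
      have "edges K \<subseteq> {{u, v} | u v. u \<in> verts K \<and> v \<in> verts K \<and> u \<noteq> v}"
      proof
        fix e assume "e \<in> edges K"
        then obtain e' where e': "e' \<in> edges G" "e = h ` e'" by (auto simp: K_def edges_def)
        then obtain u v where "e' = {u, v}" "u \<in> verts G" "v \<in> verts G" "u \<noteq> v"
          using s unfolding simple_graph_def by blast
        then have "e = {h u, h v} \<and> h u \<in> verts K \<and> h v \<in> verts K \<and> h u \<noteq> h v"
          using e' inj im by (auto simp: K_def verts_def inj_on_def)
        then show "e \<in> {{u, v} | u v. u \<in> verts K \<and> v \<in> verts K \<and> u \<noteq> v}" by blast
      qed
      moreover have "verts K \<noteq> {}" using im s by (auto simp: K_def verts_def simple_graph_def)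
      ultimately show ?thesis by (simp add: simple_graph_def) (simp add: K_def verts_def)
    qed
    have "{u, v} \<in> edges G \<longleftrightarrow> {h u, h v} \<in> edges K"
      if "u \<in> verts G" "v \<in> verts G" for u v
    proof -
      have "{h u, h v} \<in> edges K \<longleftrightarrow> (\<exists>e\<in>edges G. h ` {u, v} = h ` e)"
        by (auto simp: K_def edges_def)
      also have "\<dots> \<longleftrightarrow> {u, v} \<in> edges G"
        using inj_on_image_eq_iff[OF inj, of "{u, v}"] E that by auto
      finally show ?thesis by simp
    qed
    moreover have "bij_betw h (verts G) (verts K)" using h by (simp add: K_def verts_def)
    ultimately have iso: "(G, K) \<in> graph_iso" using s sK unfolding graph_iso_def by blast
    have "C = iso_class G"
      unfolding iso_class_def
      using Cq
    proof (rule quotientE)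
      fix A assume A: "C = graph_iso `` {A}"
      then have "(A, G) \<in> graph_iso" using G(1) by blast
      then show "C = graph_iso `` {G}" unfolding A by (rule equiv_class_eq[OF equiv_graph_iso])
    qed
    also have "\<dots> = iso_class K"
      unfolding iso_class_def using equiv_class_eq[OF equiv_graph_iso iso] .
    finally have "C = iso_class K" .
    moreover have "K \<in> {{..<n}} \<times> Pow (Pow {..<n})"
      using E im by (fastforce simp: K_def)
    ultimately show "C \<in> iso_class ` ({{..<n}} \<times> Pow (Pow {..<n}))" by blast
  qed
  show "finite (iso_class ` ({{..<n}} \<times> Pow (Pow {..<n})))" by simp
qed

end

(* The counting step: if for every eps there is an m such that all large G in Q have m
   reference neighbourhoods which predict the adjacency of G up to eps n^2 errors (each vertex is
   assigned one of them), then |Q_n| <= m^n 2^(mn) 2^(h(eps) n^2) for the binary entropy h, and this is 2^(o(n^2)).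

   Suppose this fails. Graphs in Q violating it have, by compactness of the space of graphons, a
   subsequence converging to a graphon W, which is equivalent to a {0,1}-valued W'. In a sample from
   W', the adjacency of two vertices x, y is well predicted by the adjacency of y to that one of m
   reference vertices whose adjacencies to k test vertices resemble those of x most: the
   neighbourhoods in W' form an almost totally bounded set because measurable sets are nearly finite
   unions of rectangles, and k tests estimate the distance of two neighbourhoods by the law of large
   numbers. The failure probability is a sum of induced densities, so it is equally small in W
   and in the converging graphs. Averaging over the references and tests gives a good choice in
   these graphs, a contradiction.

   For compactness, colour the vertices of each graph by nested partitions into 4^t classes,
   every step refining by a pair of sets that witnesses the cut norm of the current error. The
   energies increase and are bounded, so errors are small at most times. Colour shares and block
   densities converge along a subsequence; the limits define step functions on the unit square that
   form a martingale bounded in L^2, hence converge almost everywhere along a subsequence. *)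

theory Submission
  imports Defs "HOL-Library.Diagonal_Subsequence"
begin

section \<open>Block densities and energy\<close>

text \<open>Convergence of graphs controls cut norms, which do not count wrong entries: a large
  quasirandom graph is close in cut norm to the constant 1/2, yet no bounded number of
  neighbourhoods predicts it well. An approximation of the limit by few rows therefore does not
  carry over to the graphs entry by entry, and prediction is phrased as an event on boundedly many
  sampled vertices, the only kind of information that a limit retains. Random-freeness makes this
  event rare: where the kernel is \<open>{0,1}\<close>-valued, two points with nearly equal rows
  have nearly the same adjacency to a fresh vertex, whereas at the value 1/2 even two points with
  equal rows disagree half of the time.

  In the compactness proof, the times at which a colouring fits a graph well vary with the graph. No
  single time serves the whole sequence, so the bound is made uniform by a pigeonhole argument over
  a finite window of times.\<close>

definition colour_share :: "nat set \<Rightarrow> (nat \<Rightarrow> nat) \<Rightarrow> nat \<Rightarrow> real" where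
  "colour_share V c i = card {v \<in> V. c v = i} / card V"

definition block_mass :: "nat set \<Rightarrow> (nat \<Rightarrow> nat \<Rightarrow> real) \<Rightarrow> (nat \<Rightarrow> nat) \<Rightarrow> nat \<times> nat \<Rightarrow> real" where
  "block_mass V A c ij =
     (\<Sum>(u, v) \<in> {p \<in> V \<times> V. map_prod c c p = ij}. A u v) / (card V)\<^sup>2"

definition block_density :: "nat set \<Rightarrow> (nat \<Rightarrow> nat \<Rightarrow> real) \<Rightarrow> (nat \<Rightarrow> nat) \<Rightarrow> nat \<Rightarrow> nat \<Rightarrow> real" where
  "block_density V A c i j = block_mass V A c (i, j) / (colour_share V c i * colour_share V c j)"

definition energy :: "nat \<Rightarrow> (nat \<Rightarrow> real) \<Rightarrow> (nat \<Rightarrow> nat \<Rightarrow> real) \<Rightarrow> real" where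
  "energy N a d = (\<Sum>(i, j) \<in> {..<N} \<times> {..<N}. a i * a j * (d i j)\<^sup>2)"

text \<open>Pythagoras for a conditional expectation: on each fibre of \<open>\<pi>\<close>,
  \<open>\<delta>\<close> is the \<open>\<alpha>'\<close>-weighted mean of \<open>\<delta>'\<close>,
  so the mixed term equals the coarse energy. The means are prescribed in multiplied form because a
  fibre of weight 0 has none.\<close>

lemma weighted_variance_refinement:
  fixes \<alpha>' \<delta>' :: "'a \<Rightarrow> real" and \<alpha> \<delta> :: "'b \<Rightarrow> real"
  assumes fin: "finite J'" "finite J" and im: "\<pi> ` J' \<subseteq> J"
    and mass: "\<And>q. q \<in> J \<Longrightarrow> \<alpha> q * \<delta> q = (\<Sum>p\<in>{p \<in> J'. \<pi> p = q}. \<alpha>' p * \<delta>' p)"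
    and share: "\<And>q. q \<in> J \<Longrightarrow> \<alpha> q = (\<Sum>p\<in>{p \<in> J'. \<pi> p = q}. \<alpha>' p)"
  shows "(\<Sum>p\<in>J'. \<alpha>' p * (\<delta>' p - \<delta> (\<pi> p))\<^sup>2) =
         (\<Sum>p\<in>J'. \<alpha>' p * (\<delta>' p)\<^sup>2) - (\<Sum>q\<in>J. \<alpha> q * (\<delta> q)\<^sup>2)"
proof -
  have 1: "(\<Sum>p\<in>J'. \<alpha>' p * \<delta>' p * \<delta> (\<pi> p)) = (\<Sum>q\<in>J. \<alpha> q * (\<delta> q)\<^sup>2)"
    by (subst sum.group[OF fin im, symmetric])
       (auto intro!: sum.cong simp: power2_eq_square mult.assoc[symmetric] mass sum_distrib_right)
  have 2: "(\<Sum>p\<in>J'. \<alpha>' p * (\<delta> (\<pi> p))\<^sup>2) = (\<Sum>q\<in>J. \<alpha> q * (\<delta> q)\<^sup>2)"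
    by (subst sum.group[OF fin im, symmetric])
       (auto intro!: sum.cong simp: share sum_distrib_right)
  have "(\<Sum>p\<in>J'. \<alpha>' p * (\<delta>' p - \<delta> (\<pi> p))\<^sup>2) =
        (\<Sum>p\<in>J'. \<alpha>' p * (\<delta>' p)\<^sup>2) - 2 * (\<Sum>p\<in>J'. \<alpha>' p * \<delta>' p * \<delta> (\<pi> p)) + (\<Sum>p\<in>J'. \<alpha>' p * (\<delta> (\<pi> p))\<^sup>2)"
    unfolding sum_distrib_left sum_subtractf[symmetric] sum.distrib[symmetric]
    by (rule sum.cong) (auto simp: power2_eq_square algebra_simps)
  then show ?thesis using 1 2 by simp
qed

text \<open>The right-hand side does not depend on \<open>B\<close>, so a single energy gain can
  bound the sum over any family of blocks.\<close>

lemma weighted_Cauchy_Schwarz: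
  fixes \<alpha> z :: "'a \<Rightarrow> real"
  assumes "finite J" "\<And>p. p \<in> J \<Longrightarrow> \<alpha> p \<ge> 0" "B \<subseteq> J"
  shows "(\<Sum>p\<in>B. \<alpha> p * z p)\<^sup>2 \<le> (\<Sum>p\<in>J. \<alpha> p) * (\<Sum>p\<in>J. \<alpha> p * (z p)\<^sup>2)"
proof -
  have "(\<Sum>p\<in>B. \<alpha> p * z p)\<^sup>2 = (\<Sum>p\<in>B. sqrt (\<alpha> p) * (sqrt (\<alpha> p) * z p))\<^sup>2"
    using assms by (intro arg_cong[where f="\<lambda>x. x\<^sup>2"] sum.cong) (auto simp: mult.assoc[symmetric] subset_iff)
  also have "\<dots> \<le> (\<Sum>p\<in>B. (sqrt (\<alpha> p))\<^sup>2) * (\<Sum>p\<in>B. (sqrt (\<alpha> p) * z p)\<^sup>2)"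
    by (rule Cauchy_Schwarz_ineq_sum)
  also have "\<dots> = (\<Sum>p\<in>B. \<alpha> p) * (\<Sum>p\<in>B. \<alpha> p * (z p)\<^sup>2)"
    using assms by (intro arg_cong2[where f="(*)"] sum.cong) (auto simp: power_mult_distrib subset_iff)
  also have "\<dots> \<le> (\<Sum>p\<in>J. \<alpha> p) * (\<Sum>p\<in>J. \<alpha> p * (z p)\<^sup>2)"
    using assms by (intro mult_mono sum_mono2 sum_nonneg) (auto simp: subset_iff)
  finally show ?thesis .
qed

section \<open>Shares and masses of colour classes, and their behaviour under refinement\<close>

lemma colour_share_bounds: "0 \<le> colour_share V c i" "finite V \<Longrightarrow> colour_share V c i \<le> 1"
  by (auto simp: colour_share_def divide_simps card_mono intro: card_gt_0_iff)

lemma card_pair_fibre: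
  "card {p \<in> V \<times> V. map_prod c c p = (i, j)} = card {v \<in> V. c v = i} * card {v \<in> V. c v = j}"
proof -
  have "{p \<in> V \<times> V. map_prod c c p = (i, j)} = {v \<in> V. c v = i} \<times> {v \<in> V. c v = j}" by auto
  then show ?thesis by (simp add: card_cartesian_product)
qed

lemma block_mass_bounds:
  assumes "finite V" and A: "\<And>u v. A u v \<in> {0..1}"
  shows "0 \<le> block_mass V A c (i, j)"
    and "block_mass V A c (i, j) \<le> colour_share V c i * colour_share V c j"
proof -
  show "0 \<le> block_mass V A c (i, j)"
    using A by (auto simp: block_mass_def intro!: divide_nonneg_nonneg sum_nonneg)
  have "(\<Sum>(u, v) \<in> {p \<in> V \<times> V. map_prod c c p = (i, j)}. A u v)
        \<le> (\<Sum>p \<in> {p \<in> V \<times> V. map_prod c c p = (i, j)}. 1)"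
    using A by (intro sum_mono) auto
  also have "\<dots> = card {v \<in> V. c v = i} * card {v \<in> V. c v = j}"
    by (simp add: card_pair_fibre flip: of_nat_mult)
  finally show "block_mass V A c (i, j) \<le> colour_share V c i * colour_share V c j"
    by (auto simp: block_mass_def colour_share_def power2_eq_square intro!: divide_right_mono)
qed

lemma block_density_bounds:
  assumes "finite V" "\<And>u v. A u v \<in> {0..1}"
  shows "block_density V A c i j \<in> {0..1}"
  using block_mass_bounds[of V A c i j] assms colour_share_bounds[of V c]
  by (auto simp: block_density_def divide_simps)

text \<open>This includes empty colour classes: division by zero gives density 0 there, and the mass
  is squeezed to 0 by \<open>block_mass_bounds\<close>.\<close>

lemma share_share_density:
  assumes "finite V" "\<And>u v. A u v \<in> {0..1}"
  shows "colour_share V c i * colour_share V c j * block_density V A c i j = block_mass V A c (i, j)"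
proof (cases "colour_share V c i * colour_share V c j = 0")
  case True
  then show ?thesis using block_mass_bounds[of V A c i j] assms by auto
qed (auto simp: block_density_def)

lemma block_density_sym:
  assumes "\<And>u v. A u v = A v u"
  shows "block_density V A c i j = block_density V A c j i"
proof -
  have "block_mass V A c (i, j) = block_mass V A c (j, i)"
    unfolding block_mass_def
    by (intro arg_cong2[where f="(/)"] refl sum.reindex_bij_witness[where i=prod.swap and j=prod.swap])
       (auto simp: assms)
  then show ?thesis by (simp add: block_density_def mult.commute)
qed

lemma sum_colour_share:
  assumes "finite V" "V \<noteq> {}" "c ` V \<subseteq> I" "finite I"
  shows "(\<Sum>i\<in>I. colour_share V c i) = 1"
proof -
  have "(\<Sum>i\<in>I. real (card {v \<in> V. c v = i})) = card V"
    using sum.group[of V I c "\<lambda>_. 1::real"] assms by simp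
  then show ?thesis using assms by (simp add: colour_share_def sum_divide_distrib[symmetric])
qed

lemma colour_share_refine:
  assumes "finite V" "c' ` V \<subseteq> I'" "finite I'" "\<And>v. v \<in> V \<Longrightarrow> c v = f (c' v)"
  shows "colour_share V c i = (\<Sum>k\<in>{k \<in> I'. f k = i}. colour_share V c' k)"
proof -
  have "real (card {v \<in> V. c v = i}) = (\<Sum>k\<in>{k \<in> I'. f k = i}. real (card {v \<in> {v \<in> V. c v = i}. c' v = k}))"
    using sum.group[of "{v \<in> V. c v = i}" "{k \<in> I'. f k = i}" c' "\<lambda>_. 1::real"] assms by (force simp: image_subset_iff)
  also have "\<dots> = (\<Sum>k\<in>{k \<in> I'. f k = i}. real (card {v \<in> V. c' v = k}))"
    using assms by (intro sum.cong refl arg_cong[where f=real] arg_cong[where f=card]) auto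
  finally show ?thesis by (simp add: colour_share_def sum_divide_distrib)
qed

lemma block_mass_refine:
  assumes "finite V" "c' ` V \<subseteq> I'" "finite I'" "\<And>v. v \<in> V \<Longrightarrow> c v = f (c' v)"
  shows "block_mass V A c q = (\<Sum>p\<in>{p \<in> I' \<times> I'. map_prod f f p = q}. block_mass V A c' p)"
proof -
  have "(\<Sum>(u, v) \<in> {p \<in> V \<times> V. map_prod c c p = q}. A u v) =
    (\<Sum>p\<in>{p \<in> I' \<times> I'. map_prod f f p = q}.
       (\<Sum>(u, v) \<in> {r \<in> {p \<in> V \<times> V. map_prod c c p = q}. map_prod c' c' r = p}. A u v))"
    using assms by (intro sum.group[symmetric]) auto
  also have "\<dots> = (\<Sum>p\<in>{p \<in> I' \<times> I'. map_prod f f p = q}.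
       (\<Sum>(u, v) \<in> {r \<in> V \<times> V. map_prod c' c' r = p}. A u v))"
    using assms by (intro sum.cong refl) auto
  finally show ?thesis by (simp add: block_mass_def sum_divide_distrib)
qed

text \<open>The variance identity on pairs, with \<open>map_prod f f\<close> as projection; products
  of shares refine because the shares do. Only numbers occur, since the identity serves the
  colourings of graphs and also their limits.\<close>

lemma refinement_variance:
  fixes a a' :: "nat \<Rightarrow> real"
  assumes f: "f ` {..<N'} \<subseteq> {..<N}"
    and share: "\<And>i. i < N \<Longrightarrow> a i = (\<Sum>k\<in>{k \<in> {..<N'}. f k = i}. a' k)"
    and mass: "\<And>i j. i < N \<Longrightarrow> j < N \<Longrightarrow> a i * a j * d i j =
      (\<Sum>(k, l)\<in>{p \<in> {..<N'} \<times> {..<N'}. map_prod f f p = (i, j)}. a' k * a' l * d' k l)"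
  shows "(\<Sum>(k, l)\<in>{..<N'} \<times> {..<N'}. a' k * a' l * (d' k l - d (f k) (f l))\<^sup>2) =
         energy N' a' d' - energy N a d"
proof -
  have "(\<Sum>p\<in>{..<N'} \<times> {..<N'}. (case p of (k, l) \<Rightarrow> a' k * a' l) *
          ((case p of (k, l) \<Rightarrow> d' k l) - (case map_prod f f p of (k, l) \<Rightarrow> d k l))\<^sup>2) =
        (\<Sum>p\<in>{..<N'} \<times> {..<N'}. (case p of (k, l) \<Rightarrow> a' k * a' l) * (case p of (k, l) \<Rightarrow> d' k l)\<^sup>2) -
        (\<Sum>p\<in>{..<N} \<times> {..<N}. (case p of (k, l) \<Rightarrow> a k * a l) * (case p of (k, l) \<Rightarrow> d k l)\<^sup>2)"
  proof (rule weighted_variance_refinement)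
    fix q assume "q \<in> {..<N} \<times> {..<N}"
    then obtain i j where q: "q = (i, j)" "i < N" "j < N" by auto
    show "(case q of (k, l) \<Rightarrow> a k * a l) * (case q of (k, l) \<Rightarrow> d k l) =
      (\<Sum>p\<in>{p \<in> {..<N'} \<times> {..<N'}. map_prod f f p = q}.
         (case p of (k, l) \<Rightarrow> a' k * a' l) * (case p of (k, l) \<Rightarrow> d' k l))"
      using mass[of i j] q by (simp add: case_prod_unfold)
    have eq: "{p \<in> {..<N'} \<times> {..<N'}. map_prod f f p = q} =
        {k \<in> {..<N'}. f k = i} \<times> {k \<in> {..<N'}. f k = j}"
      by (auto simp: q)
    show "(case q of (k, l) \<Rightarrow> a k * a l) =
      (\<Sum>p\<in>{p \<in> {..<N'} \<times> {..<N'}. map_prod f f p = q}. (case p of (k, l) \<Rightarrow> a' k * a' l))"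
      unfolding eq using q share by (simp add: sum_product sum.cartesian_product)
  qed (use f in auto)
  then show ?thesis by (simp add: energy_def case_prod_unfold)
qed

text \<open>The energy increment of weak regularity. The cut consists of whole blocks of the finer
  colouring, and on such a block \<open>A\<close> sums to exactly what the finer block density
  predicts. Only differences of fine and coarse densities remain; Cauchy-Schwarz bounds them by
  their weighted variance, which is the gain in energy.\<close>

lemma cut_bound_of_refinement:
  assumes V: "finite V" "V \<noteq> {}" and A: "\<And>u v. A u v \<in> {0..1}"
    and c': "\<And>v. v \<in> V \<Longrightarrow> c' v < N'" and f: "f ` {..<N'} \<subseteq> {..<N}"
    and cc': "\<And>v. v \<in> V \<Longrightarrow> c v = f (c' v)"
  shows "(\<Sum>(u, v)\<in>{p \<in> V \<times> V. P (c' (fst p)) \<and> R (c' (snd p))}. A u v - block_density V A c (c u) (c v))\<^sup>2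
     \<le> real (card V) ^ 4 *
       (energy N' (colour_share V c') (block_density V A c') - energy N (colour_share V c) (block_density V A c))"
proof -
  let ?I = "{..<N'}" and ?B = "{p \<in> {..<N'} \<times> {..<N'}. P (fst p) \<and> R (snd p)}"
  let ?n = "real (card V)" and ?a = "colour_share V c'" and ?d' = "block_density V A c'"
    and ?d = "block_density V A c"
  have I: "c' ` V \<subseteq> ?I" using c' by auto
  have n: "?n > 0" using V by (simp add: card_gt_0_iff)
  have fib: "(\<Sum>(u, v)\<in>{p \<in> V \<times> V. map_prod c' c' p = (k, l)}. A u v - ?d (c u) (c v))
      = ?n\<^sup>2 * (?a k * ?a l * (?d' k l - ?d (f k) (f l)))" if "k < N'" "l < N'" for k l
  proof -
    have "(\<Sum>(u, v)\<in>{p \<in> V \<times> V. map_prod c' c' p = (k, l)}. A u v - ?d (c u) (c v)) =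
      (\<Sum>(u, v)\<in>{p \<in> V \<times> V. map_prod c' c' p = (k, l)}. A u v) -
      (\<Sum>(u, v)\<in>{p \<in> V \<times> V. map_prod c' c' p = (k, l)}. ?d (f k) (f l))"
      unfolding sum_subtractf[symmetric] by (intro sum.cong) (auto simp: cc')
    also have "(\<Sum>(u, v)\<in>{p \<in> V \<times> V. map_prod c' c' p = (k, l)}. A u v) = ?n\<^sup>2 * (?a k * ?a l * ?d' k l)"
      using n by (simp add: share_share_density[OF V(1) A]) (simp add: block_mass_def)
    also have "(\<Sum>(u, v)\<in>{p \<in> V \<times> V. map_prod c' c' p = (k, l)}. ?d (f k) (f l)) =
       ?n\<^sup>2 * (?a k * ?a l * ?d (f k) (f l))"
      using n by (simp add: case_prod_unfold card_pair_fibre colour_share_def power2_eq_square)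
    finally show ?thesis by (simp add: algebra_simps)
  qed
  have "(\<Sum>(u, v)\<in>{p \<in> V \<times> V. P (c' (fst p)) \<and> R (c' (snd p))}. A u v - ?d (c u) (c v)) =
     (\<Sum>q\<in>?B. \<Sum>(u, v)\<in>{r \<in> {p \<in> V \<times> V. P (c' (fst p)) \<and> R (c' (snd p))}. map_prod c' c' r = q}. A u v - ?d (c u) (c v))"
    using V I by (intro sum.group[symmetric]) auto
  also have "\<dots> = (\<Sum>q\<in>?B. \<Sum>(u, v)\<in>{r \<in> V \<times> V. map_prod c' c' r = q}. A u v - ?d (c u) (c v))"
    by (intro sum.cong refl) auto
  also have "\<dots> = (\<Sum>(k, l)\<in>?B. ?n\<^sup>2 * (?a k * ?a l * (?d' k l - ?d (f k) (f l))))"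
    by (intro sum.cong) (auto simp: fib simp del: map_prod_simp)
  also have "\<dots> = ?n\<^sup>2 * (\<Sum>p\<in>?B. (\<lambda>(k, l). ?a k * ?a l) p * (\<lambda>(k, l). ?d' k l - ?d (f k) (f l)) p)"
    by (simp add: sum_distrib_left case_prod_unfold)
  finally have eq: "(\<Sum>(u, v)\<in>{p \<in> V \<times> V. P (c' (fst p)) \<and> R (c' (snd p))}. A u v - ?d (c u) (c v))\<^sup>2 =
     ?n ^ 4 * (\<Sum>p\<in>?B. (\<lambda>(k, l). ?a k * ?a l) p * (\<lambda>(k, l). ?d' k l - ?d (f k) (f l)) p)\<^sup>2"
    by (simp add: power_mult_distrib)
  have "(\<Sum>p\<in>?B. (\<lambda>(k, l). ?a k * ?a l) p * (\<lambda>(k, l). ?d' k l - ?d (f k) (f l)) p)\<^sup>2 \<le>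
     (\<Sum>p\<in>?I \<times> ?I. (\<lambda>(k, l). ?a k * ?a l) p) *
     (\<Sum>p\<in>?I \<times> ?I. (\<lambda>(k, l). ?a k * ?a l) p * ((\<lambda>(k, l). ?d' k l - ?d (f k) (f l)) p)\<^sup>2)"
    by (rule weighted_Cauchy_Schwarz) (auto simp: colour_share_bounds)
  also have "(\<Sum>p\<in>?I \<times> ?I. (\<lambda>(k, l). ?a k * ?a l) p) = (\<Sum>k<N'. ?a k) * (\<Sum>k<N'. ?a k)"
    by (simp add: sum_product sum.cartesian_product)
  also have "(\<Sum>k<N'. ?a k) = 1"
    using sum_colour_share[OF V I] by simp
  also have "(\<Sum>p\<in>?I \<times> ?I. (\<lambda>(k, l). ?a k * ?a l) p * ((\<lambda>(k, l). ?d' k l - ?d (f k) (f l)) p)\<^sup>2) =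
     (\<Sum>(k, l)\<in>?I \<times> ?I. ?a k * ?a l * (?d' k l - ?d (f k) (f l))\<^sup>2)"
    by (simp add: case_prod_unfold)
  also have "\<dots> = energy N' ?a ?d' - energy N (colour_share V c) ?d"
  proof (rule refinement_variance[OF f])
    fix i assume "i < N"
    show "colour_share V c i = (\<Sum>k\<in>{k \<in> ?I. f k = i}. ?a k)"
      by (rule colour_share_refine) (use V I cc' in auto)
  next
    fix i j assume "i < N" "j < N"
    show "colour_share V c i * colour_share V c j * ?d i j =
      (\<Sum>(k, l)\<in>{p \<in> ?I \<times> ?I. map_prod f f p = (i, j)}. ?a k * ?a l * ?d' k l)"
      unfolding share_share_density[OF V(1) A] by (subst block_mass_refine[where c'=c' and f=f and I'="?I"]) (use V I cc' in auto)
  qed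
  finally show ?thesis unfolding eq by (simp add: mult_left_mono)
qed

lemma energy_bounds:
  assumes "\<And>i. 0 \<le> a i" "\<And>i j. d i j \<in> {0..1}" "(\<Sum>i<N. a i) = 1"
  shows "energy N a d \<in> {0..1}"
proof -
  have "energy N a d \<le> (\<Sum>(i, j) \<in> {..<N} \<times> {..<N}. a i * a j * 1)"
    unfolding energy_def using assms
    by (intro sum_mono) (auto intro!: mult_left_mono power_le_one simp del: mult_1_right)
  also have "\<dots> = (\<Sum>i<N. a i) * (\<Sum>i<N. a i)" by (simp add: sum_product sum.cartesian_product)
  finally show ?thesis using assms by (auto simp: energy_def intro!: sum_nonneg)
qed

text \<open>Each step splits along a pair of sets with the largest squared cut error, so bounding
  this one cut by the energy gain bounds all cuts. Two sets split a class into at most four parts,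
  whence the \<open>4 ^ t\<close> colours.\<close>

lemma exists_colouring_tower:
  assumes V: "finite V" "V \<noteq> {}" and A: "\<And>u v. A u v \<in> {0..1}"
  shows "\<exists>c :: nat \<Rightarrow> nat \<Rightarrow> nat. (\<forall>t v. c t v < 4 ^ t) \<and> (\<forall>t v. c (Suc t) v div 4 = c t v) \<and>
    (\<forall>t S T. S \<subseteq> V \<longrightarrow> T \<subseteq> V \<longrightarrow>
      (\<Sum>(u, v)\<in>S \<times> T. A u v - block_density V A (c t) (c t u) (c t v))\<^sup>2 \<le> real (card V) ^ 4 *
       (energy (4 ^ Suc t) (colour_share V (c (Suc t))) (block_density V A (c (Suc t))) -
        energy (4 ^ t) (colour_share V (c t)) (block_density V A (c t))))"
proof -
  define cut where "cut c S T = (\<Sum>(u, v)\<in>S \<times> T. A u v - block_density V A c (c u) (c v))\<^sup>2"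
    for c :: "nat \<Rightarrow> nat" and S T
  have "\<exists>ST. ST \<in> Pow V \<times> Pow V \<and> (\<forall>ST'\<in>Pow V \<times> Pow V. case_prod (cut c) ST' \<le> case_prod (cut c) ST)" for c
  proof -
    have fin: "finite (case_prod (cut c) ` (Pow V \<times> Pow V))" using V by simp
    then have "Max (case_prod (cut c) ` (Pow V \<times> Pow V)) \<in> case_prod (cut c) ` (Pow V \<times> Pow V)"
      by (rule Max_in) auto
    then obtain ST where ST: "ST \<in> Pow V \<times> Pow V"
      "case_prod (cut c) ST = Max (case_prod (cut c) ` (Pow V \<times> Pow V))" by auto
    then show ?thesis using Max_ge[OF fin] by (intro exI[of _ ST]) auto
  qed
  then obtain ST where ST: "\<And>c. ST c \<in> Pow V \<times> Pow V"
    "\<And>c ST'. ST' \<in> Pow V \<times> Pow V \<Longrightarrow> case_prod (cut c) ST' \<le> case_prod (cut c) (ST c)" by metis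
  \<comment> \<open>The new base-4 digit records membership in the two sets. Division by 4 returns
    the old colour, and both sets become unions of new classes, as
    \<open>cut_bound_of_refinement\<close> requires.\<close>
  define c where "c = rec_nat (\<lambda>_. 0::nat)
     (\<lambda>t c v. 4 * c v + (2 * of_bool (v \<in> fst (ST c)) + of_bool (v \<in> snd (ST c))))"
  have cSuc: "c (Suc t) v = 4 * c t v + (2 * of_bool (v \<in> fst (ST (c t))) + of_bool (v \<in> snd (ST (c t))))" for t v
    by (simp add: c_def)
  have c0: "c 0 v = 0" for v by (simp add: c_def)
  have lt: "c t v < 4 ^ t" for t v
    by (induction t) (auto simp: c0 cSuc)
  have dv: "c (Suc t) v div 4 = c t v" for t v by (simp add: cSuc)
  have m1: "c (Suc t) v mod 4 \<ge> 2 \<longleftrightarrow> v \<in> fst (ST (c t))" for t v by (simp add: cSuc mod_mult_self4)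
  have m2: "odd (c (Suc t) v) \<longleftrightarrow> v \<in> snd (ST (c t))" for t v by (simp add: cSuc)
  have "(\<Sum>(u, v)\<in>S \<times> T. A u v - block_density V A (c t) (c t u) (c t v))\<^sup>2 \<le> real (card V) ^ 4 *
       (energy (4 ^ Suc t) (colour_share V (c (Suc t))) (block_density V A (c (Suc t))) -
        energy (4 ^ t) (colour_share V (c t)) (block_density V A (c t)))" if "S \<subseteq> V" "T \<subseteq> V" for t S T
  proof -
    have "(\<Sum>(u, v)\<in>S \<times> T. A u v - block_density V A (c t) (c t u) (c t v))\<^sup>2 \<le> case_prod (cut (c t)) (ST (c t))"
      using ST(2)[of "(S, T)" "c t"] that by (simp add: cut_def)
    also have "\<dots> = (\<Sum>(u, v)\<in>fst (ST (c t)) \<times> snd (ST (c t)). A u v - block_density V A (c t) (c t u) (c t v))\<^sup>2"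
      by (simp add: cut_def case_prod_unfold)
    also have "fst (ST (c t)) \<times> snd (ST (c t)) =
        {p \<in> V \<times> V. c (Suc t) (fst p) mod 4 \<ge> 2 \<and> odd (c (Suc t) (snd p))}"
      unfolding m1 m2 using ST(1)[of "c t"] by (auto simp: mem_Times_iff)
    also have "(\<Sum>(u, v)\<in>\<dots>. A u v - block_density V A (c t) (c t u) (c t v))\<^sup>2 \<le> real (card V) ^ 4 *
       (energy (4 ^ Suc t) (colour_share V (c (Suc t))) (block_density V A (c (Suc t))) -
        energy (4 ^ t) (colour_share V (c t)) (block_density V A (c t)))"
      by (rule cut_bound_of_refinement[OF V A, where f="\<lambda>k. k div 4" and P="\<lambda>k. k mod 4 \<ge> 2" and R=odd])
         (use lt[of "Suc t"] in \<open>auto simp: dv less_mult_imp_div_less mult.commute\<close>)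
    finally show ?thesis .
  qed
  then show ?thesis using lt dv by blast
qed

section \<open>The counting lemma\<close>

definition vpairs :: "nat set \<Rightarrow> (nat \<times> nat) set" where
  "vpairs X = {(u, v). u \<in> X \<and> v \<in> X \<and> u < v}"

definition ind_weight :: "graph \<Rightarrow> ('a \<Rightarrow> 'a \<Rightarrow> real) \<Rightarrow> (nat \<Rightarrow> 'a) \<Rightarrow> real" where
  "ind_weight H w \<phi> = (\<Prod>(u, v)\<in>vpairs (verts H).
     if {u, v} \<in> edges H then w (\<phi> u) (\<phi> v) else 1 - w (\<phi> u) (\<phi> v))"

definition hom_density :: "nat set \<Rightarrow> graph \<Rightarrow> (nat \<Rightarrow> nat \<Rightarrow> real) \<Rightarrow> real" where
  "hom_density V H A = (\<Sum>\<phi>\<in>verts H \<rightarrow>\<^sub>E V. ind_weight H A \<phi>) / card V ^ card (verts H)"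

text \<open>The density of \<open>H\<close> in the weighted graph on \<open>N\<close> vertices with
  vertex weights \<open>a\<close> and edge weights \<open>d\<close>.\<close>

definition step_density :: "nat \<Rightarrow> graph \<Rightarrow> (nat \<Rightarrow> real) \<Rightarrow> (nat \<Rightarrow> nat \<Rightarrow> real) \<Rightarrow> real" where
  "step_density N H a d =
     (\<Sum>\<phi>\<in>verts H \<rightarrow>\<^sub>E {..<N}. (\<Prod>u\<in>verts H. a (\<phi> u)) * ind_weight H d \<phi>)"

definition adj :: "graph \<Rightarrow> nat \<Rightarrow> nat \<Rightarrow> real" where
  "adj G u v = of_bool ({u, v} \<in> edges G)"

lemma finite_vpairs [simp]: "finite X \<Longrightarrow> finite (vpairs X)"
  by (rule finite_subset[of _ "X \<times> X"]) (auto simp: vpairs_def)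

lemma sum_PiE_insert:
  assumes "x \<notin> S"
  shows "(\<Sum>\<phi>\<in>insert x S \<rightarrow>\<^sub>E V. F \<phi>) = (\<Sum>\<psi>\<in>S \<rightarrow>\<^sub>E V. \<Sum>a\<in>V. F (\<psi>(x := a)))"
proof -
  have "(\<Sum>\<phi>\<in>insert x S \<rightarrow>\<^sub>E V. F \<phi>) = (\<Sum>(a, \<psi>)\<in>V \<times> (S \<rightarrow>\<^sub>E V). F (\<psi>(x := a)))"
    unfolding PiE_insert_eq
    by (subst sum.reindex[OF inj_combinator[OF assms]]) (simp add: case_prod_unfold o_def)
  also have "\<dots> = (\<Sum>\<psi>\<in>S \<rightarrow>\<^sub>E V. \<Sum>a\<in>V. F (\<psi>(x := a)))"
    by (subst sum.swap) (simp add: sum.cartesian_product)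
  finally show ?thesis .
qed

text \<open>The form is linear in \<open>f\<close> and in \<open>g\<close>, so it is largest at
  indicator functions: first \<open>f\<close> is replaced by the set \<open>S\<close> of rows with
  positive sum, then \<open>g\<close> by the set \<open>T\<close> of columns with positive sum over
  \<open>S\<close>.\<close>

lemma bilinear_cut_le:
  fixes f g :: "'a \<Rightarrow> real" and \<beta> :: real
  assumes "finite V" "\<And>a. f a \<in> {0..1}" "\<And>a. g a \<in> {0..1}"
    and cut: "\<And>S T. S \<subseteq> V \<Longrightarrow> T \<subseteq> V \<Longrightarrow> (\<Sum>(a, b)\<in>S \<times> T. K a b) \<le> \<beta>"
  shows "(\<Sum>a\<in>V. \<Sum>b\<in>V. K a b * f a * g b) \<le> \<beta>"
proof -
  have extreme: "(\<Sum>a\<in>V. h a * r a) \<le> (\<Sum>a\<in>{a \<in> V. r a > 0}. r a)"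
    if "\<And>a. h a \<in> {0..1}" for h r :: "'a \<Rightarrow> real"
  proof -
    have "(\<Sum>a\<in>V. h a * r a) \<le> (\<Sum>a\<in>V. if r a > 0 then r a else 0)"
      using that by (intro sum_mono) (auto simp: mult_left_le_one_le mult_nonneg_nonpos not_less)
    then show ?thesis using \<open>finite V\<close> by (simp add: sum.inter_filter)
  qed
  define S where "S = {a \<in> V. (\<Sum>b\<in>V. K a b * g b) > 0}"
  define T where "T = {b \<in> V. (\<Sum>a\<in>S. K a b) > 0}"
  have "(\<Sum>a\<in>V. \<Sum>b\<in>V. K a b * f a * g b) = (\<Sum>a\<in>V. f a * (\<Sum>b\<in>V. K a b * g b))"
    by (simp add: sum_distrib_left mult_ac)
  also have "\<dots> \<le> (\<Sum>a\<in>S. \<Sum>b\<in>V. K a b * g b)"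
    unfolding S_def by (rule extreme) (use assms in auto)
  also have "\<dots> = (\<Sum>b\<in>V. g b * (\<Sum>a\<in>S. K a b))"
    by (subst sum.swap) (simp add: sum_distrib_left mult_ac)
  also have "\<dots> \<le> (\<Sum>b\<in>T. \<Sum>a\<in>S. K a b)"
    unfolding T_def by (rule extreme) (use assms in auto)
  also have "\<dots> = (\<Sum>(a, b)\<in>S \<times> T. K a b)"
    by (subst sum.swap) (simp add: sum.cartesian_product)
  also have "\<dots> \<le> \<beta>" by (rule cut) (auto simp: S_def T_def)
  finally show ?thesis .
qed

lemma bilinear_cut_abs_le:
  fixes f g :: "'a \<Rightarrow> real" and \<beta> :: real
  assumes "finite V" "\<And>a. f a \<in> {0..1}" "\<And>a. g a \<in> {0..1}"
    and cut: "\<And>S T. S \<subseteq> V \<Longrightarrow> T \<subseteq> V \<Longrightarrow> \<bar>\<Sum>(a, b)\<in>S \<times> T. K a b\<bar> \<le> \<beta>"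
  shows "\<bar>\<Sum>a\<in>V. \<Sum>b\<in>V. K a b * f a * g b\<bar> \<le> \<beta>"
proof -
  have "(\<Sum>a\<in>V. \<Sum>b\<in>V. K a b * f a * g b) \<le> \<beta>"
    using cut by (intro bilinear_cut_le assms) (auto simp: abs_le_iff)
  moreover have "(\<Sum>a\<in>V. \<Sum>b\<in>V. - K a b * f a * g b) \<le> \<beta>"
  proof (intro bilinear_cut_le assms)
    fix S T assume "S \<subseteq> V" "T \<subseteq> V"
    from cut[OF this] show "(\<Sum>(a, b)\<in>S \<times> T. - K a b) \<le> \<beta>"
      by (simp add: case_prod_unfold sum_negf)
  qed
  ultimately show ?thesis by (simp add: sum_negf)
qed

text \<open>Fix the images of all vertices except \<open>u\<close> and \<open>v\<close>. No pair in
  \<open>P\<close> joins \<open>u\<close> and \<open>v\<close>, so each remaining factor depends on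
  the image of at most one of them, and the sum over these two images is a bilinear form with
  coefficients in the unit interval.\<close>

lemma single_pair_cut_le:
  fixes K :: "nat \<Rightarrow> nat \<Rightarrow> real" and z :: "nat \<times> nat \<Rightarrow> nat \<Rightarrow> nat \<Rightarrow> real" and \<beta> :: real
  assumes "finite V" "finite X" and uv: "(u, v) \<in> vpairs X" and P: "P \<subseteq> vpairs X - {(u, v)}"
    and z: "\<And>p a b. z p a b \<in> {0..1}"
    and cut: "\<And>S T. S \<subseteq> V \<Longrightarrow> T \<subseteq> V \<Longrightarrow> \<bar>\<Sum>(a, b)\<in>S \<times> T. K a b\<bar> \<le> \<beta> * (card V)\<^sup>2"
  shows "\<bar>\<Sum>\<phi>\<in>X \<rightarrow>\<^sub>E V. K (\<phi> u) (\<phi> v) * (\<Prod>p\<in>P. z p (\<phi> (fst p)) (\<phi> (snd p)))\<bar>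
         \<le> \<beta> * real (card V) ^ card X"
proof -
  define Y where "Y = X - {u, v}"
  have X: "X = insert v (insert u Y)" and nv: "v \<notin> insert u Y" "u \<notin> Y" and ne: "u \<noteq> v"
    using uv by (auto simp: Y_def vpairs_def)
  have finP: "finite P" using P \<open>finite X\<close> by (meson Diff_subset finite_subset finite_vpairs)
  let ?u = "\<lambda>p. fst p = u \<or> snd p = u" and ?v = "\<lambda>p. fst p = v \<or> snd p = v"
  have notboth: "\<not> (?u p \<and> ?v p)" if "p \<in> P" for p
    using that P ne uv by (auto simp: vpairs_def)
  define w where "w p \<phi> = z p (\<phi> (fst p)) (\<phi> (snd p))" for p and \<phi> :: "nat \<Rightarrow> nat"
  have w01: "(\<Prod>p\<in>Q. w p \<phi>) \<in> {0..1}" for Q \<phi>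
    using z by (auto simp: w_def intro!: prod_nonneg prod_le_1)
  have key: "\<bar>\<Sum>a\<in>V. \<Sum>b\<in>V. K a b * (\<Prod>p\<in>P. w p (\<psi>(u := a, v := b)))\<bar> \<le> \<beta> * (card V)\<^sup>2" for \<psi>
  proof -
    let ?f = "\<lambda>a. \<Prod>p\<in>{p \<in> P. ?u p}. w p (\<psi>(u := a))"
    let ?g = "\<lambda>b. \<Prod>p\<in>{p \<in> P. \<not> ?u p}. w p (\<psi>(v := b))"
    have "(\<Prod>p\<in>P. w p (\<psi>(u := a, v := b))) = ?f a * ?g b" for a b
    proof -
      have "(\<Prod>p\<in>P. w p (\<psi>(u := a, v := b))) =
        (\<Prod>p\<in>{p \<in> P. ?u p}. w p (\<psi>(u := a, v := b))) * (\<Prod>p\<in>{p \<in> P. \<not> ?u p}. w p (\<psi>(u := a, v := b)))"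
        using finP by (subst prod.union_disjoint[symmetric]) (auto intro!: prod.cong)
      also have "(\<Prod>p\<in>{p \<in> P. ?u p}. w p (\<psi>(u := a, v := b))) = ?f a"
        using notboth by (intro prod.cong refl) (auto simp: w_def)
      also have "(\<Prod>p\<in>{p \<in> P. \<not> ?u p}. w p (\<psi>(u := a, v := b))) = ?g b"
        by (intro prod.cong refl) (auto simp: w_def)
      finally show ?thesis .
    qed
    then show ?thesis
      using bilinear_cut_abs_le[OF \<open>finite V\<close>, of ?f ?g K "\<beta> * (card V)\<^sup>2"] w01 cut
      by (simp add: mult.assoc)
  qed
  have "\<bar>\<Sum>\<phi>\<in>X \<rightarrow>\<^sub>E V. K (\<phi> u) (\<phi> v) * (\<Prod>p\<in>P. w p \<phi>)\<bar> =
     \<bar>\<Sum>\<psi>\<in>Y \<rightarrow>\<^sub>E V. \<Sum>a\<in>V. \<Sum>b\<in>V. K a b * (\<Prod>p\<in>P. w p (\<psi>(u := a, v := b)))\<bar>"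
    unfolding X using nv ne by (simp add: sum_PiE_insert)
  also have "\<dots> \<le> (\<Sum>\<psi>\<in>Y \<rightarrow>\<^sub>E V. \<bar>\<Sum>a\<in>V. \<Sum>b\<in>V. K a b * (\<Prod>p\<in>P. w p (\<psi>(u := a, v := b)))\<bar>)"
    by (rule sum_abs)
  also have "\<dots> \<le> (\<Sum>\<psi>\<in>Y \<rightarrow>\<^sub>E V. \<beta> * (card V)\<^sup>2)" by (intro sum_mono key)
  also have "\<dots> = \<beta> * real (card V) ^ card X"
  proof -
    have "finite Y" using \<open>finite X\<close> by (simp add: Y_def)
    then have "card X = card Y + 2" unfolding X using nv by simp
    then show ?thesis using \<open>finite Y\<close> by (simp add: card_funcsetE power_add power2_eq_square)
  qed
  finally show ?thesis by (simp add: w_def)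
qed

text \<open>The factors \<open>x p\<close> are exchanged for \<open>y p\<close> one pair at a time;
  each exchange costs one application of \<open>single_pair_cut_le\<close>. The kernels may depend
  on the pair so that edges and non-edges are treated alike.\<close>

lemma counting_lemma_pairs:
  fixes x y :: "nat \<times> nat \<Rightarrow> nat \<Rightarrow> nat \<Rightarrow> real" and \<beta> :: real
  assumes "finite V" "finite X" and xy: "\<And>p a b. x p a b \<in> {0..1}" "\<And>p a b. y p a b \<in> {0..1}"
    and cut: "\<And>p S T. S \<subseteq> V \<Longrightarrow> T \<subseteq> V \<Longrightarrow> \<bar>\<Sum>(a, b)\<in>S \<times> T. x p a b - y p a b\<bar> \<le> \<beta> * (card V)\<^sup>2"
  shows "\<bar>(\<Sum>\<phi>\<in>X \<rightarrow>\<^sub>E V. \<Prod>p\<in>vpairs X. x p (\<phi> (fst p)) (\<phi> (snd p))) -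
          (\<Sum>\<phi>\<in>X \<rightarrow>\<^sub>E V. \<Prod>p\<in>vpairs X. y p (\<phi> (fst p)) (\<phi> (snd p)))\<bar>
         \<le> card (vpairs X) * (\<beta> * real (card V) ^ card X)"
proof -
  define hyb where "hyb D p = (if p \<in> D then x p else y p)" for D p
  define s where "s D = (\<Sum>\<phi>\<in>X \<rightarrow>\<^sub>E V. \<Prod>p\<in>vpairs X. hyb D p (\<phi> (fst p)) (\<phi> (snd p)))" for D
  have "\<bar>s D - s {}\<bar> \<le> card D * (\<beta> * real (card V) ^ card X)"
    if "finite D" "D \<subseteq> vpairs X" for D
    using that
  proof (induction D)
    case (insert e D)
    obtain u v where e: "e = (u, v)" by force
    have split: "(\<Prod>p\<in>vpairs X. hyb D' p (\<phi> (fst p)) (\<phi> (snd p))) =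
        hyb D' e (\<phi> u) (\<phi> v) * (\<Prod>p\<in>vpairs X - {e}. hyb D' p (\<phi> (fst p)) (\<phi> (snd p)))" for D' \<phi>
      using insert.prems \<open>finite X\<close> by (subst prod.remove[of _ e]) (auto simp: e)
    have "(\<Prod>p\<in>vpairs X - {e}. hyb (insert e D) p (\<phi> (fst p)) (\<phi> (snd p))) =
        (\<Prod>p\<in>vpairs X - {e}. hyb D p (\<phi> (fst p)) (\<phi> (snd p)))" for \<phi>
      by (intro prod.cong refl) (auto simp: hyb_def)
    then have "s (insert e D) - s D = (\<Sum>\<phi>\<in>X \<rightarrow>\<^sub>E V. (x e (\<phi> u) (\<phi> v) - y e (\<phi> u) (\<phi> v)) *
        (\<Prod>p\<in>vpairs X - {e}. hyb D p (\<phi> (fst p)) (\<phi> (snd p))))"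
      using insert.hyps unfolding s_def split sum_subtractf[symmetric]
      by (intro sum.cong refl) (simp add: hyb_def algebra_simps)
    also have "\<bar>\<dots>\<bar> \<le> \<beta> * real (card V) ^ card X"
    proof (rule single_pair_cut_le[OF \<open>finite V\<close> \<open>finite X\<close>])
      show "(u, v) \<in> vpairs X" using insert.prems by (simp add: e)
      show "vpairs X - {e} \<subseteq> vpairs X - {(u, v)}" by (simp add: e)
    qed (use xy cut in \<open>auto simp: hyb_def\<close>)
    finally have "\<bar>s (insert e D) - s D\<bar> \<le> \<beta> * real (card V) ^ card X" .
    moreover have "\<bar>s D - s {}\<bar> \<le> card D * (\<beta> * real (card V) ^ card X)"
      using insert by simp
    ultimately show ?case using insert.hyps by (simp add: algebra_simps)
  qed simp
  from this[of "vpairs X"] show ?thesis using \<open>finite X\<close> by (simp add: s_def hyb_def)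
qed

text \<open>For a non-edge the factor is \<open>1 - w\<close>, which only reverses the sign of the
  difference; hence the same cut bound applies to every pair.\<close>

lemma counting_lemma:
  fixes A B :: "nat \<Rightarrow> nat \<Rightarrow> real" and \<beta> :: real
  assumes "finite V" "V \<noteq> {}" "finite (verts H)"
    and A: "\<And>a b. A a b \<in> {0..1}" "\<And>a b. B a b \<in> {0..1}"
    and cut: "\<And>S T. S \<subseteq> V \<Longrightarrow> T \<subseteq> V \<Longrightarrow> \<bar>\<Sum>(a, b)\<in>S \<times> T. A a b - B a b\<bar> \<le> \<beta> * (card V)\<^sup>2"
  shows "\<bar>hom_density V H A - hom_density V H B\<bar> \<le> card (vpairs (verts H)) * \<beta>"
proof -
  let ?n = "real (card V) ^ card (verts H)"
  have n: "?n > 0" using assms by (simp add: card_gt_0_iff)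
  define k where "k w p a b = (if {fst p, snd p} \<in> edges H then w a b else 1 - w a b)"
    for w :: "nat \<Rightarrow> nat \<Rightarrow> real" and p and a b
  have "\<bar>(\<Sum>\<phi>\<in>verts H \<rightarrow>\<^sub>E V. \<Prod>p\<in>vpairs (verts H). k A p (\<phi> (fst p)) (\<phi> (snd p))) -
         (\<Sum>\<phi>\<in>verts H \<rightarrow>\<^sub>E V. \<Prod>p\<in>vpairs (verts H). k B p (\<phi> (fst p)) (\<phi> (snd p)))\<bar>
        \<le> card (vpairs (verts H)) * (\<beta> * ?n)"
  proof (rule counting_lemma_pairs[OF assms(1,3)])
    fix p :: "nat \<times> nat" and S T assume ST: "S \<subseteq> V" "T \<subseteq> V"
    have "(\<Sum>(a, b)\<in>S \<times> T. k A p a b - k B p a b) = (\<Sum>(a, b)\<in>S \<times> T. A a b - B a b) \<or>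
      (\<Sum>(a, b)\<in>S \<times> T. k A p a b - k B p a b) = - (\<Sum>(a, b)\<in>S \<times> T. A a b - B a b)"
      by (cases "{fst p, snd p} \<in> edges H") (auto simp: k_def case_prod_unfold sum_negf[symmetric])
    then show "\<bar>\<Sum>(a, b)\<in>S \<times> T. k A p a b - k B p a b\<bar> \<le> \<beta> * (card V)\<^sup>2"
      using cut[OF ST] by auto
  qed (use A in \<open>auto simp: k_def\<close>)
  then have "\<bar>(\<Sum>\<phi>\<in>verts H \<rightarrow>\<^sub>E V. ind_weight H A \<phi>) - (\<Sum>\<phi>\<in>verts H \<rightarrow>\<^sub>E V. ind_weight H B \<phi>)\<bar>
        \<le> (card (vpairs (verts H)) * \<beta>) * ?n"
    by (simp add: ind_weight_def k_def case_prod_unfold mult.assoc)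
  then have "\<bar>(\<Sum>\<phi>\<in>verts H \<rightarrow>\<^sub>E V. ind_weight H A \<phi>) - (\<Sum>\<phi>\<in>verts H \<rightarrow>\<^sub>E V. ind_weight H B \<phi>)\<bar> / ?n
        \<le> card (vpairs (verts H)) * \<beta>"
    using n by (simp add: divide_le_eq)
  then show ?thesis using n by (simp add: hom_density_def diff_divide_distrib[symmetric] abs_divide)
qed

text \<open>The weight of a map depends only on its colour pattern \<open>q \<phi>\<close>, and the
  maps with a given pattern are counted by the product of the class sizes.\<close>

lemma hom_density_step:
  assumes V: "finite V" and X: "finite (verts H)" and c: "\<And>v. v \<in> V \<Longrightarrow> c v < N"
  shows "hom_density V H (\<lambda>u v. d (c u) (c v)) = step_density N H (colour_share V c) d"
proof -
  let ?X = "verts H"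
  define q where "q \<phi> = restrict (\<lambda>u. c (\<phi> u)) ?X" for \<phi>
  have w: "ind_weight H (\<lambda>u v. d (c u) (c v)) \<phi> = ind_weight H d (q \<phi>)" for \<phi>
    unfolding ind_weight_def by (intro prod.cong refl) (auto simp: q_def vpairs_def)
  have "(\<Sum>\<phi>\<in>?X \<rightarrow>\<^sub>E V. ind_weight H d (q \<phi>)) =
      (\<Sum>\<psi>\<in>?X \<rightarrow>\<^sub>E {..<N}. \<Sum>\<phi>\<in>{\<phi> \<in> ?X \<rightarrow>\<^sub>E V. q \<phi> = \<psi>}. ind_weight H d (q \<phi>))"
    using assms by (intro sum.group[symmetric] finite_PiE) (auto simp: q_def PiE_iff)
  also have "\<dots> = (\<Sum>\<psi>\<in>?X \<rightarrow>\<^sub>E {..<N}. real (card {\<phi> \<in> ?X \<rightarrow>\<^sub>E V. q \<phi> = \<psi>}) * ind_weight H d \<psi>)"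
    by (intro sum.cong refl) simp
  also have "\<dots> = (\<Sum>\<psi>\<in>?X \<rightarrow>\<^sub>E {..<N}. (\<Prod>u\<in>?X. real (card {v \<in> V. c v = \<psi> u})) * ind_weight H d \<psi>)"
  proof (intro sum.cong refl)
    fix \<psi> assume \<psi>: "\<psi> \<in> ?X \<rightarrow>\<^sub>E {..<N}"
    have "{\<phi> \<in> ?X \<rightarrow>\<^sub>E V. q \<phi> = \<psi>} = (\<Pi>\<^sub>E u\<in>?X. {v \<in> V. c v = \<psi> u})"
    proof (intro set_eqI iffI)
      fix \<phi> assume \<phi>: "\<phi> \<in> (\<Pi>\<^sub>E u\<in>?X. {v \<in> V. c v = \<psi> u})"
      have "q \<phi> = \<psi>"
      proof
        fix u show "q \<phi> u = \<psi> u" using PiE_mem[OF \<phi>, of u] PiE_arb[OF \<psi>, of u] by (auto simp: q_def)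
      qed
      with \<phi> show "\<phi> \<in> {\<phi> \<in> ?X \<rightarrow>\<^sub>E V. q \<phi> = \<psi>}" by (auto simp: PiE_iff)
    qed (auto simp: q_def PiE_iff)
    then show "real (card {\<phi> \<in> ?X \<rightarrow>\<^sub>E V. q \<phi> = \<psi>}) * ind_weight H d \<psi> =
        (\<Prod>u\<in>?X. real (card {v \<in> V. c v = \<psi> u})) * ind_weight H d \<psi>"
      using X by (simp add: card_PiE)
  qed
  finally have eq: "(\<Sum>\<phi>\<in>?X \<rightarrow>\<^sub>E V. ind_weight H d (q \<phi>)) =
    (\<Sum>\<psi>\<in>?X \<rightarrow>\<^sub>E {..<N}. (\<Prod>u\<in>?X. real (card {v \<in> V. c v = \<psi> u})) * ind_weight H d \<psi>)" .
  show ?thesis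
    unfolding hom_density_def w eq step_density_def colour_share_def
    by (simp add: prod_dividef sum_divide_distrib)
qed

section \<open>Induced densities: injective maps against arbitrary maps\<close>

lemma prod_of_bool: "finite P \<Longrightarrow> (\<Prod>p\<in>P. of_bool (Q p) :: real) = of_bool (\<forall>p\<in>P. Q p)"
  by (induction P rule: finite_induct) auto

lemma ind_weight_of_bool:
  assumes "finite (verts H)" "\<And>x y. r x y \<longleftrightarrow> r y x"
  shows "ind_weight H (\<lambda>x y. of_bool (r x y)) \<phi> =
    of_bool (\<forall>u\<in>verts H. \<forall>v\<in>verts H. u \<noteq> v \<longrightarrow> ({u, v} \<in> edges H \<longleftrightarrow> r (\<phi> u) (\<phi> v)))"
proof -
  have "ind_weight H (\<lambda>x y. of_bool (r x y)) \<phi> =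
    (\<Prod>p\<in>vpairs (verts H). of_bool ({fst p, snd p} \<in> edges H \<longleftrightarrow> r (\<phi> (fst p)) (\<phi> (snd p))))"
    unfolding ind_weight_def by (intro prod.cong) auto
  also have "\<dots> = of_bool (\<forall>p\<in>vpairs (verts H). {fst p, snd p} \<in> edges H \<longleftrightarrow> r (\<phi> (fst p)) (\<phi> (snd p)))"
    using assms by (intro prod_of_bool) simp
  also have "(\<forall>p\<in>vpairs (verts H). {fst p, snd p} \<in> edges H \<longleftrightarrow> r (\<phi> (fst p)) (\<phi> (snd p))) \<longleftrightarrow>
     (\<forall>u\<in>verts H. \<forall>v\<in>verts H. u \<noteq> v \<longrightarrow> ({u, v} \<in> edges H \<longleftrightarrow> r (\<phi> u) (\<phi> v)))"
  proof safe
    fix u v assume *: "\<forall>p\<in>vpairs (verts H). {fst p, snd p} \<in> edges H \<longleftrightarrow> r (\<phi> (fst p)) (\<phi> (snd p))"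
      "u \<in> verts H" "v \<in> verts H" "u \<noteq> v"
    have "(u, v) \<in> vpairs (verts H) \<or> (v, u) \<in> vpairs (verts H)" using * by (auto simp: vpairs_def)
    then have "{u, v} \<in> edges H \<longleftrightarrow> r (\<phi> u) (\<phi> v)"
      using bspec[OF *(1), of "(u, v)"] bspec[OF *(1), of "(v, u)"] assms(2) by (auto simp: insert_commute)
    then show "{u, v} \<in> edges H \<Longrightarrow> r (\<phi> u) (\<phi> v)" "r (\<phi> u) (\<phi> v) \<Longrightarrow> {u, v} \<in> edges H" by auto
  qed (auto simp: vpairs_def)
  finally show ?thesis .
qed

text \<open>Both numbers are the probability of the same event, under a uniform injection and a
  uniform map. The injection is the map conditioned on being injective, so they differ by at most
  the probability of a collision.\<close>

lemma density_minus_hom_density: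
  assumes H: "simple_graph H" and G: "simple_graph G" and le: "gsize H \<le> gsize G"
  shows "\<bar>density H G - hom_density (verts G) H (adj G)\<bar>
         \<le> 1 - (\<Prod>j<gsize H. 1 - real j / gsize G)"
proof -
  let ?X = "verts H" and ?V = "verts G"
  let ?E = "?X \<rightarrow>\<^sub>E ?V"
  define pat where "pat \<phi> \<longleftrightarrow> (\<forall>u\<in>?X. \<forall>v\<in>?X. u \<noteq> v \<longrightarrow> ({u, v} \<in> edges H \<longleftrightarrow> {\<phi> u, \<phi> v} \<in> edges G))"
    for \<phi> :: "nat \<Rightarrow> nat"
  have fin: "finite ?X" "finite ?V" "finite ?E" and n: "gsize G > 0"
    using H G by (auto simp: simple_graph_def gsize_def card_gt_0_iff intro!: finite_PiE)
  define I where "I = injections H G"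
  have IE: "I \<subseteq> ?E" by (auto simp: I_def injections_def)
  have finI: "finite I" using IE fin(3) by (rule finite_subset)
  have cE: "real (card ?E) = real (gsize G) ^ gsize H"
    using fin by (simp add: card_funcsetE gsize_def)
  have cI: "real (card I) = (\<Prod>j<gsize H. real (gsize G) - real j)"
  proof -
    have "card I = (\<Prod>j<gsize H. gsize G - j)"
      using card_inj_on_subset_funcset[OF fin(1,2) subset_refl]
      by (simp add: I_def injections_def gsize_def atLeast0LessThan)
    then show ?thesis using le by (auto simp: of_nat_diff intro!: prod.cong)
  qed
  have cIpos: "real (card I) > 0" unfolding cI using le by (intro prod_pos) auto
  then have I0: "I \<noteq> {}" by auto
  have ratio: "real (card I) / card ?E = (\<Prod>j<gsize H. 1 - real j / gsize G)"
  proof -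
    have "(\<Prod>j<gsize H. 1 - real j / gsize G) = (\<Prod>j<gsize H. (real (gsize G) - real j) / gsize G)"
      using n by (intro prod.cong refl) (simp add: field_simps)
    then show ?thesis unfolding cI cE by (simp add: prod_dividef)
  qed
  have dens: "density H G = real (card (I \<inter> Collect pat)) / card I"
    using I0 finI by (simp add: density_def measure_pmf_of_set pat_def[abs_def] I_def)
  have hom: "hom_density ?V H (adj G) = real (card (?E \<inter> Collect pat)) / card ?E"
  proof -
    have "ind_weight H (adj G) \<phi> = of_bool (pat \<phi>)" for \<phi>
      unfolding adj_def[abs_def] pat_def
      by (rule ind_weight_of_bool) (auto simp: fin insert_commute)
    then show ?thesis using fin cE by (simp add: hom_density_def gsize_def flip: of_bool_def)
  qed
  define s r where "s = real (card (I \<inter> Collect pat))" and "r = real (card ((?E - I) \<inter> Collect pat))"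
  have "card (?E \<inter> Collect pat) = card (I \<inter> Collect pat) + card ((?E - I) \<inter> Collect pat)"
    using fin(3) finI IE by (subst card_Un_disjoint[symmetric]) (auto intro!: arg_cong[where f=card])
  then have sr: "real (card (?E \<inter> Collect pat)) = s + r" by (simp add: s_def r_def)
  have si: "s \<le> card I" unfolding s_def using finI by (auto intro: card_mono)
  have "r \<le> card (?E - I)" unfolding r_def using fin(3) by (auto intro: card_mono)
  then have ri: "r \<le> real (card ?E) - card I"
    using card_Diff_subset[OF finI IE] card_mono[OF fin(3) IE] by (simp add: of_nat_diff)
  have Epos: "real (card ?E) > 0" using cIpos card_mono[OF fin(3) IE] by linarith
  have ge0: "s \<ge> 0" "r \<ge> 0" by (auto simp: s_def r_def)
  have "s / card I - s / card ?E = (s / card I) * (1 - real (card I) / card ?E)"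
    using cIpos Epos by (simp add: field_simps)
  also have "\<dots> \<le> 1 * (1 - real (card I) / card ?E)"
    using cIpos Epos si card_mono[OF fin(3) IE] by (intro mult_right_mono) auto
  finally have 1: "s / card I - s / card ?E \<le> 1 - real (card I) / card ?E" by simp
  have 2: "s / card ?E \<le> s / card I"
    using cIpos ge0 card_mono[OF fin(3) IE] by (intro divide_left_mono) auto
  have 3: "0 \<le> r / card ?E" "r / card ?E \<le> 1 - real (card I) / card ?E"
    using ri ge0 Epos by (auto simp: field_simps)
  have "\<bar>s / card I - (s + r) / card ?E\<bar> \<le> 1 - real (card I) / card ?E"
    using 1 2 3 by (simp add: add_divide_distrib abs_le_iff)
  then show ?thesis unfolding dens hom sr ratio[symmetric] by (simp add: s_def)
qed

section \<open>The graphon of a convergent tower of step functions\<close>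

lemma prob_space_unit: "prob_space unit_space"
  by (rule prob_spaceI) (simp add: unit_space_def emeasure_restrict_space space_restrict_space)

interpretation unit: prob_space unit_space by (rule prob_space_unit)
interpretation unit2: pair_prob_space unit_space unit_space ..
interpretation unit_PiM: product_sigma_finite "\<lambda>_::nat. unit_space"
  by (rule product_sigma_finite.intro) (rule unit.sigma_finite_measure_axioms)

lemma space_unit: "space unit_space = {0..1}"
  by (simp add: unit_space_def space_restrict_space)

lemma graphon_density_ind_weight:
  assumes "finite (verts H)"
  shows "graphon_density H W = (\<integral>X. ind_weight H W X \<partial>(\<Pi>\<^sub>M u\<in>verts H. unit_space))"
proof -
  let ?V = "verts H"
  let ?A = "{(u, v). u \<in> ?V \<and> v \<in> ?V \<and> u < v \<and> {u, v} \<in> edges H}"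
  let ?B = "{(u, v). u \<in> ?V \<and> v \<in> ?V \<and> u < v \<and> {u, v} \<notin> edges H}"
  have AB: "vpairs ?V = ?A \<union> ?B" "?A \<inter> ?B = {}" by (auto simp: vpairs_def)
  have fin: "finite ?A" "finite ?B" using finite_vpairs[OF assms] unfolding AB(1) by auto
  have "ind_weight H W X = (\<Prod>(u, v)\<in>?A. W (X u) (X v)) * (\<Prod>(u, v)\<in>?B. 1 - W (X u) (X v))" for X
  proof -
    let ?f = "\<lambda>(u, v). if {u, v} \<in> edges H then W (X u) (X v) else 1 - W (X u) (X v)"
    have "ind_weight H W X = prod ?f ?A * prod ?f ?B"
      unfolding ind_weight_def AB(1) by (rule prod.union_disjoint[OF fin AB(2)])
    moreover have "prod ?f ?A = (\<Prod>(u, v)\<in>?A. W (X u) (X v))" by (rule prod.cong) auto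
    moreover have "prod ?f ?B = (\<Prod>(u, v)\<in>?B. 1 - W (X u) (X v))" by (rule prod.cong) auto
    ultimately show ?thesis by simp
  qed
  then show ?thesis by (simp only: graphon_density_def)
qed

lemma graphon_measurable_pair:
  assumes "graphon W" "u \<in> I" "v \<in> I"
  shows "(\<lambda>X. W (X u) (X v)) \<in> borel_measurable (\<Pi>\<^sub>M u\<in>I. unit_space)"
proof -
  have W: "(\<lambda>(x, y). W x y) \<in> borel_measurable (unit_space \<Otimes>\<^sub>M unit_space)"
    using assms(1) unfolding graphon_def by blast
  have "(\<lambda>X. (X u, X v)) \<in> (\<Pi>\<^sub>M u\<in>I. unit_space) \<rightarrow>\<^sub>M unit_space \<Otimes>\<^sub>M unit_space"
    using assms(2,3) by (intro measurable_Pair measurable_component_singleton)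
  from measurable_compose[OF this W] show ?thesis by simp
qed

lemma borel_measurable_ind_weight:
  assumes "graphon W"
  shows "ind_weight H W \<in> borel_measurable (\<Pi>\<^sub>M u\<in>verts H. unit_space)"
  unfolding ind_weight_def[abs_def]
proof (rule borel_measurable_prod)
  fix p assume "p \<in> vpairs (verts H)"
  then obtain u v where p: "p = (u, v)" "u \<in> verts H" "v \<in> verts H" by (auto simp: vpairs_def)
  note [measurable] = graphon_measurable_pair[OF assms p(2,3)]
  show "(\<lambda>X. case p of (u, v) \<Rightarrow> if {u, v} \<in> edges H then W (X u) (X v) else 1 - W (X u) (X v))
      \<in> borel_measurable (\<Pi>\<^sub>M u\<in>verts H. unit_space)"
    by (cases "{u, v} \<in> edges H") (simp_all add: p(1))
qed

lemma ind_weight_bounds: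
  assumes "\<And>u v. (u, v) \<in> vpairs (verts H) \<Longrightarrow> w (\<phi> u) (\<phi> v) \<in> {0..1}"
  shows "ind_weight H w \<phi> \<in> {0..1}"
proof -
  have "0 \<le> (if {u, v} \<in> edges H then w (\<phi> u) (\<phi> v) else 1 - w (\<phi> u) (\<phi> v)) \<and>
      (if {u, v} \<in> edges H then w (\<phi> u) (\<phi> v) else 1 - w (\<phi> u) (\<phi> v)) \<le> 1"
    if "(u, v) \<in> vpairs (verts H)" for u v
    using assms[OF that] by simp
  then show ?thesis
    unfolding ind_weight_def by (auto intro!: prod_nonneg prod_le_1 simp del: if_split)
qed

lemma distr_PiM_pair:
  assumes M: "prob_space M" and I: "finite I" "u \<in> I" "v \<in> I" "u \<noteq> v"
  shows "distr (\<Pi>\<^sub>M i\<in>I. M) (M \<Otimes>\<^sub>M M) (\<lambda>X. (X u, X v)) = M \<Otimes>\<^sub>M M"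
proof (rule pair_measure_eqI[symmetric])
  interpret prob_space M by fact
  interpret P: finite_product_prob_space "\<lambda>_. M" I
    by (intro finite_product_prob_space.intro finite_product_sigma_finite.intro
        product_prob_spaceI finite_product_sigma_finite_axioms.intro)
       (auto intro: M I product_sigma_finite.intro sigma_finite_measure_axioms)
  show "sigma_finite_measure M" "sigma_finite_measure M" by unfold_locales
  show "sets (M \<Otimes>\<^sub>M M) = sets (distr (\<Pi>\<^sub>M i\<in>I. M) (M \<Otimes>\<^sub>M M) (\<lambda>X. (X u, X v)))" by simp
  fix A B assume AB: "A \<in> sets M" "B \<in> sets M"
  let ?F = "\<lambda>i. if i = u then A else if i = v then B else space M"
  have eq: "(\<lambda>X. (X u, X v)) -` (A \<times> B) \<inter> space (\<Pi>\<^sub>M i\<in>I. M) = (\<Pi>\<^sub>E i\<in>I. ?F i)"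
  proof (intro set_eqI iffI)
    fix X assume X: "X \<in> (\<Pi>\<^sub>E i\<in>I. ?F i)"
    have "X i \<in> space M" if "i \<in> I" for i
      using PiE_mem[OF X that] AB[THEN sets.sets_into_space] by (auto split: if_splits)
    then show "X \<in> (\<lambda>X. (X u, X v)) -` (A \<times> B) \<inter> space (\<Pi>\<^sub>M i\<in>I. M)"
      using PiE_mem[OF X I(2)] PiE_mem[OF X I(3)] I(4) X by (auto simp: space_PiM PiE_iff)
  qed (use I in \<open>auto simp: space_PiM PiE_iff\<close>)
  have "emeasure (distr (\<Pi>\<^sub>M i\<in>I. M) (M \<Otimes>\<^sub>M M) (\<lambda>X. (X u, X v))) (A \<times> B) =
      emeasure (\<Pi>\<^sub>M i\<in>I. M) (\<Pi>\<^sub>E i\<in>I. ?F i)"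
    using AB I by (subst emeasure_distr) (auto simp: eq)
  also have "\<dots> = (\<Prod>i\<in>I. emeasure M (?F i))" using AB by (intro P.measure_times) auto
  also have "\<dots> = emeasure M A * (emeasure M B * (\<Prod>i\<in>I - {u} - {v}. emeasure M (?F i)))"
    using I by (simp add: prod.remove[of I u] prod.remove[of "I - {u}" v])
  also have "(\<Prod>i\<in>I - {u} - {v}. emeasure M (?F i)) = 1"
    by (intro prod.neutral) (auto simp: emeasure_space_1)
  finally show "emeasure M A * emeasure M B =
      emeasure (distr (\<Pi>\<^sub>M i\<in>I. M) (M \<Otimes>\<^sub>M M) (\<lambda>X. (X u, X v))) (A \<times> B)" by simp
qed

lemma AE_PiM_pair:
  assumes "prob_space M" "finite I" "u \<in> I" "v \<in> I" "u \<noteq> v" "AE (x, y) in M \<Otimes>\<^sub>M M. P x y"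
  shows "AE X in (\<Pi>\<^sub>M i\<in>I. M). P (X u) (X v)"
proof -
  have "(\<lambda>X. (X u, X v)) \<in> (\<Pi>\<^sub>M i\<in>I. M) \<rightarrow>\<^sub>M M \<Otimes>\<^sub>M M"
    using assms by (intro measurable_Pair measurable_component_singleton)
  from AE_distrD[OF this, of "\<lambda>(x, y). P x y", unfolded distr_PiM_pair[OF assms(1-5)], OF assms(6)]
  show ?thesis by simp
qed

text \<open>Two distinct coordinates are distributed as a pair from the product measure. Equal
  indices are excluded because the diagonal may be a null set, on which \<open>P\<close> may fail
  everywhere.\<close>

lemma AE_PiM_pairs:
  assumes "prob_space M" "finite I" "AE (x, y) in M \<Otimes>\<^sub>M M. P x y"
  shows "AE X in (\<Pi>\<^sub>M i\<in>I. M). \<forall>u\<in>I. \<forall>v\<in>I. u \<noteq> v \<longrightarrow> P (X u) (X v)"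
  using assms by (intro AE_finite_allI) (auto intro!: AE_impI AE_PiM_pair)

text \<open>The properties of the colourings of a graph that survive a limit of shares and
  densities. Division by \<open>4 ^ (s - t)\<close> sends a colour at time \<open>s\<close> to its
  ancestor at time \<open>t\<close>. Masses are refined as products, because the limit of densities
  over classes of vanishing share is not determined by masses.\<close>

locale step_tower =
  fixes a :: "nat \<Rightarrow> nat \<Rightarrow> real" and d :: "nat \<Rightarrow> nat \<Rightarrow> nat \<Rightarrow> real"
  assumes a_nonneg: "0 \<le> a t i"
    and a_sum: "(\<Sum>i<4 ^ t. a t i) = 1"
    and d_bounds: "d t i j \<in> {0..1}"
    and d_sym: "d t i j = d t j i"
    and a_refine: "t \<le> s \<Longrightarrow> i < 4 ^ t \<Longrightarrow> a t i = (\<Sum>k\<in>{k \<in> {..<4 ^ s}. k div 4 ^ (s - t) = i}. a s k)"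
    and mass_refine: "t \<le> s \<Longrightarrow> i < 4 ^ t \<Longrightarrow> j < 4 ^ t \<Longrightarrow> a t i * a t j * d t i j =
      (\<Sum>(k, l)\<in>{p \<in> {..<4 ^ s} \<times> {..<4 ^ s}. map_prod (\<lambda>k. k div 4 ^ (s - t)) (\<lambda>k. k div 4 ^ (s - t)) p = (i, j)}.
         a s k * a s l * d s k l)"
begin

definition endpoint :: "nat \<Rightarrow> nat \<Rightarrow> real" where
  "endpoint t i = (\<Sum>k<i. a t k)"

text \<open>The points of the unit interval are coloured by consecutive half-open intervals of lengths
  \<open>a t 0, a t 1, \<dots>\<close>; the point 1, which lies in none of them, is treated like 0.\<close>

definition colour :: "nat \<Rightarrow> real \<Rightarrow> nat" where
  "colour t x = card {i \<in> {1..<4 ^ t}. endpoint t i \<le> (if x < 1 then x else 0)}"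

definition step :: "nat \<Rightarrow> real \<Rightarrow> real \<Rightarrow> real" where
  "step t x y = d t (colour t x) (colour t y)"

lemma endpoint_mono: "i \<le> j \<Longrightarrow> endpoint t i \<le> endpoint t j"
  unfolding endpoint_def by (intro sum_mono2) (auto simp: a_nonneg)

lemma endpoint_0 [simp]: "endpoint t 0 = 0" and endpoint_last: "endpoint t (4 ^ t) = 1"
  by (simp_all add: endpoint_def a_sum)

lemma endpoint_Suc: "endpoint t (Suc i) = endpoint t i + a t i"
  by (simp add: endpoint_def)

text \<open>The intervals of the four children of a colour fill the interval of that colour exactly.
  Hence the colourings of the points nest by division by 4, like those of the vertices.\<close>

lemma endpoint_refine:
  assumes "i \<le> 4 ^ t"
  shows "endpoint (Suc t) (4 * i) = endpoint t i"
proof -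
  have "endpoint t i = (\<Sum>j<i. \<Sum>k\<in>{k \<in> {..<4 * i}. k div 4 = j}. a (Suc t) k)"
    unfolding endpoint_def
  proof (intro sum.cong refl)
    fix j assume j: "j \<in> {..<i}"
    have "{k \<in> {..<4 ^ Suc t}. k div 4 ^ (Suc t - t) = j} = {k \<in> {..<4 * i}. k div 4 = j}"
      using j assms by auto
    then show "a t j = (\<Sum>k\<in>{k \<in> {..<4 * i}. k div 4 = j}. a (Suc t) k)"
      using a_refine[of t "Suc t" j] j assms by simp
  qed
  also have "\<dots> = endpoint (Suc t) (4 * i)"
    unfolding endpoint_def by (intro sum.group) auto
  finally show ?thesis by simp
qed

lemma colour_eqI:
  assumes "i < 4 ^ t" "endpoint t i \<le> (if x < 1 then x else 0)" "(if x < 1 then x else 0) < endpoint t (Suc i)"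
  shows "colour t x = i"
proof -
  let ?x = "if x < 1 then x else 0"
  have "endpoint t k \<le> ?x \<longleftrightarrow> k \<le> i" for k
    using assms endpoint_mono[of k i t] endpoint_mono[of "Suc i" k t] by (cases "k \<le> i") auto
  then have "{k \<in> {1..<4 ^ t}. endpoint t k \<le> ?x} = {k \<in> {1..<4 ^ t}. k \<le> i}" by (simp only:)
  also have "\<dots> = {1..i}" using assms(1) by auto
  finally have "{k \<in> {1..<4 ^ t}. endpoint t k \<le> ?x} = {1..i}" .
  then show ?thesis unfolding colour_def by simp
qed

lemma colour_bounds:
  assumes "0 \<le> x"
  shows "colour t x < 4 ^ t" "endpoint t (colour t x) \<le> (if x < 1 then x else 0)"
    "(if x < 1 then x else 0) < endpoint t (Suc (colour t x))"
proof -
  let ?x = "if x < 1 then x else 0"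
  define i where "i = (LEAST i. ?x < endpoint t (Suc i))"
  have ex: "?x < endpoint t (Suc (4 ^ t - 1))" using endpoint_last[of t] by simp
  have i: "?x < endpoint t (Suc i)" unfolding i_def using ex by (rule LeastI)
  have "i \<le> 4 ^ t - 1" unfolding i_def using ex by (rule Least_le)
  then have lt: "i < 4 ^ t" by (metis Suc_pred' le_imp_less_Suc zero_less_numeral zero_less_power)
  have "endpoint t i \<le> ?x"
  proof (cases i)
    case (Suc k)
    then show ?thesis using not_less_Least[of k "\<lambda>i. ?x < endpoint t (Suc i)"] by (simp add: i_def not_less)
  qed (use assms in auto)
  from colour_eqI[OF lt this i] have c: "colour t x = i" .
  show "colour t x < 4 ^ t" "endpoint t (colour t x) \<le> ?x"
    "?x < endpoint t (Suc (colour t x))" unfolding c using lt \<open>endpoint t i \<le> ?x\<close> i by blast+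
qed

lemma colour_Suc_div:
  assumes "0 \<le> x"
  shows "colour (Suc t) x div 4 = colour t x"
proof -
  let ?k = "colour (Suc t) x" and ?x = "if x < 1 then x else 0"
  note k = colour_bounds[OF assms, of "Suc t"]
  have i: "?k div 4 < 4 ^ t" using k(1) by (simp add: less_mult_imp_div_less mult.commute)
  have "endpoint t (?k div 4) = endpoint (Suc t) (4 * (?k div 4))" using i by (simp add: endpoint_refine)
  also have "\<dots> \<le> endpoint (Suc t) ?k" by (intro endpoint_mono) simp
  finally have 1: "endpoint t (?k div 4) \<le> ?x" using k(2) by linarith
  have "endpoint (Suc t) (Suc ?k) \<le> endpoint (Suc t) (4 * Suc (?k div 4))" by (intro endpoint_mono) simp
  also have "\<dots> = endpoint t (Suc (?k div 4))" using i by (intro endpoint_refine) simp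
  finally have 2: "?x < endpoint t (Suc (?k div 4))" using k(3) by linarith
  show ?thesis using colour_eqI[OF i 1 2] by simp
qed

lemma colour_div:
  assumes "0 \<le> x" "t \<le> s"
  shows "colour s x div 4 ^ (s - t) = colour t x"
  using assms(2)
proof (induction s rule: dec_induct)
  case (step s)
  have "colour (Suc s) x div 4 ^ (Suc s - t) = colour (Suc s) x div 4 div 4 ^ (s - t)"
    using step.hyps by (simp add: Suc_diff_le div_mult2_eq)
  then show ?case unfolding colour_Suc_div[OF assms(1)] step.IH .
qed simp

lemma measurable_colour [measurable]: "colour t \<in> measurable borel (count_space UNIV)"
proof -
  have "colour t = (\<lambda>x. \<Sum>i\<in>{1..<4 ^ t}. if endpoint t i \<le> (if x < 1 then x else 0) then 1 else 0)"
    by (rule ext) (simp only: colour_def card_eq_sum sum.inter_filter finite_atLeastLessThan)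
  moreover have "Measurable.pred borel (\<lambda>x. endpoint t i \<le> (if x < 1 then x else 0))" for i by measurable
  ultimately show ?thesis by (simp only:) (intro measurable_sum_nat measurable_If measurable_const, auto)
qed

lemma measurable_colour_unit [measurable]: "colour t \<in> measurable unit_space (count_space UNIV)"
  unfolding unit_space_def by (rule measurable_restrict_space1) simp

lemma emeasure_colour:
  assumes "i < 4 ^ t"
  shows "emeasure unit_space {x \<in> space unit_space. colour t x = i} = ennreal (a t i)"
proof -
  have sub: "{endpoint t i..<endpoint t (Suc i)} \<subseteq> {0..<1}"
    using endpoint_mono[of 0 i t] endpoint_mono[of "Suc i" "4 ^ t" t] assms by (auto simp: endpoint_last)
  have "emeasure unit_space {x \<in> space unit_space. colour t x = i} =
      emeasure lborel {x \<in> {0..1}. colour t x = i}"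
    unfolding unit_space_def space_unit[unfolded unit_space_def] by (subst emeasure_restrict_space) auto
  also have "\<dots> = emeasure lborel {endpoint t i..<endpoint t (Suc i)}"
  proof (rule emeasure_eq_AE)
    \<comment> \<open>The two sets differ at most in the point 1, which has the colour of 0.\<close>
    show "AE x in lborel. x \<in> {x \<in> {0..1}. colour t x = i} \<longleftrightarrow> x \<in> {endpoint t i..<endpoint t (Suc i)}"
      using AE_lborel_singleton[of "1::real"]
    proof eventually_elim
      case (elim x)
      show ?case
      proof
        assume "x \<in> {x \<in> {0..1}. colour t x = i}"
        then show "x \<in> {endpoint t i..<endpoint t (Suc i)}"
          using elim colour_bounds[of x t] by auto
      next
        assume x: "x \<in> {endpoint t i..<endpoint t (Suc i)}"
        with sub have "x \<in> {0..<1}" by blast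
        with x show "x \<in> {x \<in> {0..1}. colour t x = i}" using colour_eqI[OF assms, of x] by auto
      qed
    qed
  qed auto
  also have "\<dots> = ennreal (a t i)" using a_nonneg by (simp add: endpoint_Suc)
  finally show ?thesis .
qed

lemma nn_integral_colour:
  fixes f :: "nat \<Rightarrow> ennreal"
  shows "(\<integral>\<^sup>+x. f (colour t x) \<partial>unit_space) = (\<Sum>i<4 ^ t. ennreal (a t i) * f i)"
proof -
  have "(\<integral>\<^sup>+x. f (colour t x) \<partial>unit_space) =
    (\<integral>\<^sup>+x. (\<Sum>i<4 ^ t. f i * indicator {x \<in> space unit_space. colour t x = i} x) \<partial>unit_space)"
  proof (rule nn_integral_cong)
    fix x assume x: "x \<in> space unit_space"
    then have "colour t x < 4 ^ t" by (intro colour_bounds) (simp add: space_unit)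
    then show "f (colour t x) = (\<Sum>i<4 ^ t. f i * indicator {x \<in> space unit_space. colour t x = i} x)"
      using x by (simp add: indicator_def if_distrib cong: if_cong)
  qed
  also have "\<dots> = (\<Sum>i<4 ^ t. \<integral>\<^sup>+x. f i * indicator {x \<in> space unit_space. colour t x = i} x \<partial>unit_space)"
    by (intro nn_integral_sum) auto
  also have "\<dots> = (\<Sum>i<4 ^ t. ennreal (a t i) * f i)"
    by (intro sum.cong refl) (simp add: nn_integral_cmult_indicator emeasure_colour mult.commute)
  finally show ?thesis .
qed

lemma graphon_step: "graphon (step t)"
proof -
  have "(\<lambda>p. (\<lambda>(i, j). d t i j) (colour t (fst p), colour t (snd p)))
      \<in> borel_measurable (unit_space \<Otimes>\<^sub>M unit_space)"
    by (rule measurable_compose[of _ _ "count_space UNIV \<Otimes>\<^sub>M count_space UNIV"])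
       (auto simp: pair_measure_countable)
  then show ?thesis
    using d_bounds d_sym by (auto simp: graphon_def step_def case_prod_unfold)
qed

text \<open>Expand over all colour patterns \<open>\<phi>\<close>: at a sample \<open>X\<close> only
  the pattern of its own colours contributes, and by independence that pattern has as probability
  the product of the shares.\<close>

lemma graphon_density_step:
  assumes X: "finite (verts H)"
  shows "graphon_density H (step t) = step_density (4 ^ t) H (a t) (d t)"
proof -
  let ?X = "verts H" and ?P = "\<Pi>\<^sub>M u\<in>verts H. unit_space" and ?E = "verts H \<rightarrow>\<^sub>E {..<4 ^ t :: nat}"
  let ?B = "\<lambda>i. {x \<in> space unit_space. colour t x = i}"
  have "graphon_density H (step t) = (\<integral>X. ind_weight H (step t) X \<partial>?P)"
    using X by (rule graphon_density_ind_weight)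
  also have "\<dots> = (\<integral>X. (\<Sum>\<phi>\<in>?E. ind_weight H (d t) \<phi> * (\<Prod>u\<in>?X. indicator (?B (\<phi> u)) (X u))) \<partial>?P)"
  proof (rule Bochner_Integration.integral_cong[OF refl])
    fix X assume XP: "X \<in> space ?P"
    then have XU: "X u \<in> space unit_space" if "u \<in> ?X" for u using that by (auto simp: space_PiM)
    define \<psi> where "\<psi> = restrict (\<lambda>u. colour t (X u)) ?X"
    have \<psi>: "\<psi> \<in> ?E" using XU by (auto simp: \<psi>_def space_unit intro!: colour_bounds)
    have ind: "(\<Prod>u\<in>?X. indicator (?B (\<phi> u)) (X u)) = (of_bool (\<phi> = \<psi>) :: real)" if "\<phi> \<in> ?E" for \<phi>
    proof -
      have "(\<Prod>u\<in>?X. indicator (?B (\<phi> u)) (X u)) = (\<Prod>u\<in>?X. of_bool (\<phi> u = \<psi> u) :: real)"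
        using XU by (intro prod.cong refl) (auto simp: \<psi>_def indicator_def)
      also have "\<dots> = of_bool (\<phi> = \<psi>)"
        using X by (subst prod_of_bool) (auto intro!: PiE_ext[OF that \<psi>])
      finally show ?thesis .
    qed
    have "(\<Sum>\<phi>\<in>?E. ind_weight H (d t) \<phi> * (\<Prod>u\<in>?X. indicator (?B (\<phi> u)) (X u))) =
      (\<Sum>\<phi>\<in>?E. ind_weight H (d t) \<phi> * of_bool (\<phi> = \<psi>))"
      by (intro sum.cong refl) (simp only: ind)
    also have "\<dots> = ind_weight H (d t) \<psi>"
      using X \<psi> finite_PiE[of ?X "\<lambda>_. {..<4 ^ t :: nat}"] by (simp add: of_bool_def if_distrib cong: if_cong)
    also have "\<dots> = ind_weight H (step t) X"
      unfolding ind_weight_def by (intro prod.cong refl) (auto simp: \<psi>_def vpairs_def step_def)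
    finally show "ind_weight H (step t) X =
      (\<Sum>\<phi>\<in>?E. ind_weight H (d t) \<phi> * (\<Prod>u\<in>?X. indicator (?B (\<phi> u)) (X u)))" by simp
  qed
  also have "\<dots> = (\<Sum>\<phi>\<in>?E. ind_weight H (d t) \<phi> * (\<integral>X. (\<Prod>u\<in>?X. indicator (?B (\<phi> u)) (X u)) \<partial>?P))"
    using X by (subst Bochner_Integration.integral_sum)
       (auto intro!: integrable_mult_right unit_PiM.product_integrable_prod integrable_real_indicator
          simp: less_top[symmetric])
  also have "\<dots> = step_density (4 ^ t) H (a t) (d t)"
    unfolding step_density_def
  proof (intro sum.cong refl)
    fix \<phi> assume \<phi>: "\<phi> \<in> ?E"
    have "(\<integral>X. (\<Prod>u\<in>?X. indicator (?B (\<phi> u)) (X u) :: real) \<partial>?P) =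
      (\<Prod>u\<in>?X. \<integral>x. indicator (?B (\<phi> u)) x \<partial>unit_space)"
      using X by (rule unit_PiM.product_integral_prod[where f="\<lambda>u. indicator (?B (\<phi> u)) :: real \<Rightarrow> real"])
        (auto intro!: integrable_real_indicator simp: less_top[symmetric])
    also have "\<dots> = (\<Prod>u\<in>?X. a t (\<phi> u))"
    proof (intro prod.cong refl)
      fix u assume "u \<in> ?X"
      then have "\<phi> u < 4 ^ t" using \<phi> by auto
      from emeasure_colour[OF this] a_nonneg show "(\<integral>x. indicator (?B (\<phi> u)) x \<partial>unit_space) = a t (\<phi> u)"
        by (simp add: measure_def Int_absorb2 subset_eq)
    qed
    finally show "ind_weight H (d t) \<phi> * (\<integral>X. (\<Prod>u\<in>?X. indicator (?B (\<phi> u)) (X u)) \<partial>?P) =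
      (\<Prod>u\<in>?X. a t (\<phi> u)) * ind_weight H (d t) \<phi>" by simp
  qed
  finally show ?thesis .
qed

abbreviation "en t \<equiv> energy (4 ^ t) (a t) (d t)"

lemma en_diff:
  assumes "t \<le> s"
  shows "(\<Sum>(k, l)\<in>{..<4 ^ s} \<times> {..<4 ^ s}. a s k * a s l *
     (d s k l - d t (k div 4 ^ (s - t)) (l div 4 ^ (s - t)))\<^sup>2) = en s - en t"
proof (rule refinement_variance)
  have "(4::nat) ^ s = 4 ^ t * 4 ^ (s - t)" using assms by (simp add: power_add[symmetric])
  then show "(\<lambda>k. k div 4 ^ (s - t)) ` {..<4 ^ s} \<subseteq> {..<(4::nat) ^ t}"
    by (auto simp: less_mult_imp_div_less)
qed (use assms a_refine mass_refine in auto)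

lemma en_mono: "t \<le> s \<Longrightarrow> en t \<le> en s"
  using en_diff[of t s] sum_nonneg[of "{..<4 ^ s} \<times> {..<4 ^ s}" "\<lambda>(k, l). a s k * a s l *
     (d s k l - d t (k div 4 ^ (s - t)) (l div 4 ^ (s - t)))\<^sup>2"] a_nonneg
  by (fastforce simp: case_prod_unfold)

lemma en_bounds: "en t \<in> {0..1}"
  by (rule energy_bounds) (use a_nonneg d_bounds a_sum in auto)

text \<open>Orthogonality of martingale increments: the squared L^2 distance of two stages is the
  difference of their energies.\<close>

lemma nn_integral_step_diff:
  assumes "t \<le> s"
  shows "(\<integral>\<^sup>+(x, y). ennreal ((step s x y - step t x y)\<^sup>2) \<partial>(unit_space \<Otimes>\<^sub>M unit_space)) = ennreal (en s - en t)"
proof -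
  note [measurable] = graphon_step[unfolded graphon_def, THEN conjunct1]
  let ?F = "\<lambda>k l. (d s k l - d t (k div 4 ^ (s - t)) (l div 4 ^ (s - t)))\<^sup>2"
  have "(\<integral>\<^sup>+(x, y). ennreal ((step s x y - step t x y)\<^sup>2) \<partial>(unit_space \<Otimes>\<^sub>M unit_space)) =
    (\<integral>\<^sup>+x. \<integral>\<^sup>+y. ennreal ((step s x y - step t x y)\<^sup>2) \<partial>unit_space \<partial>unit_space)"
    by (subst unit.nn_integral_fst[symmetric]) (auto simp: case_prod_unfold)
  also have "\<dots> = (\<integral>\<^sup>+x. \<integral>\<^sup>+y. ennreal (?F (colour s x) (colour s y)) \<partial>unit_space \<partial>unit_space)"
    by (intro nn_integral_cong) (simp add: step_def space_unit colour_div assms)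
  also have "\<dots> = (\<Sum>k<4 ^ s. ennreal (a s k) * (\<Sum>l<4 ^ s. ennreal (a s l) * ennreal (?F k l)))"
    unfolding nn_integral_colour[of "\<lambda>l. ennreal (?F _ l)"]
    by (rule nn_integral_colour)
  also have "\<dots> = ennreal (\<Sum>k<4 ^ s. \<Sum>l<4 ^ s. a s k * a s l * ?F k l)"
    using a_nonneg by (simp add: ennreal_mult[symmetric] sum_nonneg sum_ennreal sum_distrib_left mult.assoc)
  also have "(\<Sum>k<4 ^ s. \<Sum>l<4 ^ s. a s k * a s l * ?F k l) = en s - en t"
    using en_diff[OF assms] by (simp add: sum.cartesian_product)
  finally show ?thesis .
qed

end

section \<open>Compactness of graph limits\<close>

context step_tower
begin

text \<open>The energies converge, so times \<open>\<tau> j\<close> exist after which at most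
  \<open>4 ^ -j\<close> of energy is gained. The L^2 increments along \<open>\<tau>\<close> then
  decay geometrically, their sum is finite almost everywhere, and dominated convergence carries the
  pointwise limit over to the densities.\<close>

lemma exists_limit_graphon:
  "\<exists>\<tau> W. strict_mono \<tau> \<and> graphon W \<and>
     (\<forall>H. finite (verts H) \<longrightarrow> (\<lambda>j. graphon_density H (step (\<tau> j))) \<longlonglongrightarrow> graphon_density H W)"
proof -
  let ?U2 = "unit_space \<Otimes>\<^sub>M unit_space"
  have "incseq en" by (intro incseq_SucI en_mono) simp
  moreover have "en t \<le> 1" for t using en_bounds[of t] by simp
  ultimately obtain E where E: "en \<longlonglongrightarrow> E" "\<And>t. en t \<le> E"
    using incseq_convergent[of en 1] by blast
  have "\<exists>T. \<forall>t\<ge>T. E - en t \<le> (1/4) ^ j" for j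
  proof -
    from LIMSEQ_D[OF E(1), of "(1/4) ^ j"] obtain T where T: "\<And>t. t \<ge> T \<Longrightarrow> norm (en t - E) < (1/4) ^ j"
      by auto
    have "E - en t \<le> (1/4) ^ j" if "t \<ge> T" for t using T[OF that] by (simp add: abs_real_def split: if_splits)
    then show ?thesis by blast
  qed
  then obtain T where T: "\<And>j t. t \<ge> T j \<Longrightarrow> E - en t \<le> (1/4) ^ j" by metis
  have "\<exists>\<tau>. \<forall>j. T j \<le> \<tau> j \<and> \<tau> j < \<tau> (Suc j)"
  proof (rule dependent_nat_choice)
    fix x n show "\<exists>y. T (Suc n) \<le> y \<and> x < y" by (intro exI[of _ "max (T (Suc n)) (Suc x)"]) auto
  qed auto
  then obtain \<tau> where \<tau>: "\<And>j. T j \<le> \<tau> j" "\<And>j. \<tau> j < \<tau> (Suc j)" by blast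
  then have mono: "strict_mono \<tau>" by (simp add: strict_mono_Suc_iff)
  define z where "z j x y = \<bar>step (\<tau> (Suc j)) x y - step (\<tau> j) x y\<bar>" for j x y
  have zm [measurable]: "(\<lambda>p. z j (fst p) (snd p)) \<in> borel_measurable ?U2" for j
  proof -
    have [measurable]: "(\<lambda>p. step t (fst p) (snd p)) \<in> borel_measurable ?U2" for t
      using graphon_step[of t] by (simp add: graphon_def case_prod_unfold)
    show ?thesis unfolding z_def by measurable
  qed
  have zint: "(\<integral>\<^sup>+p. ennreal (z j (fst p) (snd p)) \<partial>?U2) \<le> ennreal (2 * (1/2) ^ j)" for j
  proof -
    have z2: "(\<integral>\<^sup>+p. ennreal ((z j (fst p) (snd p))\<^sup>2) \<partial>?U2) \<le> ennreal ((1/4) ^ j)"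
    proof -
      have "(\<integral>\<^sup>+p. ennreal ((z j (fst p) (snd p))\<^sup>2) \<partial>?U2) = ennreal (en (\<tau> (Suc j)) - en (\<tau> j))"
        using nn_integral_step_diff[of "\<tau> j" "\<tau> (Suc j)"] \<tau>(2)[of j] by (simp add: z_def case_prod_unfold)
      also have "\<dots> \<le> ennreal ((1/4) ^ j)"
        using E(2)[of "\<tau> (Suc j)"] T[OF \<tau>(1), of j] by (intro ennreal_leI) linarith
      finally show ?thesis .
    qed
    \<comment> \<open>The first summand covers \<open>z\<close> below \<open>2 ^ -j\<close>, the
      second one larger \<open>z\<close>. Integrated with second moment at most
      \<open>4 ^ -j\<close>, both contribute \<open>2 ^ -j\<close>.\<close>
    have bd: "ennreal z \<le> ennreal ((1/2) ^ j) + ennreal (2 ^ j) * ennreal (z\<^sup>2)" if "z \<ge> 0" for z :: real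
    proof -
      have "z \<le> (1/2) ^ j + 2 ^ j * z\<^sup>2"
      proof (cases "z \<le> (1/2) ^ j")
        case False
        then have "1 \<le> 2 ^ j * z" by (simp add: power_divide field_simps)
        then have "z * 1 \<le> z * (2 ^ j * z)" using that by (intro mult_left_mono)
        then show ?thesis by (simp add: power2_eq_square mult_ac add_increasing)
      qed (simp add: add_increasing2)
      then show ?thesis using that by (simp add: ennreal_mult[symmetric] ennreal_plus[symmetric] del: ennreal_plus)
    qed
    have "(\<integral>\<^sup>+p. ennreal (z j (fst p) (snd p)) \<partial>?U2) \<le>
       (\<integral>\<^sup>+p. ennreal ((1/2) ^ j) + ennreal (2 ^ j) * ennreal ((z j (fst p) (snd p))\<^sup>2) \<partial>?U2)"
      by (intro nn_integral_mono bd) (simp add: z_def)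
    also have "\<dots> = ennreal ((1/2) ^ j) + ennreal (2 ^ j) * (\<integral>\<^sup>+p. ennreal ((z j (fst p) (snd p))\<^sup>2) \<partial>?U2)"
      by (subst nn_integral_add) (auto simp: nn_integral_cmult unit2.emeasure_space_1)
    also have "\<dots> \<le> ennreal ((1/2) ^ j) + ennreal (2 ^ j) * ennreal ((1/4) ^ j)"
      by (intro add_left_mono mult_left_mono z2) simp
    also have "\<dots> = ennreal (2 * (1/2) ^ j)"
    proof -
      have "(2::real) ^ j * (1/4) ^ j = (1/2) ^ j" by (simp add: power_mult_distrib[symmetric])
      then show ?thesis by (simp add: ennreal_mult[symmetric] ennreal_plus[symmetric] del: ennreal_plus)
    qed
    finally show ?thesis .
  qed
  \<comment> \<open>Clamping keeps \<open>W\<close> a graphon at points without a limit, where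
    \<open>lim\<close> is unspecified; at points of convergence the limit lies in the unit interval
    and is unchanged.\<close>
  define W where "W x y = max 0 (min 1 (lim (\<lambda>j. step (\<tau> j) x y)))" for x y
  have W: "graphon W"
  proof -
    have [measurable]: "(\<lambda>p. step t (fst p) (snd p)) \<in> borel_measurable ?U2" for t
      using graphon_step[of t] by (simp add: graphon_def case_prod_unfold)
    have "(\<lambda>p. W (fst p) (snd p)) \<in> borel_measurable ?U2"
      unfolding W_def by measurable
    moreover have "W x y = W y x" for x y using d_sym by (simp add: W_def step_def)
    ultimately show ?thesis by (auto simp: graphon_def case_prod_unfold W_def)
  qed
  have "(\<integral>\<^sup>+p. (\<Sum>j. ennreal (z j (fst p) (snd p))) \<partial>?U2) =
      (\<Sum>j. \<integral>\<^sup>+p. ennreal (z j (fst p) (snd p)) \<partial>?U2)"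
    by (rule nn_integral_suminf) measurable
  also have "\<dots> \<le> (\<Sum>j. ennreal (2 * (1/2) ^ j))" by (intro suminf_le zint) auto
  also have "\<dots> < \<infinity>"
  proof -
    have "summable (\<lambda>j. 2 * (1/2::real) ^ j)" by (intro summable_mult summable_geometric) simp
    then show ?thesis by (subst suminf_ennreal2) auto
  qed
  finally have fin: "(\<integral>\<^sup>+p. (\<Sum>j. ennreal (z j (fst p) (snd p))) \<partial>?U2) \<noteq> \<infinity>" by simp
  have "AE p in ?U2. (\<Sum>j. ennreal (z j (fst p) (snd p))) \<noteq> \<infinity>"
    by (rule nn_integral_PInf_AE[OF _ fin]) measurable
  then have conv: "AE (x, y) in ?U2. (\<lambda>j. step (\<tau> j) x y) \<longlonglongrightarrow> W x y"
  proof eventually_elim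
    case (elim p)
    obtain x y where p: "p = (x, y)" by force
    have "summable (\<lambda>j. z j x y)"
      using elim by (intro summable_suminf_not_top) (auto simp: z_def p)
    then have "summable (\<lambda>j. step (\<tau> (Suc j)) x y - step (\<tau> j) x y)"
      unfolding z_def by (rule summable_rabs_cancel)
    then obtain l where "(\<lambda>n. \<Sum>j<n. step (\<tau> (Suc j)) x y - step (\<tau> j) x y) \<longlonglongrightarrow> l"
      using summable_LIMSEQ by blast
    then have "(\<lambda>n. step (\<tau> n) x y - step (\<tau> 0) x y) \<longlonglongrightarrow> l"
      by (simp add: sum_lessThan_telescope[of "\<lambda>j. step (\<tau> j) x y"])
    from tendsto_add[OF this tendsto_const[of "step (\<tau> 0) x y"]]
    have L: "(\<lambda>n. step (\<tau> n) x y) \<longlonglongrightarrow> l + step (\<tau> 0) x y" by simp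
    have "l + step (\<tau> 0) x y \<in> {0..1}"
      by (rule closed_sequentially[OF closed_atLeastAtMost _ L]) (use d_bounds in \<open>auto simp: step_def\<close>)
    then have "W x y = l + step (\<tau> 0) x y" using limI[OF L] by (simp add: W_def)
    then show ?case using L p by simp
  qed
  have "(\<lambda>j. graphon_density H (step (\<tau> j))) \<longlonglongrightarrow> graphon_density H W" if H: "finite (verts H)" for H
  proof -
    let ?P = "\<Pi>\<^sub>M u\<in>verts H. unit_space"
    interpret P: prob_space ?P by (rule prob_space_PiM) (rule prob_space_unit)
    have "(\<lambda>j. \<integral>X. ind_weight H (step (\<tau> j)) X \<partial>?P) \<longlonglongrightarrow> (\<integral>X. ind_weight H W X \<partial>?P)"
    proof (rule integral_dominated_convergence[where w="\<lambda>_. 1"])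
      show "ind_weight H W \<in> borel_measurable ?P" by (rule borel_measurable_ind_weight[OF W])
      show "ind_weight H (step (\<tau> j)) \<in> borel_measurable ?P" for j
        by (rule borel_measurable_ind_weight[OF graphon_step])
      show "AE X in ?P. norm (ind_weight H (step (\<tau> j)) X) \<le> 1" for j
      proof (rule AE_I2)
        fix X
        have "ind_weight H (step (\<tau> j)) X \<in> {0..1}"
          by (rule ind_weight_bounds) (use d_bounds in \<open>auto simp: step_def\<close>)
        then show "norm (ind_weight H (step (\<tau> j)) X) \<le> 1" by simp
      qed
      show "AE X in ?P. (\<lambda>j. ind_weight H (step (\<tau> j)) X) \<longlonglongrightarrow> ind_weight H W X"
        using AE_PiM_pairs[OF prob_space_unit H conv]
      proof eventually_elim
        case (elim X)
        show ?case unfolding ind_weight_def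
        proof (intro tendsto_prod)
          fix p assume "p \<in> vpairs (verts H)"
          then obtain u v where p: "p = (u, v)" "u \<in> verts H" "v \<in> verts H" "u \<noteq> v"
            by (auto simp: vpairs_def)
          then have "(\<lambda>j. step (\<tau> j) (X u) (X v)) \<longlonglongrightarrow> W (X u) (X v)" using elim by blast
          then show "(\<lambda>j. case p of (u, v) \<Rightarrow> if {u, v} \<in> edges H then step (\<tau> j) (X u) (X v)
              else 1 - step (\<tau> j) (X u) (X v)) \<longlonglongrightarrow>
            (case p of (u, v) \<Rightarrow> if {u, v} \<in> edges H then W (X u) (X v) else 1 - W (X u) (X v))"
            unfolding p(1) by (cases "{u, v} \<in> edges H") (auto intro: tendsto_intros)
        qed
      qed
    qed simp
    then show ?thesis using H by (simp add: graphon_density_ind_weight)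
  qed
  then show ?thesis using mono W by blast
qed

end

section \<open>From a sequence of graphs to a tower of step functions\<close>

lemma bounded_diagonal_subsequence:
  fixes X :: "nat \<Rightarrow> nat \<Rightarrow> real"
  assumes "\<And>k n. X k n \<in> {0..1}"
  shows "\<exists>r. strict_mono r \<and> (\<forall>k. convergent (\<lambda>n. X k (r n)))"
proof -
  interpret subseqs "\<lambda>k s. convergent (\<lambda>n. X k (s n))"
  proof
    fix k :: nat and s :: "nat \<Rightarrow> nat"
    have "seq_compact {0..1::real}" by (intro compact_imp_seq_compact compact_Icc)
    then obtain l r where "strict_mono r" "((\<lambda>n. X k (s n)) \<circ> r) \<longlonglongrightarrow> l"
      using assms by (blast elim: seq_compactE[of _ "\<lambda>n. X k (s n)"])
    then show "\<exists>r'. strict_mono r' \<and> convergent (\<lambda>n. X k ((s \<circ> r') n))"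
      by (auto simp: o_def convergent_def)
  qed
  have "convergent (\<lambda>n. X k (diagseq n))" for k
  proof -
    \<comment> \<open>The diagonal sequence is tied to the k-th extracted subsequence only from
      index \<open>Suc k\<close> on; dropping the first terms does not affect the limit.\<close>
    have "convergent (\<lambda>n. X k ((diagseq \<circ> ((+) (Suc k))) n))"
    proof (rule diagseq_holds)
      fix r s n assume "strict_mono (r::nat \<Rightarrow> nat)" "convergent (\<lambda>m. X n (s m))"
      from convergent_subseq_convergent[OF this(2,1)] show "convergent (\<lambda>m. X n ((s \<circ> r) m))"
        by (simp add: o_def)
    qed
    then have "convergent (\<lambda>n. X k (diagseq (n + Suc k)))" by (simp add: o_def add.commute)
    then obtain L where "(\<lambda>n. X k (diagseq (n + Suc k))) \<longlonglongrightarrow> L" using convergentD by blast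
    then have "(\<lambda>n. X k (diagseq n)) \<longlonglongrightarrow> L" by (rule LIMSEQ_offset)
    then show ?thesis by (rule convergentI)
  qed
  then show ?thesis using subseq_diagseq by blast
qed

lemma hom_density_adj_tendsto:
  assumes G: "\<And>n. simple_graph (G n)" "filterlim (\<lambda>n. gsize (G n)) at_top sequentially"
    and H: "simple_graph H"
  shows "(\<lambda>n. density H (G n) - hom_density (verts (G n)) H (adj (G n))) \<longlonglongrightarrow> 0"
proof (rule Lim_null_comparison)
  show "\<forall>\<^sub>F n in sequentially. norm (density H (G n) - hom_density (verts (G n)) H (adj (G n))) \<le>
      1 - (\<Prod>j<gsize H. 1 - real j / gsize (G n))"
    using filterlim_at_top[THEN iffD1, OF G(2), rule_format, of "gsize H"]
    by eventually_elim (simp add: density_minus_hom_density G H)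
  have "filterlim (\<lambda>n. real (gsize (G n))) at_top sequentially"
    by (rule filterlim_compose[OF filterlim_real_sequentially G(2)])
  then have "(\<lambda>n. real j / gsize (G n)) \<longlonglongrightarrow> 0" for j
    by (intro tendsto_divide_0[OF tendsto_const] filterlim_at_top_imp_at_infinity)
  then have "(\<lambda>n. 1 - (\<Prod>j<gsize H. 1 - real j / gsize (G n))) \<longlonglongrightarrow> 1 - (\<Prod>j<gsize H. 1 - 0)"
    by (intro tendsto_intros)
  then show "(\<lambda>n. 1 - (\<Prod>j<gsize H. 1 - real j / gsize (G n))) \<longlonglongrightarrow> 0" by simp
qed

text \<open>The density in \<open>G (r n)\<close> is compared with that in \<open>W\<close> in four
  moves: from injections to maps, from the graph to its block densities, from these to their limits,
  and from the step function to \<open>W\<close>. The last move fixes the start \<open>s\<close> of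
  a window of times, the second its length \<open>T\<close>; the third then concerns only finitely
  many times, so one bound on \<open>n\<close> suffices.\<close>

theorem graph_sequence_compactness:
  assumes G: "\<And>n. simple_graph (G n)" "filterlim (\<lambda>n. gsize (G n)) at_top sequentially"
  shows "\<exists>r W. strict_mono r \<and> graphon W \<and>
    (\<forall>H. simple_graph H \<longrightarrow> (\<lambda>n. density H (G (r n))) \<longlonglongrightarrow> graphon_density H W)"
proof -
  have V: "finite (verts (G n))" "verts (G n) \<noteq> {}" for n using G(1)[of n] by (auto simp: simple_graph_def)
  have A: "adj g u v \<in> {0..1}" "adj g u v = adj g v u" for g u v by (auto simp: adj_def insert_commute)
  let ?sh = "\<lambda>n c. colour_share (verts (G n)) c" and ?de = "\<lambda>n c. block_density (verts (G n)) (adj (G n)) c"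
  let ?Q = "\<lambda>n c. (\<forall>t v. c t v < 4 ^ t) \<and> (\<forall>t v. c (Suc t) v div 4 = c t v) \<and>
    (\<forall>t S T. S \<subseteq> verts (G n) \<longrightarrow> T \<subseteq> verts (G n) \<longrightarrow>
      (\<Sum>(u, v)\<in>S \<times> T. adj (G n) u v - ?de n (c t) (c t u) (c t v))\<^sup>2 \<le> real (card (verts (G n))) ^ 4 *
       (energy (4 ^ Suc t) (?sh n (c (Suc t))) (?de n (c (Suc t))) - energy (4 ^ t) (?sh n (c t)) (?de n (c t))))"
  have "\<forall>n. \<exists>c. ?Q n c" by (intro allI exists_colouring_tower V A)
  from choice[OF this] obtain c where c: "\<forall>n. ?Q n (c n)" ..
  define a where "a n t = ?sh n (c n t)" for n t
  define d where "d n t = ?de n (c n t)" for n t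
  have clt: "c n t v < 4 ^ t" and cSuc: "c n (Suc t) v div 4 = c n t v" for n t v
    using c[rule_format, of n, THEN conjunct1] c[rule_format, of n, THEN conjunct2, THEN conjunct1] by blast+
  have cim: "c n t ` X \<subseteq> {..<4 ^ t}" for n t X using clt by auto
  have cdiv: "c n s v div 4 ^ (s - t) = c n t v" if "t \<le> s" for n s t v
    using that
  proof (induction s rule: dec_induct)
    case (step s)
    have "c n (Suc s) v div 4 ^ (Suc s - t) = c n (Suc s) v div 4 div 4 ^ (s - t)"
      using step.hyps by (simp add: Suc_diff_le div_mult2_eq)
    then show ?case unfolding cSuc step.IH .
  qed simp
  have a01: "a n t i \<in> {0..1}" for n t i
    using colour_share_bounds V by (simp add: a_def)
  have d01: "d n t i j \<in> {0..1}" for n t i j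
    unfolding d_def by (intro block_density_bounds V A)
  \<comment> \<open>All shares and block densities, over all times and colours, form one countable
    family, so that one subsequence makes all of them converge.\<close>
  define X where "X k n = (case from_nat k of Inl (t, i) \<Rightarrow> a n t i | Inr (t, i, j) \<Rightarrow> d n t i j)"
    for k n
  have "X k n \<in> {0..1}" for k n using a01 d01 by (simp add: X_def split: sum.split prod.split)
  from bounded_diagonal_subsequence[of X, OF this] obtain r where r: "strict_mono r"
    and Xr: "\<And>k. convergent (\<lambda>n. X k (r n))" by blast
  define la where "la t i = lim (\<lambda>n. a (r n) t i)" for t i
  define ld where "ld t i j = lim (\<lambda>n. d (r n) t i j)" for t i j
  have la: "(\<lambda>n. a (r n) t i) \<longlonglongrightarrow> la t i" for t i
    using Xr[of "to_nat (Inl (t, i) :: nat \<times> nat + nat \<times> nat \<times> nat)"]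
    by (simp add: X_def la_def convergent_LIMSEQ_iff)
  have ld: "(\<lambda>n. d (r n) t i j) \<longlonglongrightarrow> ld t i j" for t i j
    using Xr[of "to_nat (Inr (t, i, j) :: nat \<times> nat + nat \<times> nat \<times> nat)"]
    by (simp add: X_def ld_def convergent_LIMSEQ_iff)
  interpret step_tower la ld
  proof
    fix t s i j :: nat
    show "0 \<le> la t i"
      using closed_sequentially[OF closed_atLeastAtMost _ la[of t i], of 0 1] a01 by simp
    show "ld t i j \<in> {0..1}"
      using closed_sequentially[OF closed_atLeastAtMost _ ld[of t i j], of 0 1] d01 by simp
    show "ld t i j = ld t j i"
      unfolding ld_def d_def by (subst block_density_sym) (auto simp: A)
    have "(\<lambda>n. \<Sum>i<4 ^ t. a (r n) t i) \<longlonglongrightarrow> (\<Sum>i<4 ^ t. la t i)" by (intro tendsto_sum la)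
    moreover have "(\<Sum>i<4 ^ t. a n t i) = 1" for n
      unfolding a_def by (intro sum_colour_share V cim) simp
    ultimately show "(\<Sum>i<4 ^ t. la t i) = 1" using LIMSEQ_unique[OF _ tendsto_const] by fastforce
    assume ts: "t \<le> s"
    show "la t i = (\<Sum>k\<in>{k \<in> {..<4 ^ s}. k div 4 ^ (s - t) = i}. la s k)"
    proof (rule LIMSEQ_unique[OF la])
      have "a n t i = (\<Sum>k\<in>{k \<in> {..<4 ^ s}. k div 4 ^ (s - t) = i}. a n s k)" for n
        unfolding a_def by (intro colour_share_refine V cim) (simp_all add: cdiv[OF ts])
      moreover have "(\<lambda>n. \<Sum>k\<in>{k \<in> {..<4 ^ s}. k div 4 ^ (s - t) = i}. a (r n) s k) \<longlonglongrightarrow>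
          (\<Sum>k\<in>{k \<in> {..<4 ^ s}. k div 4 ^ (s - t) = i}. la s k)" by (intro tendsto_sum la)
      ultimately show "(\<lambda>n. a (r n) t i) \<longlonglongrightarrow> (\<Sum>k\<in>{k \<in> {..<4 ^ s}. k div 4 ^ (s - t) = i}. la s k)"
        by simp
    qed
    let ?f = "\<lambda>k. k div 4 ^ (s - t) :: nat"
    let ?F = "{p \<in> {..<4 ^ s} \<times> {..<4 ^ s}. map_prod ?f ?f p = (i, j)}"
    show "la t i * la t j * ld t i j = (\<Sum>(k, l)\<in>?F. la s k * la s l * ld s k l)"
    proof (rule LIMSEQ_unique)
      show "(\<lambda>n. a (r n) t i * a (r n) t j * d (r n) t i j) \<longlonglongrightarrow> la t i * la t j * ld t i j"
        by (intro tendsto_mult la ld)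
      have "a n t i * a n t j * d n t i j = (\<Sum>(k, l)\<in>?F. a n s k * a n s l * d n s k l)" for n
        unfolding a_def d_def share_share_density[OF V(1) A(1)]
        by (subst block_mass_refine[where c'="c n s" and f="?f" and I'="{..<4 ^ s}", OF V(1) cim])
           (simp_all add: cdiv[OF ts] case_prod_unfold)
      moreover have "(\<lambda>n. \<Sum>(k, l)\<in>?F. a (r n) s k * a (r n) s l * d (r n) s k l) \<longlonglongrightarrow>
          (\<Sum>(k, l)\<in>?F. la s k * la s l * ld s k l)"
        unfolding case_prod_unfold by (intro tendsto_sum tendsto_mult la ld)
      ultimately show "(\<lambda>n. a (r n) t i * a (r n) t j * d (r n) t i j) \<longlonglongrightarrow>
          (\<Sum>(k, l)\<in>?F. la s k * la s l * ld s k l)" by simp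
    qed
  qed
  obtain \<tau> W where \<tau>: "strict_mono \<tau>" and W: "graphon W"
    and \<tau>W: "\<And>H. finite (verts H) \<Longrightarrow> (\<lambda>j. graphon_density H (step (\<tau> j))) \<longlonglongrightarrow> graphon_density H W"
    using exists_limit_graphon by blast
  define e where "e n t = energy (4 ^ t) (a n t) (d n t)" for n t
  have npos: "real (card (verts (G n))) > 0" for n using V by (simp add: card_gt_0_iff)
  have cut: "(\<Sum>(u, v)\<in>S \<times> T. adj (G n) u v - d n t (c n t u) (c n t v))\<^sup>2
      \<le> real (card (verts (G n))) ^ 4 * (e n (Suc t) - e n t)"
    if "S \<subseteq> verts (G n)" "T \<subseteq> verts (G n)" for n t S T
    using c[rule_format, of n, THEN conjunct2, THEN conjunct2, rule_format, OF that]
    unfolding e_def a_def d_def .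
  have e_inc: "incseq (e n)" for n
  proof (rule incseq_SucI)
    fix t show "e n t \<le> e n (Suc t)"
      \<comment> \<open>The empty cut has error 0, which forces the energy gain to be
        nonnegative.\<close>
      using cut[of "{}" n "{}" t] npos[of n] by (simp add: zero_le_mult_iff)
  qed
  have e01: "e n t \<in> {0..1}" for n t
    unfolding e_def
  proof (rule energy_bounds)
    show "(\<Sum>i<4 ^ t. a n t i) = 1" unfolding a_def by (intro sum_colour_share V cim) simp
  qed (use a01 d01 in auto)
  \<comment> \<open>Pigeonhole: the gains at the times \<open>\<tau> j\<close> in the window belong
    to disjoint stretches of time, hence add up to at most 1. Only times of the form
    \<open>\<tau> j\<close> are of use, since the step functions approach \<open>W\<close> along
    \<open>\<tau>\<close>.\<close>
  have small_step: "\<exists>j\<in>{s..<s + T}. e n (Suc (\<tau> j)) - e n (\<tau> j) \<le> 1 / real T" if "T > 0" for n s T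
  proof (rule ccontr)
    assume no: "\<not> ?thesis"
    have big: "1 / real T < e n (Suc (\<tau> j)) - e n (\<tau> j)" if "j \<in> {s..<s + T}" for j
      using no that by (meson not_le)
    have "(\<Sum>j\<in>{s..<s + T}. 1 / real T) < (\<Sum>j\<in>{s..<s + T}. e n (Suc (\<tau> j)) - e n (\<tau> j))"
      using that by (intro sum_strict_mono big) auto
    also have "\<dots> \<le> (\<Sum>j\<in>{s..<s + T}. e n (\<tau> (Suc j)) - e n (\<tau> j))"
      using \<tau> by (intro sum_mono diff_right_mono incseqD[OF e_inc]) (simp add: strict_mono_Suc_iff Suc_leI)
    also have "\<dots> = e n (\<tau> (s + T)) - e n (\<tau> s)" by (rule sum_Suc_diff') simp
    also have "\<dots> \<le> 1" using e01[of n "\<tau> (s + T)"] e01[of n "\<tau> s"] by simp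
    finally show False using that by simp
  qed
  have "(\<lambda>n. density H (G (r n))) \<longlonglongrightarrow> graphon_density H W" if H: "simple_graph H" for H
  proof (rule LIMSEQ_I)
    fix \<epsilon> :: real assume \<epsilon>: "\<epsilon> > 0"
    have finH: "finite (verts H)" using H by (simp add: simple_graph_def)
    let ?m = "real (card (vpairs (verts H)))"
    \<comment> \<open>The energy gain bounds the square of a cut, hence the root.\<close>
    have "(\<lambda>T. ?m * sqrt (1 / real T)) \<longlonglongrightarrow> ?m * sqrt 0"
      by (intro tendsto_intros lim_1_over_n)
    then have "\<forall>\<^sub>F T in sequentially. ?m * sqrt (1 / real T) < \<epsilon> / 4"
      using \<epsilon> by (intro order_tendstoD) auto
    then obtain T where T: "T > 0" "?m * sqrt (1 / real T) < \<epsilon> / 4"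
      using eventually_conj[OF eventually_gt_at_top[of 0]] by (metis (mono_tags, lifting) eventually_happens' sequentially_bot)
    obtain s where s: "\<And>j. j \<ge> s \<Longrightarrow> \<bar>graphon_density H (step (\<tau> j)) - graphon_density H W\<bar> < \<epsilon> / 4"
      using LIMSEQ_D[OF \<tau>W[OF finH], of "\<epsilon> / 4"] \<epsilon> by auto
    let ?sd = "\<lambda>n t. step_density (4 ^ t) H (a n t) (d n t)"
    have sd: "(\<lambda>n. ?sd (r n) t) \<longlonglongrightarrow> graphon_density H (step t)" for t
      unfolding graphon_density_step[OF finH] step_density_def ind_weight_def
    proof (intro tendsto_sum tendsto_mult tendsto_prod la)
      fix \<phi> :: "nat \<Rightarrow> nat" and p :: "nat \<times> nat"
      obtain u v where p: "p = (u, v)" by force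
      show "(\<lambda>n. case p of (u, v) \<Rightarrow> if {u, v} \<in> edges H then d (r n) t (\<phi> u) (\<phi> v) else 1 - d (r n) t (\<phi> u) (\<phi> v))
         \<longlonglongrightarrow> (case p of (u, v) \<Rightarrow> if {u, v} \<in> edges H then ld t (\<phi> u) (\<phi> v) else 1 - ld t (\<phi> u) (\<phi> v))"
        unfolding p by (cases "{u, v} \<in> edges H") (auto intro!: tendsto_intros ld)
    qed
    have "\<forall>\<^sub>F n in sequentially. \<forall>j\<in>{s..<s + T}. \<bar>?sd (r n) (\<tau> j) - graphon_density H (step (\<tau> j))\<bar> < \<epsilon> / 4"
    proof (intro eventually_ball_finite ballI)
      fix j
      show "\<forall>\<^sub>F n in sequentially. \<bar>?sd (r n) (\<tau> j) - graphon_density H (step (\<tau> j))\<bar> < \<epsilon> / 4"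
        using tendstoD[OF sd, of "\<epsilon> / 4" "\<tau> j"] \<epsilon> by (simp add: dist_real_def)
    qed simp
    moreover have "\<forall>\<^sub>F n in sequentially.
        \<bar>density H (G (r n)) - hom_density (verts (G (r n))) H (adj (G (r n)))\<bar> < \<epsilon> / 4"
      using tendstoD[OF LIMSEQ_subseq_LIMSEQ[OF hom_density_adj_tendsto[OF G H] r], of "\<epsilon> / 4"] \<epsilon>
      by (simp add: dist_real_def o_def)
    ultimately have "\<forall>\<^sub>F n in sequentially. norm (density H (G (r n)) - graphon_density H W) < \<epsilon>"
    proof eventually_elim
      case (elim n)
      let ?V = "verts (G (r n))"
      obtain j where j: "j \<in> {s..<s + T}" "e (r n) (Suc (\<tau> j)) - e (r n) (\<tau> j) \<le> 1 / real T"
        using small_step[OF T(1)] by blast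
      let ?B = "\<lambda>u v. d (r n) (\<tau> j) (c (r n) (\<tau> j) u) (c (r n) (\<tau> j) v)"
      have "\<bar>hom_density ?V H (adj (G (r n))) - hom_density ?V H ?B\<bar> \<le> ?m * sqrt (1 / real T)"
      proof (rule counting_lemma[OF V finH])
        show "adj (G (r n)) x y \<in> {0..1}" "?B x y \<in> {0..1}" for x y by (rule A(1), rule d01)
        fix S S' assume "S \<subseteq> ?V" "S' \<subseteq> ?V"
        from cut[OF this] have "(\<Sum>(u, v)\<in>S \<times> S'. adj (G (r n)) u v - ?B u v)\<^sup>2 \<le>
            real (card ?V) ^ 4 * (e (r n) (Suc (\<tau> j)) - e (r n) (\<tau> j))" .
        also have "\<dots> \<le> real (card ?V) ^ 4 * (1 / real T)" using j by (intro mult_left_mono) auto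
        also have "\<dots> = (sqrt (1 / real T) * (real (card ?V))\<^sup>2)\<^sup>2" by (simp add: power_mult_distrib)
        finally have "\<bar>\<Sum>(u, v)\<in>S \<times> S'. adj (G (r n)) u v - ?B u v\<bar>\<^sup>2 \<le>
            (sqrt (1 / real T) * (real (card ?V))\<^sup>2)\<^sup>2" by (simp only: power2_abs)
        then show "\<bar>\<Sum>(u, v)\<in>S \<times> S'. adj (G (r n)) u v - ?B u v\<bar> \<le> sqrt (1 / real T) * (card ?V)\<^sup>2"
          unfolding of_nat_power by (rule power2_le_imp_le) simp
      qed
      moreover have "hom_density ?V H ?B = ?sd (r n) (\<tau> j)"
        unfolding a_def by (intro hom_density_step V finH clt)
      moreover have "\<bar>?sd (r n) (\<tau> j) - graphon_density H (step (\<tau> j))\<bar> < \<epsilon> / 4" using elim(1) j by blast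
      moreover have "\<bar>graphon_density H (step (\<tau> j)) - graphon_density H W\<bar> < \<epsilon> / 4" using s j by auto
      ultimately show ?case using elim(2) T(2) by (simp only: real_norm_def)
    qed
    then show "\<exists>N. \<forall>n\<ge>N. norm (density H (G (r n)) - graphon_density H W) < \<epsilon>"
      by (simp add: eventually_sequentially)
  qed
  then show ?thesis using r W by blast
qed

section \<open>Approximation by finitely many types\<close>

text \<open>These are the finite unions of measurable rectangles; \<open>p x\<close> encodes which of the rectangles
  meet the row of \<open>x\<close>.\<close>

definition finite_type :: "'a measure \<Rightarrow> ('a \<times> 'a) set \<Rightarrow> bool" where
  "finite_type M T \<longleftrightarrow> (\<exists>(N::nat) p R. p \<in> M \<rightarrow>\<^sub>M count_space UNIV \<and> (\<forall>x. p x < N) \<and>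
     (\<forall>i. R i \<in> sets M) \<and> T = {q \<in> space (M \<Otimes>\<^sub>M M). snd q \<in> R (p (fst q))})"

lemma finite_type_sets:
  assumes "finite_type M T"
  shows "T \<in> sets (M \<Otimes>\<^sub>M M)"
proof -
  obtain N p R where p [measurable]: "p \<in> M \<rightarrow>\<^sub>M count_space UNIV" and N: "\<And>x. p x < (N::nat)"
    and R [measurable]: "\<And>i. R i \<in> sets M" and T: "T = {q \<in> space (M \<Otimes>\<^sub>M M). snd q \<in> R (p (fst q))}"
    using assms unfolding finite_type_def by blast
  have "T = (\<Union>i<N. (p -` {i} \<inter> space M) \<times> R i)"
    using N R[THEN sets.sets_into_space] unfolding T by (auto simp: space_pair_measure)
  also have "\<dots> \<in> sets (M \<Otimes>\<^sub>M M)"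
    by (intro sets.finite_UN pair_measureI measurable_sets[OF p] R) auto
  finally show ?thesis .
qed

lemma finite_type_Compl:
  assumes "finite_type M T"
  shows "finite_type M (space (M \<Otimes>\<^sub>M M) - T)"
proof -
  obtain N p R where p: "p \<in> M \<rightarrow>\<^sub>M count_space UNIV" and N: "\<And>x. p x < (N::nat)"
    and R: "\<And>i. R i \<in> sets M" and T: "T = {q \<in> space (M \<Otimes>\<^sub>M M). snd q \<in> R (p (fst q))}"
    using assms unfolding finite_type_def by blast
  show ?thesis unfolding finite_type_def
    by (rule exI[of _ N], rule exI[of _ p], rule exI[of _ "\<lambda>i. space M - R i"])
       (use p N R in \<open>auto simp: T space_pair_measure\<close>)
qed

lemma finite_type_Un:
  assumes "finite_type M T1" "finite_type M T2"
  shows "finite_type M (T1 \<union> T2)"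
proof -
  obtain N1 p1 R1 where 1: "p1 \<in> M \<rightarrow>\<^sub>M count_space UNIV" "\<And>x. p1 x < (N1::nat)"
    "\<And>i. R1 i \<in> sets M" and T1: "T1 = {q \<in> space (M \<Otimes>\<^sub>M M). snd q \<in> R1 (p1 (fst q))}"
    using assms(1) unfolding finite_type_def by blast
  obtain N2 p2 R2 where 2: "p2 \<in> M \<rightarrow>\<^sub>M count_space UNIV" "\<And>x. p2 x < (N2::nat)"
    "\<And>i. R2 i \<in> sets M" and T2: "T2 = {q \<in> space (M \<Otimes>\<^sub>M M). snd q \<in> R2 (p2 (fst q))}"
    using assms(2) unfolding finite_type_def by blast
  note [measurable] = 1(1) 2(1)
  let ?p = "\<lambda>x. p1 x * N2 + p2 x"
  have dm: "?p x div N2 = p1 x" "?p x mod N2 = p2 x" for x using 2(2)[of x] by auto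
  have lt: "?p x < N1 * N2" for x
  proof -
    have "?p x < (p1 x + 1) * N2" using 2(2)[of x] by simp
    also have "\<dots> \<le> N1 * N2" using 1(2)[of x] by (intro mult_right_mono) auto
    finally show ?thesis .
  qed
  show ?thesis unfolding finite_type_def
  proof (intro exI conjI allI)
    show "?p \<in> M \<rightarrow>\<^sub>M count_space UNIV" by measurable
    show "?p x < N1 * N2" for x by (rule lt)
    show "R1 (i div N2) \<union> R2 (i mod N2) \<in> sets M" for i using 1 2 by auto
    show "T1 \<union> T2 = {q \<in> space (M \<Otimes>\<^sub>M M). snd q \<in> R1 (?p (fst q) div N2) \<union> R2 (?p (fst q) mod N2)}"
      unfolding dm T1 T2 by auto
  qed
qed

lemma finite_type_Times:
  assumes "A \<in> sets M" "B \<in> sets M"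
  shows "finite_type M (A \<times> B)"
  unfolding finite_type_def
proof (intro exI conjI allI)
  show "(\<lambda>x. of_bool (x \<in> A) :: nat) \<in> M \<rightarrow>\<^sub>M count_space UNIV"
    using assms(1) unfolding of_bool_def by measurable
  show "of_bool (x \<in> A) < (2::nat)" for x by simp
  show "(if i = (1::nat) then B else {}) \<in> sets M" for i using assms by auto
  show "A \<times> B = {q \<in> space (M \<Otimes>\<^sub>M M). snd q \<in> (if of_bool (fst q \<in> A) = (1::nat) then B else {})}"
    using assms[THEN sets.sets_into_space] by (auto simp: space_pair_measure split: if_splits)
qed

lemma finite_type_UN:
  assumes "\<And>i. i < n \<Longrightarrow> finite_type M (T i)"
  shows "finite_type M (\<Union>i<n::nat. T i)"
  using assms
proof (induction n)
  case 0
  show ?case using finite_type_Times[of "{}" M "{}"] by simp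
next
  case (Suc n)
  then show ?case by (simp add: lessThan_Suc finite_type_Un)
qed

text \<open>The approximable sets contain the rectangles and form a sigma-algebra. For a countable
  union, half of \<open>\<epsilon>\<close> pays for truncation to \<open>n\<close> sets and the
  other half is shared among these; \<open>Suc n\<close> avoids division by zero.\<close>

lemma finite_type_approximation:
  assumes "prob_space M" and S: "S \<in> sets (M \<Otimes>\<^sub>M M)"
  shows "\<forall>\<epsilon>>0. \<exists>T. finite_type M T \<and> measure (M \<Otimes>\<^sub>M M) (sym_diff S T) \<le> \<epsilon>"
proof -
  interpret prob_space M by fact
  interpret P: pair_prob_space M M ..
  have "S \<in> sigma_sets (space M \<times> space M) {a \<times> b |a b. a \<in> sets M \<and> b \<in> sets M}"
    using S by (simp add: sets_pair_measure)
  then show ?thesis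
  proof induction
    case (Basic S)
    then obtain a b where "S = a \<times> b" "a \<in> sets M" "b \<in> sets M" by blast
    then have "finite_type M S" by (simp add: finite_type_Times)
    then show ?case by (intro allI impI exI[of _ S]) simp
  next
    case Empty
    have "finite_type M {}" using finite_type_Times[of "{}" M "{}"] by simp
    then show ?case by (intro allI impI exI[of _ "{}"]) simp
  next
    case (Compl S)
    show ?case
    proof (intro allI impI)
      fix \<epsilon> :: real assume "\<epsilon> > 0"
      then obtain T where T: "finite_type M T" "measure (M \<Otimes>\<^sub>M M) (sym_diff S T) \<le> \<epsilon>" using Compl by blast
      have "T \<subseteq> space M \<times> space M" using finite_type_sets[OF T(1), THEN sets.sets_into_space]
        by (simp add: space_pair_measure)
      moreover have "S \<subseteq> space M \<times> space M"
        using Compl(1) by (rule sigma_sets_into_sp[rotated]) (auto dest: sets.sets_into_space)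
      ultimately have "sym_diff (space M \<times> space M - S) (space (M \<Otimes>\<^sub>M M) - T) = sym_diff S T"
        by (auto simp: space_pair_measure)
      then show "\<exists>T. finite_type M T \<and> measure (M \<Otimes>\<^sub>M M) (sym_diff (space M \<times> space M - S) T) \<le> \<epsilon>"
        using T finite_type_Compl by metis
    qed
  next
    case (Union A)
    have Am [measurable]: "A i \<in> sets (M \<Otimes>\<^sub>M M)" for i
      using Union(1)[of i] by (simp add: sets_pair_measure)
    show ?case
    proof (intro allI impI)
      fix \<epsilon> :: real assume \<epsilon>: "\<epsilon> > 0"
      let ?\<mu> = "measure (M \<Otimes>\<^sub>M M)" and ?B = "\<lambda>n. \<Union>i<n. A i"
      have "(\<lambda>n. ?\<mu> (?B n)) \<longlonglongrightarrow> ?\<mu> (\<Union>n. ?B n)"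
        by (intro P.finite_Lim_measure_incseq) (auto intro!: incseq_SucI simp: lessThan_Suc)
      moreover have "(\<Union>n. ?B n) = (\<Union>i. A i)" by auto
      ultimately obtain n where n: "\<bar>?\<mu> (?B n) - ?\<mu> (\<Union>i. A i)\<bar> < \<epsilon> / 2"
        using LIMSEQ_D[of "\<lambda>n. ?\<mu> (?B n)" _ "\<epsilon> / 2"] \<epsilon> by fastforce
      have "\<forall>i. \<exists>T. finite_type M T \<and> ?\<mu> (sym_diff (A i) T) \<le> \<epsilon> / (2 * real (Suc n))"
        using Union(2) \<epsilon> by simp
      then obtain T where T: "\<And>i. finite_type M (T i)" "\<And>i. ?\<mu> (sym_diff (A i) (T i)) \<le> \<epsilon> / (2 * real (Suc n))"
        by metis
      note [measurable] = finite_type_sets[OF T(1)]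
      have "?\<mu> (sym_diff (\<Union>i. A i) (\<Union>i<n. T i)) \<le>
          ?\<mu> (((\<Union>i. A i) - ?B n) \<union> (\<Union>i<n. sym_diff (A i) (T i)))"
        proof (rule P.finite_measure_mono)
          show "((\<Union>i. A i) - ?B n) \<union> (\<Union>i<n. sym_diff (A i) (T i)) \<in> sets (M \<Otimes>\<^sub>M M)" by measurable
        qed blast
      also have "\<dots> \<le> ?\<mu> ((\<Union>i. A i) - ?B n) + ?\<mu> (\<Union>i<n. sym_diff (A i) (T i))"
        by (rule measure_Un_le) measurable
      also have "?\<mu> ((\<Union>i. A i) - ?B n) = ?\<mu> (\<Union>i. A i) - ?\<mu> (?B n)"
        by (rule P.finite_measure_Diff) auto
      also have "?\<mu> (\<Union>i<n. sym_diff (A i) (T i)) \<le> (\<Sum>i<n. ?\<mu> (sym_diff (A i) (T i)))"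
        by (rule P.finite_measure_subadditive_finite) auto
      also have "\<dots> \<le> (\<Sum>i<n. \<epsilon> / (2 * real (Suc n)))" by (intro sum_mono T)
      also have "\<dots> \<le> \<epsilon> / 2" using \<epsilon> by (simp add: field_simps)
      finally have "?\<mu> (sym_diff (\<Union>i. A i) (\<Union>i<n. T i)) \<le> \<epsilon>" using n by linarith
      then show "\<exists>T. finite_type M T \<and> ?\<mu> (sym_diff (\<Union>i. A i) T) \<le> \<epsilon>"
        using finite_type_UN[of n M T] T(1) by blast
    qed
  qed
qed

text \<open>The L^1 distance of the rows of \<open>x\<close> and \<open>z\<close> in the indicator
  function of \<open>S\<close>.\<close>

definition disagreement :: "'a measure \<Rightarrow> ('a \<times> 'a) set \<Rightarrow> 'a \<Rightarrow> 'a \<Rightarrow> real" where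
  "disagreement M S x z = (\<integral>y. of_bool (((x, y) \<in> S) \<noteq> ((z, y) \<in> S)) \<partial>M)"

text \<open>Fubini in a form that keeps the index set: the outer sample still has a coordinate
  \<open>i\<close>, but the integrand overwrites it with a fresh point. This isolates one vertex of
  a sample without re-indexing the others.\<close>

lemma integral_resample:
  fixes f :: "('i \<Rightarrow> 'a) \<Rightarrow> real"
  assumes "prob_space M" "finite I" "i \<in> I"
    and f [measurable]: "f \<in> borel_measurable (\<Pi>\<^sub>M i\<in>I. M)" and bd: "\<And>X. \<bar>f X\<bar> \<le> B"
  shows "(\<integral>X. f X \<partial>(\<Pi>\<^sub>M i\<in>I. M)) = (\<integral>X. (\<integral>y. f (X(i := y)) \<partial>M) \<partial>(\<Pi>\<^sub>M i\<in>I. M))"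
    and "(\<lambda>X. \<integral>y. f (X(i := y)) \<partial>M) \<in> borel_measurable (\<Pi>\<^sub>M i\<in>I. M)"
proof -
  interpret prob_space M by fact
  interpret product_sigma_finite "\<lambda>_::'i. M" by (rule product_sigma_finite.intro) unfold_locales
  let ?P = "\<Pi>\<^sub>M i\<in>I. M" and ?g = "\<lambda>X. \<integral>y. f (X(i := y)) \<partial>M"
  interpret P: prob_space ?P by (rule prob_space_PiM) (rule assms)
  have "(\<lambda>q. (fst q)(i := snd q)) \<in> ?P \<Otimes>\<^sub>M M \<rightarrow>\<^sub>M ?P"
    by (rule measurable_fun_upd[where J=I]) (use assms in auto)
  from measurable_compose[OF this f] have "(\<lambda>(X, y). f (X(i := y))) \<in> borel_measurable (?P \<Otimes>\<^sub>M M)"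
    by (simp add: case_prod_unfold)
  then show g [measurable]: "?g \<in> borel_measurable ?P"
    by (rule borel_measurable_lebesgue_integral)
  have gb: "\<bar>?g X\<bar> \<le> B" for X
  proof -
    have "B \<ge> 0" using bd[of X] by linarith
    have "\<bar>?g X\<bar> \<le> (\<integral>y. \<bar>f (X(i := y))\<bar> \<partial>M)" by (rule integral_abs_bound)
    also have "\<dots> \<le> B"
    proof (cases "integrable M (\<lambda>y. \<bar>f (X(i := y))\<bar>)")
      case True
      then have "(\<integral>y. \<bar>f (X(i := y))\<bar> \<partial>M) \<le> (\<integral>y. B \<partial>M)" by (intro integral_mono bd) auto
      then show ?thesis by (simp add: prob_space)
    qed (use \<open>B \<ge> 0\<close> in \<open>simp add: not_integrable_integral_eq\<close>)
    finally show ?thesis .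
  qed
  obtain J where J: "I = insert i J" "i \<notin> J" "finite J"
    using assms(2,3) by (metis Set.set_insert finite_insert)
  have fi: "integrable ?P f" by (rule P.integrable_const_bound[of _ B]) (use bd in auto)
  have gi: "integrable ?P ?g" by (rule P.integrable_const_bound[of _ B]) (use gb in auto)
  have "integral\<^sup>L ?P f = (\<integral>X. (\<integral>y. f (X(i := y)) \<partial>M) \<partial>(\<Pi>\<^sub>M i\<in>J. M))"
    using fi unfolding J(1) by (rule product_integral_insert[OF J(3,2)])
  also have "\<dots> = (\<integral>X. (\<integral>z. ?g (X(i := z)) \<partial>M) \<partial>(\<Pi>\<^sub>M i\<in>J. M))"
    by (simp add: prob_space)
  also have "\<dots> = integral\<^sup>L ?P ?g"
    using gi unfolding J(1) by (rule product_integral_insert[OF J(3,2), symmetric])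
  finally show "integral\<^sup>L ?P f = integral\<^sup>L ?P ?g" .
qed

section \<open>Prediction of adjacency in random-free graphons\<close>

(* These rules would rewrite the index sets {..<2 + m + k} of the samples. *)
declare add_2_eq_Suc [simp del] add_2_eq_Suc' [simp del]

text \<open>In a sample, vertex 0 and vertex 1 form the pair whose adjacency is to be predicted, the
  vertices \<open>2, \<dots>, m + 1\<close> are the references and the following \<open>k\<close> vertices are the tests. The
  prediction is the adjacency of vertex 1 to the reference that looks most like vertex 0 on the
  tests.\<close>

definition mismatch :: "nat \<Rightarrow> nat \<Rightarrow> (nat \<Rightarrow> nat \<Rightarrow> bool) \<Rightarrow> nat \<Rightarrow> nat" where
  "mismatch m k r i = card {j \<in> {..<k}. r 0 (2 + m + j) \<noteq> r (2 + i) (2 + m + j)}"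

text \<open>Ties are broken by the least index, so the choice is a function of the sampled
  adjacencies alone.\<close>

definition nearest :: "nat \<Rightarrow> nat \<Rightarrow> (nat \<Rightarrow> nat \<Rightarrow> bool) \<Rightarrow> nat" where
  "nearest m k r = (LEAST i. i < m \<and> (\<forall>i'<m. mismatch m k r i \<le> mismatch m k r i'))"

definition mispredict :: "nat \<Rightarrow> nat \<Rightarrow> (nat \<Rightarrow> nat \<Rightarrow> bool) \<Rightarrow> bool" where
  "mispredict m k r \<longleftrightarrow> r 0 1 \<noteq> r (2 + nearest m k r) 1"

lemma nearest:
  assumes "m > 0"
  shows "nearest m k r < m" "i < m \<Longrightarrow> mismatch m k r (nearest m k r) \<le> mismatch m k r i"
proof -
  have "\<exists>i. i < m \<and> (\<forall>i'<m. mismatch m k r i \<le> mismatch m k r i')"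
    using ex_has_least_nat[of "\<lambda>i. i < m" 0 "mismatch m k r"] assms by auto
  from LeastI_ex[OF this] show "nearest m k r < m"
    "i < m \<Longrightarrow> mismatch m k r (nearest m k r) \<le> mismatch m k r i"
    unfolding nearest_def by auto
qed

lemma mismatch_cong:
  assumes "\<And>i j. i < m \<Longrightarrow> j < k \<Longrightarrow> r (2 + i) (2 + m + j) = r' (2 + i) (2 + m + j)"
    and "\<And>j. j < k \<Longrightarrow> r 0 (2 + m + j) = r' 0 (2 + m + j)" and "i < m"
  shows "mismatch m k r i = mismatch m k r' i"
  unfolding mismatch_def using assms by (intro arg_cong[where f=card]) auto

text \<open>The reference is chosen without looking at vertex 1. In a random sample vertex 1 is
  therefore independent of the choice, and in a graph the choice depends on \<open>x\<close> but not
  on \<open>y\<close>.\<close>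

lemma nearest_cong:
  assumes "\<And>i j. i < m \<Longrightarrow> j < k \<Longrightarrow> r (2 + i) (2 + m + j) = r' (2 + i) (2 + m + j)"
    and "\<And>j. j < k \<Longrightarrow> r 0 (2 + m + j) = r' 0 (2 + m + j)"
  shows "nearest m k r = nearest m k r'"
proof -
  have "mismatch m k r i = mismatch m k r' i" if "i < m" for i
    using assms that by (rule mismatch_cong)
  then have "(\<lambda>i. i < m \<and> (\<forall>i'<m. mismatch m k r i \<le> mismatch m k r i')) =
      (\<lambda>i. i < m \<and> (\<forall>i'<m. mismatch m k r' i \<le> mismatch m k r' i'))"
    by (intro ext) (metis (no_types, lifting))
  then show ?thesis unfolding nearest_def by simp
qed

text \<open>Diagonal values of \<open>r\<close> are never read, as vertices 0 and 1, references and
  tests carry different labels. So misprediction is a property of the labelled graph on the sample,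
  even if \<open>S\<close> contains diagonal points.\<close>

lemma mispredict_cong:
  assumes "m > 0" and r: "\<And>a b. a < 2 + m + k \<Longrightarrow> b < 2 + m + k \<Longrightarrow> a \<noteq> b \<Longrightarrow> r a b = r' a b"
  shows "mispredict m k r = mispredict m k r'"
proof -
  have "nearest m k r = nearest m k r'" by (rule nearest_cong; rule r; arith)
  then show ?thesis unfolding mispredict_def using nearest(1)[OF assms(1), of k r'] by (auto simp: r)
qed

locale sampled_relation = prob_space M for M :: "'a measure" +
  fixes S :: "('a \<times> 'a) set"
  assumes S [measurable]: "S \<in> sets (M \<Otimes>\<^sub>M M)"
begin

abbreviation "D \<equiv> disagreement M S"

abbreviation sample_space :: "nat \<Rightarrow> (nat \<Rightarrow> 'a) measure" where
  "sample_space K \<equiv> \<Pi>\<^sub>M i\<in>{..<K}. M"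

definition rel :: "(nat \<Rightarrow> 'a) \<Rightarrow> nat \<Rightarrow> nat \<Rightarrow> bool" where
  "rel X a b \<longleftrightarrow> (X a, X b) \<in> S"

lemma prob_space_sample: "prob_space (sample_space K)"
  by (rule prob_space_PiM) (rule prob_space_axioms)

section \<open>Measurability of the prediction\<close>

lemma measurable_diff_pred:
  assumes [measurable]: "f \<in> N \<rightarrow>\<^sub>M M" "g \<in> N \<rightarrow>\<^sub>M M" "h \<in> N \<rightarrow>\<^sub>M M"
  shows "(\<lambda>x. of_bool (((f x, h x) \<in> S) \<noteq> ((g x, h x) \<in> S)) :: real) \<in> borel_measurable N"
  unfolding of_bool_def by measurable

lemma measurable_rel:
  assumes "a < K" "b < K"
  shows "Measurable.pred (sample_space K) (\<lambda>X. rel X a b)"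
proof -
  have [measurable]: "(\<lambda>X. X a) \<in> sample_space K \<rightarrow>\<^sub>M M" "(\<lambda>X. X b) \<in> sample_space K \<rightarrow>\<^sub>M M"
    using assms by (auto intro: measurable_component_singleton)
  show ?thesis unfolding rel_def by measurable
qed

lemma measurable_mismatch:
  assumes "i < m"
  shows "(\<lambda>X. mismatch m k (rel X) i) \<in> sample_space (2 + m + k) \<rightarrow>\<^sub>M count_space UNIV"
proof -
  have pred: "Measurable.pred (sample_space (2 + m + k)) (\<lambda>X. rel X 0 (2 + m + j) \<noteq> rel X (2 + i) (2 + m + j))"
    if "j < k" for j
  proof -
    have [measurable]: "Measurable.pred (sample_space (2 + m + k)) (\<lambda>X. rel X 0 (2 + m + j))"
      "Measurable.pred (sample_space (2 + m + k)) (\<lambda>X. rel X (2 + i) (2 + m + j))"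
      using assms that by (auto intro!: measurable_rel)
    show ?thesis by measurable
  qed
  have "(\<lambda>X. mismatch m k (rel X) i) =
      (\<lambda>X. \<Sum>j<k. if rel X 0 (2 + m + j) \<noteq> rel X (2 + i) (2 + m + j) then 1 else 0)"
    by (rule ext) (simp only: mismatch_def card_eq_sum sum.inter_filter finite_lessThan)
  then show ?thesis
    by (simp only:) (intro measurable_sum_nat measurable_If measurable_const pred[unfolded pred_def], auto)
qed

lemma measurable_nearest:
  assumes "m > 0"
  shows "(\<lambda>X. nearest m k (rel X)) \<in> sample_space (2 + m + k) \<rightarrow>\<^sub>M count_space UNIV"
proof -
  let ?P = "sample_space (2 + m + k)"
  have le: "Measurable.pred ?P (\<lambda>X. mismatch m k (rel X) i \<le> mismatch m k (rel X) i')" if "i < m" "i' < m" for i i'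
    using measurable_mismatch[OF that(1)] measurable_mismatch[OF that(2)] by measurable
  have "Measurable.pred ?P (\<lambda>X. i < m \<and> (\<forall>i'<m. mismatch m k (rel X) i \<le> mismatch m k (rel X) i'))" for i
  proof (cases "i < m")
    case True
    have "Measurable.pred ?P (\<lambda>X. \<forall>i'\<in>{..<m}. mismatch m k (rel X) i \<le> mismatch m k (rel X) i')"
      by (intro pred_intros_finite finite_lessThan le) (use True in auto)
    then show ?thesis by (simp only: True simp_thms Ball_def lessThan_iff)
  qed (simp only: simp_thms measurable_const sets.sets_Collect_const, simp)
  then show ?thesis unfolding nearest_def by (rule measurable_Least)
qed

lemma measurable_mispredict:
  assumes "m > 0"
  shows "Measurable.pred (sample_space (2 + m + k)) (\<lambda>X. mispredict m k (rel X))"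
proof -
  let ?P = "sample_space (2 + m + k)"
  note [measurable] = measurable_nearest[OF assms, of k]
  have [measurable]: "Measurable.pred ?P (\<lambda>X. rel X 0 1)" by (rule measurable_rel) auto
  have eq: "mispredict m k (rel X) \<longleftrightarrow> (\<exists>i\<in>{..<m}. nearest m k (rel X) = i \<and> rel X 0 1 \<noteq> rel X (2 + i) 1)" for X
    unfolding mispredict_def using nearest(1)[OF assms] by auto
  have "Measurable.pred ?P (\<lambda>X. nearest m k (rel X) = i \<and> rel X 0 1 \<noteq> rel X (2 + i) 1)" if "i < m" for i
  proof -
    have [measurable]: "Measurable.pred ?P (\<lambda>X. rel X (2 + i) 1)" by (rule measurable_rel) (use that in auto)
    show ?thesis by measurable
  qed
  then show ?thesis unfolding eq by (intro pred_intros_finite) auto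
qed

lemma disagreement_bounds: "D x z \<in> {0..1}"
proof -
  have "D x z \<le> 1"
  proof (cases "integrable M (\<lambda>y. of_bool (((x, y) \<in> S) \<noteq> ((z, y) \<in> S)) :: real)")
    case True
    then have "D x z \<le> (\<integral>y. 1 \<partial>M)" unfolding disagreement_def by (intro integral_mono) auto
    then show ?thesis by (simp add: prob_space)
  qed (simp add: disagreement_def not_integrable_integral_eq)
  then show ?thesis by (auto simp: disagreement_def)
qed

lemma measurable_disagreement:
  assumes [measurable]: "f \<in> N \<rightarrow>\<^sub>M M" "g \<in> N \<rightarrow>\<^sub>M M"
  shows "(\<lambda>x. D (f x) (g x)) \<in> borel_measurable N"
  unfolding disagreement_def
proof (rule borel_measurable_lebesgue_integral)
  have "(\<lambda>q. of_bool (((f (fst q), snd q) \<in> S) \<noteq> ((g (fst q), snd q) \<in> S)) :: real) \<in> borel_measurable (N \<Otimes>\<^sub>M M)"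
    by (rule measurable_diff_pred) measurable
  then show "(\<lambda>(x, y). of_bool (((f x, y) \<in> S) \<noteq> ((g x, y) \<in> S)) :: real) \<in> borel_measurable (N \<Otimes>\<^sub>M M)"
    by (simp add: case_prod_unfold)
qed

text \<open>Resample vertex 1, which is independent of the chosen reference: given the rest, the
  prediction fails with probability equal to the distance of the rows of vertex 0 and of that
  reference.\<close>

lemma prob_mispredict:
  assumes "m > 0"
  shows "measure (sample_space (2 + m + k)) {X \<in> space (sample_space (2 + m + k)). mispredict m k (rel X)} =
    (\<integral>X. D (X 0) (X (2 + nearest m k (rel X))) \<partial>sample_space (2 + m + k))"
proof -
  let ?P = "sample_space (2 + m + k)"
  note [measurable] = measurable_mispredict[OF assms, of k]
  interpret P: prob_space ?P by (rule prob_space_sample)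
  have "measure ?P {X \<in> space ?P. mispredict m k (rel X)} =
      (\<integral>X. indicator {X \<in> space ?P. mispredict m k (rel X)} X \<partial>?P)"
    unfolding Bochner_Integration.integral_indicator by (intro arg_cong2[where f=measure]) auto
  also have "\<dots> = (\<integral>X. of_bool (mispredict m k (rel X)) \<partial>?P)"
    by (intro Bochner_Integration.integral_cong) (auto simp: indicator_def)
  also have "\<dots> = (\<integral>X. (\<integral>y. of_bool (mispredict m k (rel (X(1 := y)))) \<partial>M) \<partial>?P)"
    by (rule integral_resample[OF prob_space_axioms, where B=1]) (auto simp: of_bool_def)
  also have "\<dots> = (\<integral>X. D (X 0) (X (2 + nearest m k (rel X))) \<partial>?P)"
  proof (intro Bochner_Integration.integral_cong refl)
    fix X
    have "nearest m k (rel (X(1 := y))) = nearest m k (rel X)" for y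
      by (rule nearest_cong) (auto simp: rel_def)
    then have "mispredict m k (rel (X(1 := y))) \<longleftrightarrow>
        (((X 0, y) \<in> S) \<noteq> ((X (2 + nearest m k (rel X)), y) \<in> S))" for y
      unfolding mispredict_def by (simp add: rel_def)
    then show "(\<integral>y. of_bool (mispredict m k (rel (X(1 := y)))) \<partial>M) = D (X 0) (X (2 + nearest m k (rel X)))"
      unfolding disagreement_def by simp
  qed
  finally show ?thesis .
qed

text \<open>Given vertex 0 and the reference, the tests are independent with mean \<open>D\<close>,
  so the centred variables \<open>\<xi> j\<close> are uncorrelated and their sum has second moment
  at most \<open>k\<close>. A square number \<open>k\<close> of tests makes the resulting bound
  \<open>1 / q\<close> free of roots.\<close>

lemma empirical_error:
  fixes q :: nat
  assumes "i < m" "q > 0"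
  defines "k \<equiv> q\<^sup>2"
  shows "(\<lambda>X. \<bar>mismatch m k (rel X) i / k - D (X 0) (X (2 + i))\<bar>) \<in> borel_measurable (sample_space (2 + m + k))"
    and "(\<integral>X. \<bar>mismatch m k (rel X) i / k - D (X 0) (X (2 + i))\<bar> \<partial>sample_space (2 + m + k)) \<le> 1 / q"
proof -
  let ?P = "sample_space (2 + m + k)"
  interpret P: prob_space ?P by (rule prob_space_sample)
  have k: "k > 0" using assms by (simp add: k_def)
  define t where "t j = 2 + m + j" for j
  define \<xi> where "\<xi> j X = of_bool (((X 0, X (t j)) \<in> S) \<noteq> ((X (2 + i), X (t j)) \<in> S)) - D (X 0) (X (2 + i))" for j X
  have comp: "(\<lambda>X. X a) \<in> ?P \<rightarrow>\<^sub>M M" if "a < 2 + m + k" for a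
    using that by (intro measurable_component_singleton) auto
  have [measurable]: "(\<lambda>X. D (X 0) (X (2 + i))) \<in> borel_measurable ?P"
    by (intro measurable_disagreement comp) (use assms in auto)
  have \<xi>m: "\<xi> j \<in> borel_measurable ?P" if "j < k" for j
    unfolding \<xi>_def
    by (intro borel_measurable_diff measurable_diff_pred comp measurable_disagreement) (use assms that in \<open>auto simp: t_def\<close>)
  have \<xi>b: "\<bar>\<xi> j X\<bar> \<le> 1" for j X
    using disagreement_bounds[of "X 0" "X (2 + i)"] by (auto simp: \<xi>_def)
  have sum: "mismatch m k (rel X) i / k - D (X 0) (X (2 + i)) = (\<Sum>j<k. \<xi> j X) / k" for X
  proof -
    have "real (mismatch m k (rel X) i) = (\<Sum>j<k. of_bool (((X 0, X (t j)) \<in> S) \<noteq> ((X (2 + i), X (t j)) \<in> S)))"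
      unfolding mismatch_def rel_def t_def card_eq_sum sum.inter_filter[OF finite_lessThan] of_nat_sum
      by (intro sum.cong refl) (simp only: of_bool_def of_nat_1 of_nat_0 if_distrib[where f=real])
    then show ?thesis using k unfolding \<xi>_def by (simp add: sum_subtractf diff_divide_distrib del: of_bool_eq_iff)
  qed
  have m1 [measurable]: "(\<lambda>X. \<Sum>j<k. \<xi> j X) \<in> borel_measurable ?P"
    by (intro borel_measurable_sum \<xi>m) auto
  show "(\<lambda>X. \<bar>mismatch m k (rel X) i / k - D (X 0) (X (2 + i))\<bar>) \<in> borel_measurable ?P"
    unfolding sum by measurable
  have prodb: "\<bar>\<xi> j X * \<xi> l X\<bar> \<le> 1" for j l X
    unfolding abs_mult by (intro mult_le_one \<xi>b) auto
  have prodm: "(\<lambda>X. \<xi> j X * \<xi> l X) \<in> borel_measurable ?P" if "j < k" "l < k" for j l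
    using \<xi>m[OF that(1)] \<xi>m[OF that(2)] by measurable
  have prodi: "integrable ?P (\<lambda>X. \<xi> j X * \<xi> l X)" if "j < k" "l < k" for j l
    by (rule P.integrable_const_bound[of _ 1]) (use prodb prodm that in auto)
  have zero: "(\<integral>X. \<xi> j X * \<xi> l X \<partial>?P) = 0" if "j < k" "l < k" "j \<noteq> l" for j l
  proof -
    \<comment> \<open>Resampling the test \<open>j\<close> leaves \<open>\<xi> l\<close> unchanged
      and averages \<open>\<xi> j\<close> to 0.\<close>
    have "(\<integral>X. \<xi> j X * \<xi> l X \<partial>?P) = (\<integral>X. (\<integral>y. \<xi> j (X(t j := y)) * \<xi> l (X(t j := y)) \<partial>M) \<partial>?P)"
      by (rule integral_resample[OF prob_space_axioms, where B=1])
         (use prodb prodm that in \<open>auto simp: t_def\<close>)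
    also have "\<dots> = (\<integral>X. 0 \<partial>?P)"
    proof (intro Bochner_Integration.integral_cong refl)
      fix X assume X: "X \<in> space ?P"
      then have X0: "X 0 \<in> space M" "X (2 + i) \<in> space M"
        using measurable_space[OF comp X] assms by auto
      have up: "\<xi> l (X(t j := y)) = \<xi> l X" for y using that assms by (auto simp: \<xi>_def t_def)
      have "\<xi> j (X(t j := y)) = of_bool (((X 0, y) \<in> S) \<noteq> ((X (2 + i), y) \<in> S)) - D (X 0) (X (2 + i))" for y
        using assms by (auto simp: \<xi>_def t_def)
      moreover have "integrable M (\<lambda>y. of_bool (((X 0, y) \<in> S) \<noteq> ((X (2 + i), y) \<in> S)) :: real)"
        by (rule integrable_const_bound[of _ 1])
           (use X0 in \<open>auto intro!: measurable_diff_pred\<close>)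
      ultimately have "(\<integral>y. \<xi> j (X(t j := y)) \<partial>M) = 0"
        by (simp add: disagreement_def prob_space)
      then show "(\<integral>y. \<xi> j (X(t j := y)) * \<xi> l (X(t j := y)) \<partial>M) = 0" unfolding up by simp
    qed
    finally show ?thesis by simp
  qed
  have sq: "(\<integral>X. (\<Sum>j<k. \<xi> j X)\<^sup>2 \<partial>?P) \<le> k"
  proof -
    have "(\<integral>X. (\<Sum>j<k. \<xi> j X)\<^sup>2 \<partial>?P) = (\<integral>X. (\<Sum>j<k. \<Sum>l<k. \<xi> j X * \<xi> l X) \<partial>?P)"
      by (simp add: power2_eq_square sum_product)
    also have "\<dots> = (\<Sum>j<k. \<integral>X. (\<Sum>l<k. \<xi> j X * \<xi> l X) \<partial>?P)"
      by (rule Bochner_Integration.integral_sum) (auto intro: Bochner_Integration.integrable_sum prodi)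
    also have "\<dots> = (\<Sum>j<k. \<Sum>l<k. \<integral>X. \<xi> j X * \<xi> l X \<partial>?P)"
      by (intro sum.cong refl Bochner_Integration.integral_sum) (auto intro: prodi)
    also have "\<dots> \<le> (\<Sum>j<k. \<Sum>l<k. if l = j then 1 else 0)"
    proof (intro sum_mono)
      fix j l assume jl: "j \<in> {..<k}" "l \<in> {..<k}"
      show "(\<integral>X. \<xi> j X * \<xi> l X \<partial>?P) \<le> (if l = j then 1 else 0)"
      proof (cases "l = j")
        case True
        have "(\<integral>X. \<xi> j X * \<xi> l X \<partial>?P) \<le> (\<integral>X. 1 \<partial>?P)"
          using prodi[of j l] jl prodb[of j _ l] by (intro integral_mono) (auto simp: abs_le_iff)
        then show ?thesis using True by (simp add: P.prob_space)
      qed (use zero[of j l] jl in auto)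
    qed
    also have "\<dots> = k" by simp
    finally show ?thesis .
  qed
  let ?h = "\<lambda>X. (\<Sum>j<k. \<xi> j X) / k"
  have sumb: "\<bar>\<Sum>j<k. \<xi> j X\<bar> \<le> k" for X
    using order_trans[OF sum_abs sum_mono[of "{..<k}" "\<lambda>j. \<bar>\<xi> j X\<bar>" "\<lambda>_. 1"]] \<xi>b by simp
  have hb: "\<bar>?h X\<bar> \<le> 1" for X using sumb[of X] k by simp
  have i1: "integrable ?P (\<lambda>X. \<bar>?h X\<bar>)"
    by (rule P.integrable_const_bound[of _ 1]) (use hb in auto)
  have i2: "integrable ?P (\<lambda>X. (\<Sum>j<k. \<xi> j X)\<^sup>2)"
    by (rule P.integrable_const_bound[of _ "(real k)\<^sup>2"])
       (use sumb in \<open>auto simp: abs_le_square_iff[symmetric]\<close>)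
  have "(\<integral>X. \<bar>?h X\<bar> \<partial>?P) \<le> (\<integral>X. 1 / (2 * q) + (q / (2 * (real k)\<^sup>2)) * (\<Sum>j<k. \<xi> j X)\<^sup>2 \<partial>?P)"
  proof (rule integral_mono[OF i1])
    show "integrable ?P (\<lambda>X. 1 / (2 * q) + (q / (2 * (real k)\<^sup>2)) * (\<Sum>j<k. \<xi> j X)\<^sup>2)"
      using i2 by auto
    fix X
    \<comment> \<open>The first moment is bounded through the second, with equality where
      \<open>\<bar>h\<bar>\<close> is \<open>1 / q\<close>, the typical size of the
      deviation.\<close>
    have "\<bar>?h X\<bar> \<le> 1 / (2 * q) + (q / 2) * (?h X)\<^sup>2"
    proof -
      define h where "h = ?h X"
      have "0 \<le> (1 - q * \<bar>h\<bar>)\<^sup>2" by simp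
      also have "\<dots> = 1 - 2 * (q * \<bar>h\<bar>) + q * (q * h\<^sup>2)"
        by (simp add: power2_eq_square algebra_simps)
      finally have "2 * (q * \<bar>h\<bar>) \<le> 1 + q * (q * h\<^sup>2)" by simp
      then have "\<bar>h\<bar> \<le> 1 / (2 * q) + (q / 2) * h\<^sup>2" using assms(2) by (simp add: field_simps)
      then show ?thesis by (simp only: h_def)
    qed
    then show "\<bar>?h X\<bar> \<le> 1 / (2 * q) + (q / (2 * (real k)\<^sup>2)) * (\<Sum>j<k. \<xi> j X)\<^sup>2"
      by (simp add: power_divide)
  qed
  also have "\<dots> = 1 / (2 * q) + (q / (2 * (real k)\<^sup>2)) * (\<integral>X. (\<Sum>j<k. \<xi> j X)\<^sup>2 \<partial>?P)"
    using i2 by (simp add: P.prob_space)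
  also have "\<dots> \<le> 1 / (2 * q) + (q / (2 * (real k)\<^sup>2)) * k"
    by (intro add_left_mono mult_left_mono sq) auto
  also have "\<dots> = 1 / q" using assms by (simp add: k_def field_simps power2_eq_square)
  finally show "(\<integral>X. \<bar>mismatch m k (rel X) i / k - D (X 0) (X (2 + i))\<bar> \<partial>?P) \<le> 1 / q"
    unfolding sum .
qed

text \<open>Call a row good if it is \<eta>-close to the row of its type in \<open>T\<close>. Either
  vertex 0 has a bad row (Markov), or no reference has a good row of its type (at most
  \<open>1 / (m + 1)\<close> for each type), or some reference is within 2\<eta> and the tests find
  one almost as near. So \<open>m\<close> is chosen after the number \<open>N\<close> of types, and
  \<open>q\<close> after \<open>m\<close>.\<close>

lemma exists_good_predictor:
  assumes "\<epsilon> > 0"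
  shows "\<exists>m k. m > 0 \<and>
    measure (sample_space (2 + m + k)) {X \<in> space (sample_space (2 + m + k)). mispredict m k (rel X)} \<le> \<epsilon>"
proof -
  interpret P2: pair_prob_space M M ..
  \<comment> \<open>The total error will be at most \<open>9 * \<eta>\<close>: 2\<eta> for two good
    rows of one type, \<eta> for Markov, 3\<eta> each for missing references and for the tests.
    \<open>T\<close> is taken within \<eta>^2 of \<open>S\<close> because Markov's inequality is
    applied at level \<eta>.\<close>
  define \<eta> where "\<eta> = \<epsilon> / 12"
  have \<eta>: "\<eta> > 0" using assms by (simp add: \<eta>_def)
  obtain T where T: "finite_type M T" "measure (M \<Otimes>\<^sub>M M) (sym_diff S T) \<le> \<eta>\<^sup>2"
    using finite_type_approximation[OF prob_space_axioms S, rule_format, of "\<eta>\<^sup>2"] \<eta> by auto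
  note [measurable] = finite_type_sets[OF T(1)]
  obtain N p R where p [measurable]: "p \<in> M \<rightarrow>\<^sub>M count_space UNIV" and N: "\<And>x. p x < (N::nat)"
    and R [measurable]: "\<And>i. R i \<in> sets M" and T_def: "T = {q \<in> space (M \<Otimes>\<^sub>M M). snd q \<in> R (p (fst q))}"
    using T(1) unfolding finite_type_def by blast
  define F where "F x y = (of_bool (((x, y) \<in> S) \<noteq> (y \<in> R (p x))) :: real)" for x y
  define e where "e x = (\<integral>y. F x y \<partial>M)" for x
  have Fm: "(\<lambda>q. F (fst q) (snd q)) \<in> borel_measurable (M \<Otimes>\<^sub>M M)"
  proof -
    have "(\<lambda>q. of_bool ((q \<in> S) \<noteq> (q \<in> T)) :: real) \<in> borel_measurable (M \<Otimes>\<^sub>M M)"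
      unfolding of_bool_def by measurable
    then show ?thesis by (subst measurable_cong) (auto simp: F_def T_def)
  qed
  have Fx [measurable]: "F x \<in> borel_measurable M" if "x \<in> space M" for x
    using measurable_compose[OF measurable_Pair1'[OF that] Fm] by simp
  have Fi: "integrable M (F x)" if "x \<in> space M" for x
    by (rule integrable_const_bound[of _ 1]) (use that in \<open>auto simp: F_def[of x]\<close>)
  have em [measurable]: "e \<in> borel_measurable M"
    unfolding e_def by (rule borel_measurable_lebesgue_integral) (use Fm in \<open>simp add: case_prod_unfold\<close>)
  have e0: "0 \<le> e x" for x unfolding e_def by (intro integral_nonneg_AE) (simp add: F_def)
  have e1: "e x \<le> 1" if "x \<in> space M" for x
  proof -
    have "e x \<le> (\<integral>y. 1 \<partial>M)" unfolding e_def using Fi[OF that] by (intro integral_mono) (auto simp: F_def)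
    then show ?thesis by (simp add: prob_space)
  qed
  have ie: "integrable M e"
    by (rule integrable_const_bound[of _ 1]) (use e0 e1 in \<open>auto intro!: AE_I2\<close>)
  have int_e: "(\<integral>x. e x \<partial>M) \<le> \<eta>\<^sup>2"
  proof -
    have "integrable (M \<Otimes>\<^sub>M M) (\<lambda>(x, y). F x y)"
      by (rule P2.integrable_const_bound[of _ 1]) (use Fm in \<open>auto simp: F_def case_prod_unfold\<close>)
    then have "(\<integral>x. e x \<partial>M) = (\<integral>q. (\<lambda>(x, y). F x y) q \<partial>(M \<Otimes>\<^sub>M M))"
      unfolding e_def using P2.integral_fst'[of "\<lambda>(x, y). F x y"] by simp
    also have "\<dots> = (\<integral>q. indicator (sym_diff S T) q \<partial>(M \<Otimes>\<^sub>M M))"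
      by (intro Bochner_Integration.integral_cong) (auto simp: F_def T_def indicator_def)
    also have "\<dots> = measure (M \<Otimes>\<^sub>M M) (sym_diff S T \<inter> space (M \<Otimes>\<^sub>M M))"
      by (rule Bochner_Integration.integral_indicator)
    also have "\<dots> \<le> measure (M \<Otimes>\<^sub>M M) (sym_diff S T)"
      by (rule P2.finite_measure_mono) auto
    finally show ?thesis using T(2) by linarith
  qed
  have D_le: "D x z \<le> e x + e z" if "x \<in> space M" "z \<in> space M" "p x = p z" for x z
  proof -
    have "D x z \<le> (\<integral>y. F x y + F z y \<partial>M)"
      unfolding disagreement_def
    proof (rule integral_mono)
      show "integrable M (\<lambda>y. of_bool (((x, y) \<in> S) \<noteq> ((z, y) \<in> S)) :: real)"
        by (rule integrable_const_bound[of _ 1])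
           (use that in \<open>auto intro!: measurable_diff_pred\<close>)
      show "integrable M (\<lambda>y. F x y + F z y)"
        using Fi that by (intro Bochner_Integration.integrable_add) auto
    qed (use that in \<open>auto simp: F_def\<close>)
    then show ?thesis using Fi that by (simp add: e_def)
  qed
  define C where "C \<tau> = {x \<in> space M. p x = \<tau> \<and> e x \<le> \<eta>}" for \<tau>
  have C [measurable]: "C \<tau> \<in> sets M" for \<tau> unfolding C_def by measurable
  define m where "m = nat \<lceil>real N / (3 * \<eta>)\<rceil> + 1"
  have m: "m > 0" and mN: "real N / real (Suc m) \<le> 3 * \<eta>"
  proof -
    have "real N / (3 * \<eta>) \<le> real (Suc m)" unfolding m_def by linarith
    then show "real N / real (Suc m) \<le> 3 * \<eta>" using \<eta> by (simp add: field_simps)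
  qed (simp add: m_def)
  define q where "q = nat \<lceil>2 * real m / (3 * \<eta>)\<rceil> + 1"
  have q: "q > 0" and qm: "2 * real m / real q \<le> 3 * \<eta>"
  proof -
    have "2 * real m / (3 * \<eta>) \<le> real q" unfolding q_def by linarith
    moreover show "q > 0" by (simp add: q_def)
    ultimately show "2 * real m / real q \<le> 3 * \<eta>" using \<eta> by (simp add: field_simps)
  qed
  define k where "k = q\<^sup>2"
  let ?K = "2 + m + k"
  let ?P = "sample_space ?K"
  interpret P: prob_space ?P by (rule prob_space_sample)
  interpret sig: product_sigma_finite "\<lambda>_::nat. M"
    by (rule product_sigma_finite.intro) unfold_locales
  have comp: "(\<lambda>X. X a) \<in> ?P \<rightarrow>\<^sub>M M" if "a < ?K" for a
    using that by (intro measurable_component_singleton) auto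
  \<comment> \<open>On samples, the product \<open>g \<tau>\<close> is the indicator of the event
    that vertex 0 lies in \<open>C \<tau>\<close> and every reference misses it; its integral
    factorises.\<close>
  define f where "f \<tau> a x = (if a = 0 then indicator (C \<tau>) x
      else if a \<in> {2..<2 + m} then indicator (space M - C \<tau>) x else 1 :: real)" for \<tau> and a :: nat and x
  define g where "g \<tau> X = (\<Prod>a<?K. f \<tau> a (X a))" for \<tau> X
  define err where "err i X = \<bar>mismatch m k (rel X) i / k - D (X 0) (X (2 + i))\<bar>" for i X
  have fi: "integrable M (f \<tau> a)" for \<tau> a
    by (rule integrable_const_bound[of _ 1]) (auto simp: f_def[abs_def] indicator_def)
  have gi: "integrable ?P (g \<tau>)" for \<tau>
    unfolding g_def by (intro sig.product_integrable_prod fi) auto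
  have int_g: "(\<integral>X. g \<tau> X \<partial>?P) \<le> 1 / real (Suc m)" for \<tau>
  proof -
    define r where "r = prob (C \<tau>)"
    have r: "0 \<le> r" "r \<le> 1" by (auto simp: r_def)
    have ff: "integral\<^sup>L M (f \<tau> a) = (if a = 0 then r else if a \<in> {2..<2 + m} then 1 - r else 1)" for a
      using C[THEN sets.sets_into_space]
      by (auto simp: f_def[abs_def] r_def prob_compl prob_space Int_absorb2)
    have "(\<integral>X. g \<tau> X \<partial>?P) = (\<Prod>a<?K. integral\<^sup>L M (f \<tau> a))"
      unfolding g_def by (intro sig.product_integral_prod fi) auto
    also have "\<dots> = (\<Prod>a\<in>insert 0 {2..<2 + m}. integral\<^sup>L M (f \<tau> a))"
      by (rule prod.mono_neutral_right) (auto simp: ff)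
    also have "\<dots> = r * (\<Prod>a\<in>{2..<2 + m}. 1 - r)"
      by (subst prod.insert) (auto simp: ff intro!: prod.cong)
    also have "\<dots> = r * (1 - r) ^ m" by simp
    also have "\<dots> \<le> 1 / real (Suc m)"
    proof -
      \<comment> \<open>The term \<open>r * (1 - r) ^ m\<close> is the smallest of
        \<open>m + 1\<close> terms of a geometric sum that is at most 1.\<close>
      have "real (Suc m) * (r * (1 - r) ^ m) = (\<Sum>j<Suc m. r * (1 - r) ^ m)" by simp
      also have "\<dots> \<le> (\<Sum>j<Suc m. r * (1 - r) ^ j)"
        using r by (intro sum_mono mult_left_mono power_decreasing) auto
      also have "\<dots> = 1 - (1 - r) ^ Suc m"
        unfolding sum_distrib_left[symmetric] using one_diff_power_eq[of "1 - r" "Suc m"] by simp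
      also have "\<dots> \<le> 1" using r by simp
      finally show ?thesis by (simp add: field_simps)
    qed
    finally show ?thesis .
  qed
  have erri: "integrable ?P (err i)" and int_err: "(\<integral>X. err i X \<partial>?P) \<le> 1 / q" if "i < m" for i
  proof -
    show "(\<integral>X. err i X \<partial>?P) \<le> 1 / q"
      unfolding err_def k_def by (rule empirical_error(2)[OF that q])
    have "\<bar>err i X\<bar> \<le> 1" for X
    proof -
      have "mismatch m k (rel X) i \<le> k" unfolding mismatch_def
        using card_mono[of "{..<k}" "{j \<in> {..<k}. rel X 0 (2 + m + j) \<noteq> rel X (2 + i) (2 + m + j)}"] by auto
      then have "0 \<le> real (mismatch m k (rel X) i) / k" "real (mismatch m k (rel X) i) / k \<le> 1"
        by (auto simp: divide_simps)
      moreover have "0 \<le> D (X 0) (X (2 + i))" "D (X 0) (X (2 + i)) \<le> 1"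
        using disagreement_bounds[of "X 0" "X (2 + i)"] by auto
      ultimately show ?thesis unfolding err_def by linarith
    qed
    moreover have "err i \<in> borel_measurable ?P"
      unfolding err_def k_def by (rule empirical_error(1)[OF that q])
    ultimately show "integrable ?P (err i)" by (intro P.integrable_const_bound[of _ 1]) auto
  qed
  have ie0: "integrable ?P (\<lambda>X. e (X 0))" and int_e0: "(\<integral>X. e (X 0) \<partial>?P) = (\<integral>x. e x \<partial>M)"
  proof -
    have "distr ?P M (\<lambda>X. X 0) = M" by (rule distr_PiM_component) (auto intro: prob_space_axioms)
    then show "integrable ?P (\<lambda>X. e (X 0))" "(\<integral>X. e (X 0) \<partial>?P) = (\<integral>x. e x \<partial>M)"
      using integrable_distr[OF comp[of 0], of e] integral_distr[OF comp[of 0] em] ie by auto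
  qed
  have bound: "D (X 0) (X (2 + nearest m k (rel X))) \<le>
      2 * \<eta> + e (X 0) / \<eta> + (\<Sum>\<tau><N. g \<tau> X) + 2 * (\<Sum>i<m. err i X)" if X: "X \<in> space ?P" for X
  proof -
    have XM: "X a \<in> space M" if "a < ?K" for a using measurable_space[OF comp[OF that] X] .
    have g0: "0 \<le> g \<tau> X" for \<tau> unfolding g_def by (intro prod_nonneg) (simp add: f_def)
    have D1: "D x z \<le> 1" for x z using disagreement_bounds[of x z] by simp
    have "\<exists>i<m. D (X 0) (X (2 + i)) \<le> 2 * \<eta> + e (X 0) / \<eta> + (\<Sum>\<tau><N. g \<tau> X)"
    proof (cases "e (X 0) \<le> \<eta>")
      case False
      then have "1 \<le> e (X 0) / \<eta>" using \<eta> by simp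
      moreover have "0 \<le> (\<Sum>\<tau><N. g \<tau> X)" using g0 by (simp add: sum_nonneg)
      ultimately have "D (X 0) (X (2 + 0)) \<le> 2 * \<eta> + e (X 0) / \<eta> + (\<Sum>\<tau><N. g \<tau> X)"
        using D1[of "X 0" "X (2 + 0)"] \<eta> by linarith
      then show ?thesis using m by blast
    next
      case True
      show ?thesis
      proof (cases "\<exists>i<m. X (2 + i) \<in> C (p (X 0))")
        case True
        then obtain i where i: "i < m" "X (2 + i) \<in> C (p (X 0))" by blast
        then have "D (X 0) (X (2 + i)) \<le> e (X 0) + e (X (2 + i))"
          by (intro D_le XM) (auto simp: C_def)
        also have "\<dots> \<le> 2 * \<eta>" using \<open>e (X 0) \<le> \<eta>\<close> i by (simp add: C_def)
        also have "\<dots> \<le> 2 * \<eta> + e (X 0) / \<eta> + (\<Sum>\<tau><N. g \<tau> X)"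
          using e0 \<eta> g0 by (simp add: sum_nonneg)
        finally show ?thesis using i(1) by blast
      next
        case no: False
        have "f (p (X 0)) a (X a) = 1" if "a < ?K" for a
        proof -
          have "X a \<in> space M - C (p (X 0))" if "a \<in> {2..<2 + m}"
            using no[unfolded not_ex, rule_format, of "a - 2"] that XM[OF \<open>a < ?K\<close>] by auto
          moreover have "X 0 \<in> C (p (X 0))" using \<open>e (X 0) \<le> \<eta>\<close> XM[of 0] by (simp add: C_def)
          ultimately show ?thesis by (auto simp: f_def)
        qed
        then have "g (p (X 0)) X = 1" unfolding g_def by (intro prod.neutral) auto
        moreover have "g (p (X 0)) X \<le> (\<Sum>\<tau><N. g \<tau> X)"
          using N g0 by (intro member_le_sum) auto
        ultimately have "D (X 0) (X (2 + 0)) \<le> 2 * \<eta> + e (X 0) / \<eta> + (\<Sum>\<tau><N. g \<tau> X)"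
          using D1[of "X 0" "X (2 + 0)"] \<eta> divide_nonneg_pos[OF e0[of "X 0"] \<eta>] by linarith
        then show ?thesis using m by blast
      qed
    qed
    then obtain i where i: "i < m" "D (X 0) (X (2 + i)) \<le> 2 * \<eta> + e (X 0) / \<eta> + (\<Sum>\<tau><N. g \<tau> X)" by blast
    let ?n = "nearest m k (rel X)"
    have n: "?n < m" "mismatch m k (rel X) ?n \<le> mismatch m k (rel X) i" using nearest[OF m] i by auto
    \<comment> \<open>The nearest reference depends on the sample, so its test error is replaced by
      the sum over all references.\<close>
    have err_le: "err j X \<le> (\<Sum>i<m. err i X)" if "j < m" for j
      using that by (intro member_le_sum) (auto simp: err_def)
    have "D (X 0) (X (2 + ?n)) \<le> mismatch m k (rel X) ?n / k + err ?n X"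
      unfolding err_def by linarith
    also have "\<dots> \<le> mismatch m k (rel X) i / k + err ?n X"
      using n(2) by (intro add_right_mono divide_right_mono) auto
    also have "mismatch m k (rel X) i / k \<le> D (X 0) (X (2 + i)) + err i X"
      unfolding err_def by linarith
    finally show ?thesis using i(2) err_le[OF i(1)] err_le[OF n(1)] by linarith
  qed
  let ?bound = "\<lambda>X. 2 * \<eta> + e (X 0) / \<eta> + (\<Sum>\<tau><N. g \<tau> X) + 2 * (\<Sum>i<m. err i X)"
  have "measure ?P {X \<in> space ?P. mispredict m k (rel X)} =
      (\<integral>X. D (X 0) (X (2 + nearest m k (rel X))) \<partial>?P)" by (rule prob_mispredict[OF m])
  also have "\<dots> \<le> (\<integral>X. ?bound X \<partial>?P)"
  proof (rule integral_mono')
    show "integrable ?P ?bound"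
      using ie0 gi erri by (intro Bochner_Integration.integrable_add integrable_divide
        integrable_mult_right Bochner_Integration.integrable_sum) auto
    fix X assume X: "X \<in> space ?P"
    show "D (X 0) (X (2 + nearest m k (rel X))) \<le> ?bound X" by (rule bound[OF X])
    show "0 \<le> ?bound X"
      using order_trans[OF _ bound[OF X], of 0] disagreement_bounds[of "X 0" "X (2 + nearest m k (rel X))"] by simp
  qed
  also have "\<dots> = 2 * \<eta> + (\<integral>X. e (X 0) \<partial>?P) / \<eta> + (\<Sum>\<tau><N. \<integral>X. g \<tau> X \<partial>?P) + 2 * (\<Sum>i<m. \<integral>X. err i X \<partial>?P)"
  proof -
    have Ig: "integrable ?P (\<lambda>X. \<Sum>\<tau><N. g \<tau> X)"
      by (rule Bochner_Integration.integrable_sum) (rule gi)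
    have Ie: "integrable ?P (\<lambda>X. \<Sum>i<m. err i X)"
      by (rule Bochner_Integration.integrable_sum) (use erri in simp)
    have "(\<integral>X. ?bound X \<partial>?P) = 2 * \<eta> + (\<integral>X. e (X 0) \<partial>?P) / \<eta> +
        (\<integral>X. (\<Sum>\<tau><N. g \<tau> X) \<partial>?P) + 2 * (\<integral>X. (\<Sum>i<m. err i X) \<partial>?P)"
      using ie0 Ig Ie by (simp only: Bochner_Integration.integral_add Bochner_Integration.integrable_add
        integrable_divide_zero integrable_mult_right P.integrable_const Bochner_Integration.integral_divide_zero
        Bochner_Integration.integral_mult_right_zero lebesgue_integral_const P.prob_space scaleR_one
        simp_thms)
    also have "(\<integral>X. (\<Sum>\<tau><N. g \<tau> X) \<partial>?P) = (\<Sum>\<tau><N. \<integral>X. g \<tau> X \<partial>?P)"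
      by (rule Bochner_Integration.integral_sum) (rule gi)
    also have "(\<integral>X. (\<Sum>i<m. err i X) \<partial>?P) = (\<Sum>i<m. \<integral>X. err i X \<partial>?P)"
      by (rule Bochner_Integration.integral_sum) (use erri in simp)
    finally show ?thesis .
  qed
  also have "\<dots> \<le> 2 * \<eta> + \<eta>\<^sup>2 / \<eta> + (\<Sum>\<tau><N. 1 / real (Suc m)) + 2 * (\<Sum>i<m. 1 / q)"
    using \<eta> int_e int_e0 int_g int_err
    by (intro add_mono mult_left_mono sum_mono divide_right_mono) auto
  also have "\<dots> = 3 * \<eta> + real N / real (Suc m) + 2 * real m / real q"
    using \<eta> by (simp add: power2_eq_square)
  also have "\<dots> \<le> \<epsilon>"
  proof -
    have "\<epsilon> = 12 * \<eta>" by (simp add: \<eta>_def)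
    then show ?thesis using mN qm \<eta> by linarith
  qed
  finally show ?thesis using m by blast
qed

end

section \<open>From samples to graphs\<close>

text \<open>Wrong predictions are counted over ordered pairs because the prediction is not
  symmetric: \<open>x\<close> is replaced by a reference, \<open>y\<close> is not. The reference
  neighbourhoods are bare predicates \<open>g j\<close>, so that they can be encoded apart from the
  graph.\<close>

definition compressible :: "nat \<Rightarrow> real \<Rightarrow> graph \<Rightarrow> bool" where
  "compressible m \<epsilon> G \<longleftrightarrow> (\<exists>(i :: nat \<Rightarrow> nat) g. (\<forall>x. i x < m) \<and>
     real (card {(x, y) \<in> verts G \<times> verts G. ({x, y} \<in> edges G) \<noteq> g (i x) y}) \<le> \<epsilon> * (real (gsize G))\<^sup>2)"

lemma compressible_mono: "compressible m \<epsilon> G \<Longrightarrow> m \<le> m' \<Longrightarrow> compressible m' \<epsilon> G"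
  unfolding compressible_def by (meson less_le_trans)

definition patterns :: "nat \<Rightarrow> nat \<Rightarrow> graph set" where
  "patterns m k = {H. simple_graph H \<and> verts H = {..<2 + m + k} \<and>
     mispredict m k (\<lambda>a b. {a, b} \<in> edges H)}"

lemma finite_patterns: "finite (patterns m k)"
proof (rule finite_subset)
  let ?K = "{..<2 + m + k}"
  show "patterns m k \<subseteq> {?K} \<times> Pow (Pow ?K)"
  proof
    fix H assume H: "H \<in> patterns m k"
    then have "edges H \<subseteq> {{u, v} |u v. u \<in> ?K \<and> v \<in> ?K \<and> u \<noteq> v}" "verts H = ?K"
      unfolding patterns_def simple_graph_def by auto
    then have "edges H \<in> Pow (Pow ?K)" "fst H = ?K" by (auto simp: verts_def)
    then show "H \<in> {?K} \<times> Pow (Pow ?K)" by (cases H) (simp add: edges_def)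
  qed
qed simp

text \<open>Exactly one labelled graph \<open>H0\<close> on the sample has the adjacencies given by
  \<open>r\<close>, so at most one summand is 1. It occurs in the sum if and only if
  \<open>r\<close> is mispredicted.\<close>

lemma sum_patterns:
  fixes r :: "nat \<Rightarrow> nat \<Rightarrow> bool"
  assumes m: "m > 0" and sym: "\<And>a b. r a b \<longleftrightarrow> r b a"
  shows "(\<Sum>H\<in>patterns m k. of_bool (\<forall>u\<in>verts H. \<forall>v\<in>verts H. u \<noteq> v \<longrightarrow> ({u, v} \<in> edges H \<longleftrightarrow> r u v)))
    = (of_bool (mispredict m k r) :: real)"
proof -
  let ?K = "{..<2 + m + k}"
  define H0 :: graph where "H0 = (?K, {{a, b} |a b. a \<in> ?K \<and> b \<in> ?K \<and> a \<noteq> b \<and> r a b})"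
  have H0: "verts H0 = ?K" "edges H0 = {{a, b} |a b. a \<in> ?K \<and> b \<in> ?K \<and> a \<noteq> b \<and> r a b}"
    by (auto simp: H0_def verts_def edges_def)
  have H0e: "{u, v} \<in> edges H0 \<longleftrightarrow> r u v" if "u \<in> ?K" "v \<in> ?K" "u \<noteq> v" for u v
    using that sym unfolding H0(2) by (auto simp: doubleton_eq_iff)
  have "0 \<in> verts H0" using H0(1) by simp
  then have "verts H0 \<noteq> {}" by blast
  then have simp0: "simple_graph H0" unfolding simple_graph_def by (auto simp: H0)
  have iff: "(\<forall>u\<in>verts H. \<forall>v\<in>verts H. u \<noteq> v \<longrightarrow> ({u, v} \<in> edges H \<longleftrightarrow> r u v)) \<longleftrightarrow> H = H0"
    if H: "H \<in> patterns m k" for H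
  proof
    assume *: "\<forall>u\<in>verts H. \<forall>v\<in>verts H. u \<noteq> v \<longrightarrow> ({u, v} \<in> edges H \<longleftrightarrow> r u v)"
    have V: "verts H = ?K" and E: "edges H \<subseteq> {{u, v} |u v. u \<in> ?K \<and> v \<in> ?K \<and> u \<noteq> v}"
      using H unfolding patterns_def simple_graph_def by auto
    have "edges H = edges H0"
    proof (intro set_eqI iffI)
      fix e assume e: "e \<in> edges H"
      then obtain u v where uv: "e = {u, v}" "u \<in> ?K" "v \<in> ?K" "u \<noteq> v" using E by blast
      then show "e \<in> edges H0" using * e H0e V by auto
    next
      fix e assume "e \<in> edges H0"
      then obtain u v where "e = {u, v}" "u \<in> ?K" "v \<in> ?K" "u \<noteq> v" "r u v" unfolding H0(2) by blast
      then show "e \<in> edges H" using * V by auto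
    qed
    with V H0(1) show "H = H0" by (simp add: verts_def edges_def prod_eq_iff)
  next
    assume "H = H0"
    then show "\<forall>u\<in>verts H. \<forall>v\<in>verts H. u \<noteq> v \<longrightarrow> ({u, v} \<in> edges H \<longleftrightarrow> r u v)"
      using H0e H0(1) by auto
  qed
  have "mispredict m k (\<lambda>a b. {a, b} \<in> edges H0) = mispredict m k r"
    by (rule mispredict_cong[OF m]) (use H0e in auto)
  then have mem: "H0 \<in> patterns m k \<longleftrightarrow> mispredict m k r"
    using simp0 H0(1) by (simp add: patterns_def)
  have "(\<Sum>H\<in>patterns m k. of_bool (\<forall>u\<in>verts H. \<forall>v\<in>verts H. u \<noteq> v \<longrightarrow> ({u, v} \<in> edges H \<longleftrightarrow> r u v)))
      = (\<Sum>H\<in>patterns m k. if H = H0 then 1 else 0 :: real)"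
    by (intro sum.cong refl) (simp only: iff of_bool_def)
  also have "\<dots> = of_bool (mispredict m k r)"
    using finite_patterns mem by simp
  finally show ?thesis .
qed

lemma sum_hom_density_patterns:
  assumes "m > 0"
  shows "(\<Sum>H\<in>patterns m k. hom_density V H (adj G)) =
    (\<Sum>\<phi>\<in>{..<2 + m + k} \<rightarrow>\<^sub>E V. of_bool (mispredict m k (\<lambda>a b. {\<phi> a, \<phi> b} \<in> edges G))) / card V ^ (2 + m + k)"
proof -
  let ?K = "2 + m + k"
  let ?pat = "\<lambda>H \<phi>. of_bool (\<forall>u\<in>verts H. \<forall>v\<in>verts H. u \<noteq> v \<longrightarrow> ({u, v} \<in> edges H \<longleftrightarrow> {\<phi> u, \<phi> v} \<in> edges G)) :: real"
  have "hom_density V H (adj G) = (\<Sum>\<phi>\<in>{..<?K} \<rightarrow>\<^sub>E V. ?pat H \<phi>) / card V ^ ?K" if "H \<in> patterns m k" for H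
  proof -
    have V: "verts H = {..<?K}" using that by (simp add: patterns_def)
    then have "ind_weight H (adj G) \<phi> = ?pat H \<phi>" for \<phi>
      unfolding adj_def[abs_def] by (intro ind_weight_of_bool) (auto simp: insert_commute)
    then show ?thesis by (simp only: hom_density_def V card_lessThan)
  qed
  then have "(\<Sum>H\<in>patterns m k. hom_density V H (adj G)) =
      (\<Sum>\<phi>\<in>{..<?K} \<rightarrow>\<^sub>E V. \<Sum>H\<in>patterns m k. ?pat H \<phi>) / card V ^ ?K"
    by (subst sum.swap) (simp add: sum_divide_distrib)
  moreover have "(\<Sum>H\<in>patterns m k. ?pat H \<phi>) = of_bool (mispredict m k (\<lambda>a b. {\<phi> a, \<phi> b} \<in> edges G))" for \<phi>
    by (rule sum_patterns[OF assms]) (auto simp: insert_commute)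
  ultimately show ?thesis by (simp only:)
qed

text \<open>Split a map into its restriction \<open>\<psi>\<close> to references and tests and the
  images \<open>x\<close>, \<open>y\<close> of vertices 0 and 1. As \<open>hom_density\<close> runs
  over all maps, each \<open>\<psi>\<close> meets every pair, coincidences included; a
  \<open>\<psi>\<close> with at most the average number of bad pairs supplies the reference
  neighbourhoods.\<close>

lemma compressible_of_few_mispredictions:
  assumes G: "simple_graph G" and m: "m > 0"
    and few: "(\<Sum>H\<in>patterns m k. hom_density (verts G) H (adj G)) \<le> \<epsilon>"
  shows "compressible m \<epsilon> G"
proof -
  let ?V = "verts G" and ?K = "2 + m + k"
  let ?R = "{2..<?K}"
  let ?mis = "\<lambda>\<phi>. mispredict m k (\<lambda>a b. {\<phi> a, \<phi> b} \<in> edges G)"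
  have V: "finite ?V" "?V \<noteq> {}" using G by (auto simp: simple_graph_def)
  let ?n = "real (card ?V)"
  have n: "?n > 0" using V by (simp add: card_gt_0_iff)
  define bad where "bad \<psi> = {(x, y) \<in> ?V \<times> ?V. ?mis (\<psi>(1 := y, 0 := x))}" for \<psi>
  have ins: "{..<?K} = insert 0 (insert 1 ?R)" by auto
  have "(\<Sum>\<phi>\<in>{..<?K} \<rightarrow>\<^sub>E ?V. of_bool (?mis \<phi>)) =
      (\<Sum>\<psi>\<in>?R \<rightarrow>\<^sub>E ?V. \<Sum>y\<in>?V. \<Sum>x\<in>?V. of_bool (?mis (\<psi>(1 := y, 0 := x))) :: real)"
    unfolding ins by (subst sum_PiE_insert, simp, subst sum_PiE_insert, simp, simp)
  also have "\<dots> = (\<Sum>\<psi>\<in>?R \<rightarrow>\<^sub>E ?V. real (card (bad \<psi>)))"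
  proof (intro sum.cong refl)
    fix \<psi>
    have "(\<Sum>y\<in>?V. \<Sum>x\<in>?V. of_bool (?mis (\<psi>(1 := y, 0 := x))) :: real) =
        (\<Sum>p\<in>?V \<times> ?V. if ?mis (\<psi>(1 := snd p, 0 := fst p)) then 1 else 0)"
      by (subst sum.swap) (simp only: sum.cartesian_product case_prod_unfold of_bool_def)
    also have "\<dots> = (\<Sum>p\<in>{p \<in> ?V \<times> ?V. ?mis (\<psi>(1 := snd p, 0 := fst p))}. 1)"
      using V by (intro sum.inter_filter[symmetric]) simp
    also have "{p \<in> ?V \<times> ?V. ?mis (\<psi>(1 := snd p, 0 := fst p))} = bad \<psi>"
      unfolding bad_def by auto
    finally show "(\<Sum>y\<in>?V. \<Sum>x\<in>?V. of_bool (?mis (\<psi>(1 := y, 0 := x))) :: real) = real (card (bad \<psi>))"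
      unfolding card_eq_sum of_nat_sum of_nat_1 .
  qed
  finally have tot: "(\<Sum>\<psi>\<in>?R \<rightarrow>\<^sub>E ?V. real (card (bad \<psi>))) \<le> \<epsilon> * ?n ^ ?K"
    using few n unfolding sum_hom_density_patterns[OF m] by (simp add: divide_le_eq)
  have "\<exists>\<psi>. real (card (bad \<psi>)) \<le> \<epsilon> * ?n\<^sup>2"
  proof (rule ccontr)
    assume no: "\<not> ?thesis"
    have ne: "?R \<rightarrow>\<^sub>E ?V \<noteq> {}" using V by (simp add: PiE_eq_empty_iff)
    have fin: "finite (?R \<rightarrow>\<^sub>E ?V)" using V by (intro finite_PiE) auto
    have "\<epsilon> * ?n ^ ?K = (\<Sum>\<psi>\<in>?R \<rightarrow>\<^sub>E ?V. \<epsilon> * ?n\<^sup>2)"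
      by (simp add: card_funcsetE power_add power2_eq_square)
    also have "\<dots> < (\<Sum>\<psi>\<in>?R \<rightarrow>\<^sub>E ?V. real (card (bad \<psi>)))"
      using no by (intro sum_strict_mono fin ne) (simp add: not_le)
    finally show False using tot by simp
  qed
  then obtain \<psi> where \<psi>: "real (card (bad \<psi>)) \<le> \<epsilon> * ?n\<^sup>2" by blast
  define i where "i x = nearest m k (\<lambda>a b. {(\<psi>(0 := x)) a, (\<psi>(0 := x)) b} \<in> edges G)" for x
  define g where "g j y \<longleftrightarrow> {\<psi> (2 + j), y} \<in> edges G" for j y
  have "?mis (\<psi>(1 := y, 0 := x)) \<longleftrightarrow> ({x, y} \<in> edges G) \<noteq> g (i x) y" for x y
  proof -
    have "nearest m k (\<lambda>a b. {(\<psi>(1 := y, 0 := x)) a, (\<psi>(1 := y, 0 := x)) b} \<in> edges G) = i x"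
      unfolding i_def by (rule nearest_cong) auto
    then show ?thesis unfolding mispredict_def g_def by simp
  qed
  then have "bad \<psi> = {(x, y) \<in> ?V \<times> ?V. ({x, y} \<in> edges G) \<noteq> g (i x) y}"
    unfolding bad_def by (simp only:)
  moreover have "i x < m" for x unfolding i_def by (rule nearest(1)[OF m])
  ultimately show ?thesis unfolding compressible_def using \<psi> by (auto simp: gsize_def)
qed

text \<open>Here random-freeness enters. For almost all samples the values of \<open>W\<close> at
  distinct sample points are 0 or 1, so the weight of a pattern is the indicator that the relation
  \<open>W = 1\<close> induces it. The diagonal of \<open>W\<close> is uncontrolled but does not
  occur in \<open>vpairs\<close>.\<close>

lemma sum_graphon_density_patterns:
  assumes W: "graphon W" and rf: "random_free_graphon W" and m: "m > 0"
  defines "S \<equiv> {q \<in> space (unit_space \<Otimes>\<^sub>M unit_space). W (fst q) (snd q) = 1}"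
  shows "(\<Sum>H\<in>patterns m k. graphon_density H W) =
    measure (\<Pi>\<^sub>M i\<in>{..<2 + m + k}. unit_space)
      {X \<in> space (\<Pi>\<^sub>M i\<in>{..<2 + m + k}. unit_space). mispredict m k (sampled_relation.rel S X)}"
proof -
  let ?K = "2 + m + k"
  let ?P = "\<Pi>\<^sub>M i\<in>{..<?K}. unit_space"
  have Wm [measurable]: "(\<lambda>q. W (fst q) (snd q)) \<in> borel_measurable (unit_space \<Otimes>\<^sub>M unit_space)"
    using W by (simp add: graphon_def case_prod_unfold)
  have Sm: "S \<in> sets (unit_space \<Otimes>\<^sub>M unit_space)" unfolding S_def by measurable
  interpret sampled_relation unit_space S
    by (intro sampled_relation.intro sampled_relation_axioms.intro prob_space_unit Sm)
  interpret P: prob_space ?P by (rule prob_space_sample)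
  have sym: "(x, y) \<in> S \<longleftrightarrow> (y, x) \<in> S" for x y
    using W by (auto simp: S_def space_pair_measure space_unit graphon_def)
  let ?pat = "\<lambda>H X. of_bool (\<forall>u\<in>verts H. \<forall>v\<in>verts H. u \<noteq> v \<longrightarrow> ({u, v} \<in> edges H \<longleftrightarrow> (X u, X v) \<in> S)) :: real"
  have dens: "graphon_density H W = (\<integral>X. ?pat H X \<partial>?P)"
    and inte: "integrable ?P (?pat H)" if H: "H \<in> patterns m k" for H
  proof -
    have V: "verts H = {..<?K}" using H by (simp add: patterns_def)
    then have fin: "finite (verts H)" by simp
    have ae: "AE X in ?P. ind_weight H W X = ?pat H X"
      using AE_PiM_pairs[OF prob_space_unit finite_lessThan rf[unfolded random_free_graphon_def], of ?K] AE_space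
    proof eventually_elim
      case (elim X)
      have "ind_weight H W X = ind_weight H (\<lambda>x y. of_bool ((x, y) \<in> S)) X"
        unfolding ind_weight_def
      proof (intro prod.cong refl)
        fix p assume "p \<in> vpairs (verts H)"
        then obtain u v where p: "p = (u, v)" "u < ?K" "v < ?K" "u \<noteq> v" by (auto simp: vpairs_def V)
        then have "X u \<in> space unit_space" "X v \<in> space unit_space" using elim(2) by (auto simp: space_PiM)
        moreover have "W (X u) (X v) \<in> {0, 1}" using elim(1) p by auto
        ultimately have "W (X u) (X v) = of_bool ((X u, X v) \<in> S)"
          by (auto simp: S_def space_pair_measure)
        then show "(case p of (u, v) \<Rightarrow> if {u, v} \<in> edges H then W (X u) (X v) else 1 - W (X u) (X v)) =
          (case p of (u, v) \<Rightarrow> if {u, v} \<in> edges H then of_bool ((X u, X v) \<in> S) else 1 - of_bool ((X u, X v) \<in> S))"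
          unfolding p(1) by (simp only: prod.case)
      qed
      also have "\<dots> = ?pat H X" by (rule ind_weight_of_bool[OF fin sym])
      finally show ?case .
    qed
    have wm: "ind_weight H W \<in> borel_measurable ?P"
      using borel_measurable_ind_weight[OF W, of H] by (simp only: V)
    have pm: "?pat H \<in> borel_measurable ?P"
    proof -
      have "Measurable.pred ?P (\<lambda>X. \<forall>u\<in>verts H. \<forall>v\<in>verts H. u \<noteq> v \<longrightarrow> ({u, v} \<in> edges H \<longleftrightarrow> (X u, X v) \<in> S))"
      proof (intro pred_intros_finite fin)
        fix u v assume "u \<in> verts H" "v \<in> verts H"
        then have [measurable]: "Measurable.pred ?P (\<lambda>X. (X u, X v) \<in> S)"
          using measurable_rel[of u ?K v] by (simp add: rel_def V)
        show "Measurable.pred ?P (\<lambda>X. u \<noteq> v \<longrightarrow> ({u, v} \<in> edges H \<longleftrightarrow> (X u, X v) \<in> S))" by measurable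
      qed
      then show ?thesis unfolding of_bool_def by measurable
    qed
    show "graphon_density H W = (\<integral>X. ?pat H X \<partial>?P)"
      using graphon_density_ind_weight[OF fin, of W] integral_cong_AE[OF wm pm ae] by (simp only: V)
    show "integrable ?P (?pat H)" by (rule P.integrable_const_bound[OF _ pm, of 1]) simp
  qed
  have "(\<Sum>H\<in>patterns m k. graphon_density H W) = (\<Sum>H\<in>patterns m k. \<integral>X. ?pat H X \<partial>?P)"
    by (intro sum.cong refl dens)
  also have "\<dots> = (\<integral>X. (\<Sum>H\<in>patterns m k. ?pat H X) \<partial>?P)"
    by (rule Bochner_Integration.integral_sum[symmetric]) (rule inte)
  also have "\<dots> = (\<integral>X. of_bool (mispredict m k (rel X)) \<partial>?P)"
  proof (intro Bochner_Integration.integral_cong refl)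
    fix X show "(\<Sum>H\<in>patterns m k. ?pat H X) = of_bool (mispredict m k (rel X))"
      using sum_patterns[OF m, of "rel X" k] sym by (simp add: rel_def[abs_def])
  qed
  also have "\<dots> = (\<integral>X. indicator {X \<in> space ?P. mispredict m k (rel X)} X \<partial>?P)"
    by (intro Bochner_Integration.integral_cong) (auto simp: indicator_def)
  also have "\<dots> = measure ?P {X \<in> space ?P. mispredict m k (rel X)}"
    unfolding Bochner_Integration.integral_indicator by (intro arg_cong2[where f=measure]) auto
  finally show ?thesis .
qed

section \<open>Counting\<close>

text \<open>Negation with \<open>m = N = j\<close> yields graphs of growing size, the j-th not
  compressible with \<open>j\<close> references. A limit argument that works with any fixed
  \<open>m\<close> refutes this, as compressibility is monotone in \<open>m\<close>.\<close>

lemma random_free_class_compressible: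
  assumes rf: "random_free_class Q" and "\<epsilon> > 0"
  shows "\<exists>m N. \<forall>G. simple_graph G \<longrightarrow> iso_class G \<in> Q \<longrightarrow> gsize G \<ge> N \<longrightarrow> compressible m \<epsilon> G"
proof (rule ccontr)
  assume "\<not> ?thesis"
  then have "\<forall>j. \<exists>G. simple_graph G \<and> iso_class G \<in> Q \<and> gsize G \<ge> j \<and> \<not> compressible j \<epsilon> G" by blast
  then obtain G where G: "\<And>j. simple_graph (G j)" "\<And>j. iso_class (G j) \<in> Q" "\<And>j. gsize (G j) \<ge> j"
    and bad: "\<And>j. \<not> compressible j \<epsilon> (G j)" by metis
  have lim: "filterlim (\<lambda>j. gsize (G j)) at_top sequentially"
    by (rule filterlim_at_top_mono[OF filterlim_ident]) (simp add: G(3))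
  obtain r W where r: "strict_mono r" and W: "graphon W"
    and conv: "\<And>H. simple_graph H \<Longrightarrow> (\<lambda>n. density H (G (r n))) \<longlonglongrightarrow> graphon_density H W"
    using graph_sequence_compactness[OF G(1) lim] by blast
  \<comment> \<open>Three representatives of this limit occur: \<open>W\<close> from compactness,
    the one picked by \<open>limit_density\<close>, and the random-free \<open>W'\<close>. They
    agree on all densities.\<close>
  define \<Gamma> where "\<Gamma> = graphon_equiv `` {W}"
  have "W \<in> \<Gamma>" using W by (simp add: \<Gamma>_def graphon_equiv_def)
  then have mem: "(SOME V. V \<in> \<Gamma>) \<in> \<Gamma>" by (rule someI[of "\<lambda>V. V \<in> \<Gamma>"])
  have same: "graphon_density H W = graphon_density H V" if "V \<in> \<Gamma>" "simple_graph H" for V H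
    using that unfolding \<Gamma>_def graphon_equiv_def by blast
  have dens: "limit_density H \<Gamma> = graphon_density H W" if "simple_graph H" for H
    unfolding limit_density_def using same[OF mem that] by simp
  have limr: "filterlim (\<lambda>n. gsize (G (r n))) at_top sequentially"
    by (rule filterlim_compose[OF lim filterlim_subseq[OF r]])
  have "\<Gamma> \<in> class_limits Q"
    unfolding class_limits_def graph_limits_def converges_to_def
    using G(1,2) limr conv W dens by (auto simp: \<Gamma>_def intro!: quotientI exI[of _ "\<lambda>n. G (r n)"])
  then obtain W' where W': "W' \<in> \<Gamma>" "random_free_graphon W'"
    using rf by (auto simp: random_free_class_def random_free_limit_def)
  then have gW': "graphon W'"
    by (auto simp: \<Gamma>_def graphon_equiv_def)
  define S where "S = {q \<in> space (unit_space \<Otimes>\<^sub>M unit_space). W' (fst q) (snd q) = 1}"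
  have "(\<lambda>q. W' (fst q) (snd q)) \<in> borel_measurable (unit_space \<Otimes>\<^sub>M unit_space)"
    using gW' by (simp add: graphon_def case_prod_unfold)
  then have "S \<in> sets (unit_space \<Otimes>\<^sub>M unit_space)" unfolding S_def by measurable
  then interpret sampled_relation unit_space S
    by (intro sampled_relation.intro sampled_relation_axioms.intro prob_space_unit)
  obtain m k where m: "m > 0" and small: "measure (sample_space (2 + m + k))
      {X \<in> space (sample_space (2 + m + k)). mispredict m k (rel X)} \<le> \<epsilon> / 2"
    using exists_good_predictor[of "\<epsilon> / 2"] \<open>\<epsilon> > 0\<close> by auto
  have le: "(\<Sum>H\<in>patterns m k. graphon_density H W) \<le> \<epsilon> / 2"
  proof -
    have "(\<Sum>H\<in>patterns m k. graphon_density H W) = (\<Sum>H\<in>patterns m k. graphon_density H W')"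
      by (intro sum.cong refl same[OF W'(1)]) (simp add: patterns_def)
    then show ?thesis
      using sum_graphon_density_patterns[OF gW' W'(2) m, of k] small by (simp add: S_def)
  qed
  have "(\<lambda>n. hom_density (verts (G (r n))) H (adj (G (r n)))) \<longlonglongrightarrow> graphon_density H W"
    if H: "H \<in> patterns m k" for H
  proof -
    have sH: "simple_graph H" using H by (simp add: patterns_def)
    show ?thesis
      using tendsto_diff[OF conv[OF sH] hom_density_adj_tendsto[OF G(1) limr sH]] by simp
  qed
  then have "(\<lambda>n. \<Sum>H\<in>patterns m k. hom_density (verts (G (r n))) H (adj (G (r n))))
      \<longlonglongrightarrow> (\<Sum>H\<in>patterns m k. graphon_density H W)" by (rule tendsto_sum)
  moreover have "(\<Sum>H\<in>patterns m k. graphon_density H W) < \<epsilon>"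
    using le \<open>\<epsilon> > 0\<close> by linarith
  ultimately have "\<forall>\<^sub>F n in sequentially. (\<Sum>H\<in>patterns m k. hom_density (verts (G (r n))) H (adj (G (r n)))) < \<epsilon>"
    by (rule order_tendstoD(2))
  then have "\<forall>\<^sub>F n in sequentially. False"
    using eventually_ge_at_top[of m]
  proof eventually_elim
    case (elim n)
    have "compressible m \<epsilon> (G (r n))"
      using elim(1) by (intro compressible_of_few_mispredictions[OF G(1) m, where k=k]) simp
    moreover have "m \<le> r n" using elim(2) seq_suble[OF r, of n] by linarith
    ultimately show False using compressible_mono bad by blast
  qed
  then show False by simp
qed

text \<open>Exponential Markov bound in place of entropy: give each subset the weight
  \<open>x ^ card E\<close>. All weights sum to \<open>(1 + x) ^ card A\<close>, and each counted
  subset weighs at least \<open>x powr s\<close>.\<close>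

lemma card_small_subsets:
  assumes "finite A" and x: "0 < x" "x \<le> 1"
  shows "real (card {E. E \<subseteq> A \<and> real (card E) \<le> s}) \<le> x powr (- s) * (1 + x) ^ card A"
proof -
  have "(1 + x) ^ card A = (\<Sum>E\<in>Pow A. x ^ card E)"
    using prod_add[OF assms(1), of "\<lambda>_. x" "\<lambda>_. 1"] by (simp add: add.commute)
  also have "\<dots> \<ge> (\<Sum>E\<in>{E. E \<subseteq> A \<and> real (card E) \<le> s}. x ^ card E)"
    using assms by (intro sum_mono2) auto
  finally have "(\<Sum>E\<in>{E. E \<subseteq> A \<and> real (card E) \<le> s}. x ^ card E) \<le> (1 + x) ^ card A" .
  moreover have "(\<Sum>E\<in>{E. E \<subseteq> A \<and> real (card E) \<le> s}. x powr s) \<le>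
      (\<Sum>E\<in>{E. E \<subseteq> A \<and> real (card E) \<le> s}. x ^ card E)"
  proof (intro sum_mono)
    fix E assume "E \<in> {E. E \<subseteq> A \<and> real (card E) \<le> s}"
    then have "x powr s \<le> x powr real (card E)" using x by (intro powr_mono') auto
    then show "x powr s \<le> x ^ card E" using x by (simp add: powr_realpow)
  qed
  ultimately have "real (card {E. E \<subseteq> A \<and> real (card E) \<le> s}) * x powr s \<le> (1 + x) ^ card A" by simp
  then show ?thesis using x by (simp add: powr_minus field_simps)
qed

lemma class_representative:
  assumes Q: "Q \<subseteq> unlabelled_graphs" and C: "C \<in> class_level Q n"
  shows "\<exists>K. simple_graph K \<and> verts K = {..<n} \<and> C = iso_class K"
proof -
  obtain G where G: "G \<in> C" "gsize G = n" and CQ: "C \<in> Q" using C by (auto simp: class_level_def)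
  then have Cq: "C \<in> {G. simple_graph G} // graph_iso" using Q by (auto simp: unlabelled_graphs_def)
  then have s: "simple_graph G" using G(1) in_quotient_imp_subset[OF equiv_graph_iso Cq] by blast
  then have "finite (verts G)" by (simp add: simple_graph_def)
  then obtain h where h: "bij_betw h (verts G) {..<n}"
    using G ex_bij_betw_finite_nat[of "verts G"] by (auto simp: gsize_def atLeast0LessThan)
  then have im: "h ` verts G = {..<n}" and inj: "inj_on h (verts G)" by (auto simp: bij_betw_def)
  define K :: graph where "K = ({..<n}, {{h u, h v} |u v. u \<in> verts G \<and> v \<in> verts G \<and> u \<noteq> v \<and> {u, v} \<in> edges G})"
  have K: "verts K = {..<n}"
    "edges K = {{h u, h v} |u v. u \<in> verts G \<and> v \<in> verts G \<and> u \<noteq> v \<and> {u, v} \<in> edges G}"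
    by (auto simp: K_def verts_def edges_def)
  have "verts K \<noteq> {}" using s im K(1) by (auto simp: simple_graph_def)
  moreover have "edges K \<subseteq> {{u, v} |u v. u \<in> verts K \<and> v \<in> verts K \<and> u \<noteq> v}"
  proof
    fix e assume "e \<in> edges K"
    then obtain u v where uv: "e = {h u, h v}" "u \<in> verts G" "v \<in> verts G" "u \<noteq> v" unfolding K(2) by blast
    then have "h u \<noteq> h v" "h u \<in> verts K" "h v \<in> verts K" using inj im K(1) by (auto simp: inj_on_def)
    then show "e \<in> {{u, v} |u v. u \<in> verts K \<and> v \<in> verts K \<and> u \<noteq> v}" using uv(1) by blast
  qed
  ultimately have sK: "simple_graph K" using K(1) by (simp add: simple_graph_def)
  have "{u, v} \<in> edges G \<longleftrightarrow> {h u, h v} \<in> edges K" if "u \<in> verts G" "v \<in> verts G" "u \<noteq> v" for u v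
  proof
    assume "{h u, h v} \<in> edges K"
    then obtain a b where ab: "{h u, h v} = {h a, h b}" "a \<in> verts G" "b \<in> verts G" "{a, b} \<in> edges G"
      unfolding K(2) by blast
    then have "u = a \<and> v = b \<or> u = b \<and> v = a"
      using that inj by (auto simp: doubleton_eq_iff inj_on_def)
    then show "{u, v} \<in> edges G" using ab(4) by (auto simp: insert_commute)
  qed (use that K(2) in blast)
  then have "(G, K) \<in> graph_iso" using s sK h K(1) unfolding graph_iso_def by auto
  moreover have "C = graph_iso `` {G}"
    using Cq
  proof (rule quotientE)
    fix A assume A: "C = graph_iso `` {A}"
    then show "C = graph_iso `` {G}" using G(1) equiv_class_eq[OF equiv_graph_iso, of A G] by simp
  qed
  ultimately have "C = iso_class K"
    unfolding iso_class_def using equiv_class_eq[OF equiv_graph_iso] by simp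
  then show ?thesis using sK K(1) by blast
qed

text \<open>A graph is recovered from the assignment \<open>i\<close>, the reference neighbourhoods
  \<open>g\<close> and the set \<open>E\<close> of wrong predictions; the three factors count these
  data.\<close>

lemma card_class_level_le:
  assumes Q: "Q \<subseteq> unlabelled_graphs"
    and comp: "\<And>G. simple_graph G \<Longrightarrow> iso_class G \<in> Q \<Longrightarrow> gsize G = n \<Longrightarrow> compressible m \<epsilon> G"
  shows "card (class_level Q n) \<le>
    m ^ n * 2 ^ (m * n) * card {E. E \<subseteq> {..<n} \<times> {..<n} \<and> real (card E) \<le> \<epsilon> * (real n)\<^sup>2}"
proof -
  let ?Ex = "{E. E \<subseteq> {..<n} \<times> {..<n} \<and> real (card E) \<le> \<epsilon> * (real n)\<^sup>2}"
  let ?codes = "({..<n} \<rightarrow>\<^sub>E {..<m}) \<times> Pow ({..<m} \<times> {..<n}) \<times> ?Ex"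
  \<comment> \<open>Adjacency is the prediction corrected on \<open>E\<close>. An edge is decoded if
    either order of its ends says so; for the code of a graph both orders agree, since both return
    its adjacency.\<close>
  define decode :: "(nat \<Rightarrow> nat) \<times> (nat \<times> nat) set \<times> (nat \<times> nat) set \<Rightarrow> graph" where
    "decode = (\<lambda>(i, g, E). ({..<n}, {{x, y} |x y. x < n \<and> y < n \<and> x \<noteq> y \<and> ((i x, y) \<in> g) \<noteq> ((x, y) \<in> E)}))"
  have finE: "finite ?Ex" by (rule finite_subset[of _ "Pow ({..<n} \<times> {..<n})"]) auto
  have fin: "finite ?codes" using finE by (intro finite_cartesian_product finite_PiE) auto
  have "class_level Q n \<subseteq> (\<lambda>c. iso_class (decode c)) ` ?codes"
  proof
    fix C assume C: "C \<in> class_level Q n"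
    then obtain K where K: "simple_graph K" "verts K = {..<n}" "C = iso_class K"
      using class_representative[OF Q] by blast
    have "compressible m \<epsilon> K" using C K by (intro comp) (auto simp: class_level_def gsize_def)
    then obtain i g where i: "\<And>x. i x < m"
      and E: "real (card {(x, y) \<in> {..<n} \<times> {..<n}. ({x, y} \<in> edges K) \<noteq> g (i x) y}) \<le> \<epsilon> * (real n)\<^sup>2"
      unfolding compressible_def K(2) gsize_def by auto
    define c where "c = (restrict i {..<n}, {(j, y) \<in> {..<m} \<times> {..<n}. g j y},
        {(x, y) \<in> {..<n} \<times> {..<n}. ({x, y} \<in> edges K) \<noteq> g (i x) y})"
    have "c \<in> ?codes" using i E by (auto simp: c_def)
    moreover have "decode c = K"
    proof -
      have "snd (decode c) = {{x, y} |x y. x < n \<and> y < n \<and> x \<noteq> y \<and> {x, y} \<in> edges K}"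
        using i by (auto simp: decode_def c_def)
      also have "\<dots> = edges K"
      proof
        show "edges K \<subseteq> {{x, y} |x y. x < n \<and> y < n \<and> x \<noteq> y \<and> {x, y} \<in> edges K}"
        proof
          fix e assume e: "e \<in> edges K"
          then obtain x y where "e = {x, y}" "x < n" "y < n" "x \<noteq> y"
            using K(1,2) unfolding simple_graph_def by blast
          then show "e \<in> {{x, y} |x y. x < n \<and> y < n \<and> x \<noteq> y \<and> {x, y} \<in> edges K}" using e by blast
        qed
      qed auto
      finally show ?thesis using K(2) by (simp add: prod_eq_iff verts_def edges_def decode_def case_prod_unfold)
    qed
    ultimately show "C \<in> (\<lambda>c. iso_class (decode c)) ` ?codes" using K(3) by (intro image_eqI[of _ _ c]) auto
  qed
  then have "card (class_level Q n) \<le> card ((\<lambda>c. iso_class (decode c)) ` ?codes)"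
    by (intro card_mono finite_imageI fin)
  also have "\<dots> \<le> card ?codes" by (rule card_image_le[OF fin])
  also have "\<dots> = m ^ n * 2 ^ (m * n) * card ?Ex"
    by (simp add: card_cartesian_product card_funcsetE card_Pow)
  finally show ?thesis .
qed

theorem corollary1p4:
  fixes Q :: "graph set set"
  assumes "Q \<subseteq> unlabelled_graphs"
    and "random_free_class Q"
  shows "\<forall>\<epsilon>>0. \<forall>\<^sub>F n in sequentially.
           real (card (class_level Q n)) \<le> 2 powr (\<epsilon> * (real n)\<^sup>2)"
proof (intro allI impI)
  fix \<epsilon> :: real assume \<epsilon>: "\<epsilon> > 0"
  \<comment> \<open>Each of three factors may use \<open>\<epsilon> / 3\<close>:
    \<open>(1 + x) ^ (n^2)\<close>, \<open>x powr (- \<delta> n^2)\<close>, and the references. The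
    first one dictates \<open>x\<close>.\<close>
  define x where "x = min 1 (2 powr (\<epsilon> / 3) - 1)"
  have x: "0 < x" "x \<le> 1" using \<epsilon> by (auto simp: x_def)
  have x1: "1 + x \<le> 2 powr (\<epsilon> / 3)" by (simp add: x_def)
  define l where "l = log 2 (1 / x)"
  have l: "l \<ge> 0" "x = 2 powr (- l)" using x by (auto simp: l_def powr_minus)
  \<comment> \<open>The second factor is \<open>2 powr (\<delta> l n^2)\<close>;
    \<open>l + 1\<close> guards against \<open>l = 0\<close>, which occurs for \<open>x = 1\<close>.
    The number of references depends on \<open>\<delta>\<close> and is fixed afterwards.\<close>
  define \<delta> where "\<delta> = \<epsilon> / (3 * (l + 1))"
  have \<delta>: "\<delta> > 0" "\<delta> * l \<le> \<epsilon> / 3" using l(1) \<epsilon> by (auto simp: \<delta>_def field_simps)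
  obtain m0 N where comp0: "\<And>G. simple_graph G \<Longrightarrow> iso_class G \<in> Q \<Longrightarrow> gsize G \<ge> N \<Longrightarrow> compressible m0 \<delta> G"
    using random_free_class_compressible[OF assms(2) \<delta>(1)] by blast
  \<comment> \<open>A positive \<open>m\<close> makes \<open>log 2 m\<close> the true exponent of
    the factor \<open>m ^ n\<close>. Together with \<open>2 ^ (m * n)\<close> it is only exponential
    in \<open>n\<close>, thus below its share for large \<open>n\<close>.\<close>
  define m where "m = Suc m0"
  have comp: "compressible m \<delta> G" if "simple_graph G" "iso_class G \<in> Q" "gsize G \<ge> N" for G
    using compressible_mono[OF comp0[OF that]] by (simp add: m_def)
  define b where "b = log 2 m + m"
  show "\<forall>\<^sub>F n in sequentially. real (card (class_level Q n)) \<le> 2 powr (\<epsilon> * (real n)\<^sup>2)"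
    using eventually_ge_at_top[of N] eventually_ge_at_top[of "nat \<lceil>3 * b / \<epsilon>\<rceil>"]
  proof eventually_elim
    case (elim n)
    let ?N = "(real n)\<^sup>2"
    let ?E = "{E. E \<subseteq> {..<n} \<times> {..<n} \<and> real (card E) \<le> \<delta> * ?N}"
    have "card (class_level Q n) \<le> m ^ n * 2 ^ (m * n) * card ?E"
      using comp elim(1) by (intro card_class_level_le[OF assms(1)]) auto
    then have "real (card (class_level Q n)) \<le> real (m ^ n * 2 ^ (m * n) * card ?E)"
      by (simp only: of_nat_le_iff)
    also have "\<dots> = (real m ^ n * 2 ^ (m * n)) * real (card ?E)" by simp
    also have "\<dots> \<le> 2 powr (\<epsilon> / 3 * ?N) * (2 powr (\<epsilon> / 3 * ?N) * 2 powr (\<epsilon> / 3 * ?N))"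
    proof (rule mult_mono)
      have "real m ^ n = (2 powr log 2 m) powr n" by (simp add: powr_realpow m_def)
      also have "\<dots> = 2 powr (log 2 m * n)" by (rule powr_powr)
      finally have "real m ^ n * 2 ^ (m * n) = 2 powr (b * n)"
        by (simp add: b_def distrib_right powr_add powr_realpow[symmetric])
      also have "\<dots> \<le> 2 powr (\<epsilon> / 3 * ?N)"
      proof -
        have "3 * b / \<epsilon> \<le> n" using elim(2) by linarith
        then have "b \<le> \<epsilon> / 3 * n" using \<epsilon> by (simp add: field_simps)
        then have "b * n \<le> \<epsilon> / 3 * n * n" by (intro mult_right_mono) auto
        then show ?thesis by (simp add: power2_eq_square)
      qed
      finally show "real m ^ n * 2 ^ (m * n) \<le> 2 powr (\<epsilon> / 3 * ?N)" .
      have "real (card ?E) \<le> x powr (- (\<delta> * ?N)) * (1 + x) ^ card ({..<n} \<times> {..<n})"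
        by (intro card_small_subsets x) simp
      also have "\<dots> \<le> 2 powr (\<epsilon> / 3 * ?N) * 2 powr (\<epsilon> / 3 * ?N)"
      proof (rule mult_mono)
        have "x powr (- (\<delta> * ?N)) = 2 powr (\<delta> * l * ?N)"
          by (subst l(2), subst powr_powr) (simp add: mult_ac)
        also have "\<dots> \<le> 2 powr (\<epsilon> / 3 * ?N)" using \<delta>(2) by (intro powr_mono mult_right_mono) auto
        finally show "x powr (- (\<delta> * ?N)) \<le> 2 powr (\<epsilon> / 3 * ?N)" .
        have "(1 + x) ^ card ({..<n} \<times> {..<n}) \<le> (2 powr (\<epsilon> / 3)) ^ card ({..<n} \<times> {..<n})"
          using x x1 by (intro power_mono) auto
        also have "\<dots> = 2 powr (\<epsilon> / 3 * ?N)"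
          by (simp add: card_cartesian_product powr_realpow[symmetric] powr_powr power2_eq_square)
        finally show "(1 + x) ^ card ({..<n} \<times> {..<n}) \<le> 2 powr (\<epsilon> / 3 * ?N)" .
      qed (use x in auto)
      finally show "real (card ?E) \<le> 2 powr (\<epsilon> / 3 * ?N) * 2 powr (\<epsilon> / 3 * ?N)" .
    qed auto
    also have "\<dots> = 2 powr (\<epsilon> * ?N)" by (simp add: powr_add[symmetric])
    finally show ?case .
  qed
qed

end
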